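(* Let $\ell,\ell'$ be geodesic lines of $\mathbb{H}^2$ and $g,g'\in G_0$. The following are equivalent: (1) the right $\mathrm{AdS}$ crooked planes $g\mathsf{C}^*(\ell)$ and $g'\mathsf{C}^*(\ell')$ are disjoint; (2) there exists $K>0$ such that $d(g\cdot x,g'\cdot x')-d(x,x')\leq -K$ for all $x\in\ell$, $x'\in\ell'$; (3) for any endpoint $\xi$ of $\ell$ and any endpoint $\xi'$ of $\ell'$, we have $\xi\neq\xi'$ and $F_{g,g'}(\xi,\xi')<0$. If these conditions hold, then $\ell$ and $\ell'$ have disjoint closures in $\overline{\mathbb{H}^2}$. Moreover, for given transverse orientations of $\ell$ and $\ell'$, the closed right crooked half-spaces $g\,\overline{\mathsf{H}^*_+(\ell)}$ and $g'\,\overline{\mathsf{H}^*_+(\ell')}$ are disjoint if and only if (1), (2), (3) hold and $\ell$ and $\ell'$ are transversely oriented away from each other.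
   Context: $\mathbb{H}^2$ is the hyperbolic plane with metric $d$, $\overline{\mathbb{H}^2}=\mathbb{H}^2\cup\partial_\infty\mathbb{H}^2$, $G_0=\mathrm{PSL}_2(\mathbb{R})$, and $\mathrm{AdS}^3$ is identified with $G_0$ (with bi-invariant Lorentzian metric from half the Killing form). For a geodesic line $\ell$ with closure $\overline\ell$, $\mathsf{C}^*(\ell)$ is the set of $h\in G_0$ having a nonattracting fixed point in $\overline\ell$ (identity: every point; elliptic: its fixed point in $\mathbb{H}^2$; parabolic: its fixed point at infinity; hyperbolic: its repelling fixed point). If $\ell$ is transversely oriented, $\mathsf{H}^*_+(\ell)$ is the set of nontrivial $h\in G_0$ having a nonattracting fixed point in $\overline{\mathbb{H}^2}\smallsetminus\overline\ell$ on the positive side of $\overline\ell$, and $\overline{\mathsf{H}^*_+(\ell)}=\mathsf{H}^*_+(\ell)\cup\mathsf{C}^*(\ell)$. For $g,g'\in G_0$, $F_{g,g'}(x,x')=d(g\cdot x,g'\cdot x')-d(x,x')$ for $x,x'\in\mathbb{H}^2$, and for ideal points $\xi,\xi'$ (not with both $\xi=\xi'$ and $g\cdot\xi=g'\cdot\xi'$) it is the continuous extension, given by $F_{g,g'}(\xi,\xi')=d(g\cdot B,g'\cdot B')-d(B,B')$ for any sufficiently small horoballs $B,B'$ centered at $\xi,\xi'$; here the distance between disjoint sets is the infimum of pointwise distances, and the distance between concentric horoballs is declared to be $-\infty$. *)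

theory Defs
  imports "HOL-Analysis.Analysis"
begin

text \<open>Model: the Poincare disk. The hyperbolic plane is the open unit disk in the
complex plane, its closure (with the circle at infinity) is the closed unit disk.\<close>

definition H2 :: "complex set" where "H2 = ball 0 1"
definition H2bar :: "complex set" where "H2bar = cball 0 1"

definition hdist :: "complex \<Rightarrow> complex \<Rightarrow> real" where
  "hdist z w = arcosh (1 + 2 * (cmod (z - w))^2 / ((1 - (cmod z)^2) * (1 - (cmod w)^2)))"

text \<open>The action of the matrix [[a,b],[c,d]] of SL2(R) on the closed disk, obtained by
conjugating the upper half-plane action through the Cayley transform
(the corresponding SU(1,1) matrix is [[al, be],[cnj be, cnj al]]). Outside the closed disk
the map is declared to be the identity, so that composition of maps corresponds exactly to
the group law and M, -M give the same map.\<close>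
definition psl_act :: "real \<Rightarrow> real \<Rightarrow> real \<Rightarrow> real \<Rightarrow> complex \<Rightarrow> complex" where
  "psl_act a b c d z =
     (let al = Complex ((a + d) / 2) ((b - c) / 2);
          be = Complex ((a - d) / 2) (- (b + c) / 2)
      in if cmod z \<le> 1 then (al * z + be) / (cnj be * z + cnj al) else z)"

definition G0 :: "(complex \<Rightarrow> complex) set" where
  "G0 = {psl_act a b c d | a b c d. a * d - b * c = 1}"

definition lmul :: "(complex \<Rightarrow> complex) \<Rightarrow> (complex \<Rightarrow> complex) set \<Rightarrow> (complex \<Rightarrow> complex) set" where
  "lmul g S = (\<lambda>h. g \<circ> h) ` S"

definition geodesic_line :: "complex set \<Rightarrow> bool" where
  "geodesic_line l \<longleftrightarrow> (\<exists>\<gamma>. (\<forall>t. \<gamma> t \<in> H2) \<and> (\<forall>s t. hdist (\<gamma> s) (\<gamma> t) = \<bar>s - t\<bar>) \<and> l = range \<gamma>)"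

definition endpoints :: "complex set \<Rightarrow> complex set" where
  "endpoints l = closure l - l"

definition fixpts :: "(complex \<Rightarrow> complex) \<Rightarrow> complex set" where
  "fixpts h = {p \<in> H2bar. h p = p}"

text \<open>Attracting fixed point of a hyperbolic element (exactly two fixed points in the closed
disk): forward orbits of all points of H2 converge to it.\<close>
definition attracting_fp :: "(complex \<Rightarrow> complex) \<Rightarrow> complex \<Rightarrow> bool" where
  "attracting_fp h p \<longleftrightarrow> card (fixpts h) = 2 \<and> p \<in> fixpts h \<and>
      (\<forall>x \<in> H2. (\<lambda>n. (h ^^ n) x) \<longlonglongrightarrow> p)"

text \<open>Nonattracting fixed points (identity: all points; elliptic: its interior fixed point;
parabolic: its ideal fixed point; hyperbolic: its repelling fixed point).\<close>
definition nonattr_fixpts :: "(complex \<Rightarrow> complex) \<Rightarrow> complex set" where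
  "nonattr_fixpts h = {p \<in> fixpts h. \<not> attracting_fp h p}"

definition Cstar :: "complex set \<Rightarrow> (complex \<Rightarrow> complex) set" where
  "Cstar l = {h \<in> G0. nonattr_fixpts h \<inter> closure l \<noteq> {}}"

text \<open>Transverse orientation: a choice of one of the (two) connected components of
H2bar minus the closure of l, declared the positive side.\<close>
definition side_of :: "complex set \<Rightarrow> complex set \<Rightarrow> bool" where
  "side_of l P \<longleftrightarrow> (\<exists>x \<in> H2bar - closure l. P = connected_component_set (H2bar - closure l) x)"

definition Hstar_plus :: "complex set \<Rightarrow> complex set \<Rightarrow> (complex \<Rightarrow> complex) set" where
  "Hstar_plus l P = {h \<in> G0. h \<noteq> id \<and> nonattr_fixpts h \<inter> P \<noteq> {}}"

definition Hstar_plus_closed :: "complex set \<Rightarrow> complex set \<Rightarrow> (complex \<Rightarrow> complex) set" where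
  "Hstar_plus_closed l P = Hstar_plus l P \<union> Cstar l"

definition oriented_away :: "complex set \<Rightarrow> complex set \<Rightarrow> complex set \<Rightarrow> complex set \<Rightarrow> bool" where
  "oriented_away l P l' P' \<longleftrightarrow>
     closure l' \<subseteq> H2bar - closure l - P \<and> closure l \<subseteq> H2bar - closure l' - P'"

definition horoball :: "complex \<Rightarrow> real \<Rightarrow> complex set" where
  "horoball xi r = ball ((1 - r) * xi) r"

definition hb_dist :: "complex \<Rightarrow> complex set \<Rightarrow> complex \<Rightarrow> complex set \<Rightarrow> ereal" where
  "hb_dist xi B xi' B' =
     (if xi = xi' then - \<infinity> else (INF p \<in> B \<times> B'. ereal (hdist (fst p) (snd p))))"

definition F_ideal :: "(complex \<Rightarrow> complex) \<Rightarrow> (complex \<Rightarrow> complex) \<Rightarrow> complex \<Rightarrow> complex \<Rightarrow> ereal" where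
  "F_ideal g g' xi xi' = (THE c. \<exists>r0>0. \<forall>r r'. 0 < r \<and> r < r0 \<and> 0 < r' \<and> r' < r0 \<longrightarrow>
      hb_dist (g xi) (g ` horoball xi r) (g' xi') (g' ` horoball xi' r')
      - hb_dist xi (horoball xi r) xi' (horoball xi' r') = c)"

end

theory Submission
  imports Defs
begin

text \<open>Represent \<open>PSL\<^sub>2(\<real>)\<close> by \<open>SU(1,1)\<close>, acting on \<open>spinors\<close> \<open>\<zeta> \<in> \<complex> = \<real>\<^sup>2\<close> by
  \<open>\<zeta> \<mapsto> \<alpha> \<zeta> + \<beta> cnj \<zeta>\<close> and preserving \<open>area \<zeta> \<omega>\<close>. Ideal points are the spinors up to real scalars,
  points of the closed disk are sums of two of the null vectors \<open>(|\<zeta>|\<^sup>2, \<zeta>\<^sup>2)\<close> up to positive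
  scalars, and the Lorentzian product of two null vectors is \<open>2 (area \<zeta> \<omega>)\<^sup>2\<close>; for points of the
  hyperbolic plane the normalized product is \<open>cosh\<close> of the distance. Condition (3) becomes
  \<open>|area (g a) (g' b)| < |area a b|\<close> for all endpoint spinors \<open>a\<close> of \<open>\<ell>\<close> and \<open>b\<close> of \<open>\<ell>'\<close>. By
  bilinearity it yields a uniform ratio of the values of \<open>cosh\<close>, which is (2). A fixed point of \<open>c\<close> is
  nonattracting iff \<open>c\<close> scales its null vector by a factor \<open>\<le> 1\<close>; hence a common element
  \<open>g c = g' c'\<close> cannot decrease the product of the fixed vectors, so (3) implies (1). If (3) fails,
  a common element comes from a linear map sending \<open>a, b\<close> to multiples of \<open>g a, g' b\<close>, or from two
  interior points whose distance is unchanged. For half-planes facing away from each other, the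
  areas of the endpoint spinors have equal signs, and bilinearity works for all pairs of points.\<close>

text \<open>Disjointness concerns all pairs of fixed points, interior and ideal, while (3) sees only
  four pairs of endpoints. Every line is the image of the real diameter under some
  \<open>mob k\<close>, with endpoint spinors \<open>spin k 1\<close> and
  \<open>spin k \<i>\<close>. Its points come from nonnegative combinations of the two null vectors,
  those of its half-plane from the quadrant spanned by the two spinors. On lines only squared areas
  are added, so signs do not matter; on half-planes the areas themselves are added, and the
  orientation is what rules out cancellation. The delicate case is a common endpoint. A map of
  determinant 1 cannot send parallel spinors to nonparallel ones, so the linear construction breaks
  down if g and g' separate that endpoint. Near it the change of distance is then positive, near
  another pair of endpoints it is negative, and a zero supplies the interior points. Conversely, the
  gap K in (2) keeps the lines at distance at least K and so excludes a common endpoint.\<close>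

section \<open>Moebius transformations of the closed disk and their spinor action\<close>

text \<open>The pair \<open>(\<alpha>, \<beta>)\<close> stands for the matrix \<open>[[\<alpha>, \<beta>], [cnj \<beta>, cnj \<alpha>]]\<close>.\<close>

definition SU :: "(complex \<times> complex) set" where
  "SU = {m. (cmod (fst m))\<^sup>2 - (cmod (snd m))\<^sup>2 = 1}"

definition den :: "complex \<times> complex \<Rightarrow> complex \<Rightarrow> complex" where
  "den m z = cnj (snd m) * z + cnj (fst m)"

definition mob :: "complex \<times> complex \<Rightarrow> complex \<Rightarrow> complex" where
  "mob m z = (if cmod z \<le> 1 then (fst m * z + snd m) / den m z else z)"

definition mmul :: "complex \<times> complex \<Rightarrow> complex \<times> complex \<Rightarrow> complex \<times> complex" where
  "mmul m n = (fst m * fst n + snd m * cnj (snd n), fst m * snd n + snd m * cnj (fst n))"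

definition minv :: "complex \<times> complex \<Rightarrow> complex \<times> complex" where
  "minv m = (cnj (fst m), - snd m)"

text \<open>The reciprocal of the conformal factor \<open>|h'(z)|\<close>; at a fixed point, the factor by which
  the cone vector is scaled.\<close>

definition jac :: "complex \<times> complex \<Rightarrow> complex \<Rightarrow> real" where
  "jac m z = (cmod (den m z))\<^sup>2"

text \<open>The matrix applied to the column (\<zeta>, cnj \<zeta>). Columns of this shape form a
  real plane that SU(1,1) preserves, and \<open>pt\<close> is the quotient of their entries, so on
  the circle \<open>mob\<close> is the projectivized linear action.\<close>

definition spin :: "complex \<times> complex \<Rightarrow> complex \<Rightarrow> complex" where
  "spin m \<zeta> = fst m * \<zeta> + snd m * cnj \<zeta>"

definition area :: "complex \<Rightarrow> complex \<Rightarrow> real" where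
  "area \<zeta> \<omega> = Im (cnj \<zeta> * \<omega>)"

definition pt :: "complex \<Rightarrow> complex" where
  "pt \<zeta> = \<zeta> / cnj \<zeta>"

text \<open>The Lorentzian product of the cone vectors \<open>(1 + |z|\<^sup>2, 2 z)\<close> and \<open>(1 + |w|\<^sup>2, 2 w)\<close>.\<close>

definition lform :: "complex \<Rightarrow> complex \<Rightarrow> real" where
  "lform z w = (1 + (cmod z)\<^sup>2) * (1 + (cmod w)\<^sup>2) - 4 * Re (z * cnj w)"

lemma SU_cnj: "m \<in> SU \<Longrightarrow> fst m * cnj (fst m) - snd m * cnj (snd m) = 1"
  unfolding SU_def
  by (metis (mono_tags, lifting) complex_norm_square mem_Collect_eq of_real_1 of_real_diff)

lemma SU_iff: "m \<in> SU \<longleftrightarrow> fst m * cnj (fst m) - snd m * cnj (snd m) = 1"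
proof
  assume "fst m * cnj (fst m) - snd m * cnj (snd m) = 1"
  then have "complex_of_real ((cmod (fst m))\<^sup>2 - (cmod (snd m))\<^sup>2) = of_real 1"
    by (simp only: complex_norm_square of_real_diff of_real_1)
  then show "m \<in> SU"
    unfolding SU_def by (simp only: of_real_eq_iff mem_Collect_eq)
qed (rule SU_cnj)

lemma SU_cmod_less: "m \<in> SU \<Longrightarrow> cmod (snd m) < cmod (fst m)"
  by (rule power_less_imp_less_base[of _ 2]) (auto simp: SU_def)

lemma G0_eq: "G0 = mob ` SU"
proof (intro equalityI subsetI)
  fix h assume "h \<in> G0"
  then obtain a b c d :: real where h: "h = psl_act a b c d" and det: "a * d - b * c = 1"
    by (auto simp: G0_def)
  let ?m = "(Complex ((a + d) / 2) ((b - c) / 2), Complex ((a - d) / 2) (- (b + c) / 2))"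
  have "?m \<in> SU" using det
    by (simp add: SU_def cmod_power2) (simp add: field_simps power2_eq_square)
  moreover have "h = mob ?m"
    by (rule ext) (simp add: h psl_act_def mob_def den_def Let_def)
  ultimately show "h \<in> mob ` SU" by blast
next
  fix h assume "h \<in> mob ` SU"
  then obtain m where m: "m \<in> SU" and h: "h = mob m" by auto
  obtain p q r s where ab: "m = (Complex p q, Complex r s)" by (metis complex_surj surj_pair)
  have "(p + r) * (p - r) - (q - s) * (- q - s) = 1"
    using m by (simp add: ab SU_def cmod_power2) (simp add: algebra_simps power2_eq_square)
  moreover have "h = psl_act (p + r) (q - s) (- q - s) (p - r)"
    by (rule ext) (simp add: h ab psl_act_def mob_def den_def Let_def)
  ultimately show "h \<in> G0" unfolding G0_def by blast
qed

lemma den_nz: assumes "m \<in> SU" "cmod z \<le> 1" shows "den m z \<noteq> 0"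
proof
  assume "den m z = 0"
  then have "cnj (fst m) = - (cnj (snd m) * z)" by (simp add: den_def eq_neg_iff_add_eq_0 add.commute)
  then have "cmod (fst m) = cmod (snd m) * cmod z"
    by (metis complex_mod_cnj norm_minus_cancel norm_mult)
  also have "\<dots> \<le> cmod (snd m) * 1" using assms by (intro mult_left_mono) auto
  finally show False using SU_cmod_less[OF assms(1)] by simp
qed

lemma jac_pos: "m \<in> SU \<Longrightarrow> cmod z \<le> 1 \<Longrightarrow> jac m z > 0"
  using den_nz by (simp add: jac_def)

text \<open>A matrix in \<open>SU\<close> preserves the Hermitian form |v|^2 - |u|^2 on columns (u,
  v); here it is evaluated at (z, 1) and at its image.\<close>

lemma one_minus_num:
  assumes "m \<in> SU"
  shows "(cmod (den m z))\<^sup>2 - (cmod (fst m * z + snd m))\<^sup>2 = 1 - (cmod z)\<^sup>2"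
proof -
  have "complex_of_real ((cmod (den m z))\<^sup>2 - (cmod (fst m * z + snd m))\<^sup>2)
      = den m z * cnj (den m z) - (fst m * z + snd m) * cnj (fst m * z + snd m)"
    by (simp only: complex_norm_square of_real_diff)
  also have "\<dots> = (fst m * cnj (fst m) - snd m * cnj (snd m)) * (1 - z * cnj z)"
    by (simp add: den_def algebra_simps)
  also have "\<dots> = 1 - z * cnj z" using SU_cnj[OF assms] by simp
  also have "\<dots> = of_real (1 - (cmod z)\<^sup>2)" by (simp only: complex_norm_square of_real_diff of_real_1)
  finally show ?thesis by (simp only: of_real_eq_iff)
qed

lemma mob_one_minus:
  assumes "m \<in> SU" "cmod z \<le> 1"
  shows "1 - (cmod (mob m z))\<^sup>2 = (1 - (cmod z)\<^sup>2) / jac m z"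
proof -
  have "1 - (cmod (mob m z))\<^sup>2 = ((cmod (den m z))\<^sup>2 - (cmod (fst m * z + snd m))\<^sup>2) / jac m z"
    using den_nz[OF assms] assms(2)
    by (simp add: mob_def jac_def norm_divide power_divide diff_divide_distrib)
  then show ?thesis by (simp only: one_minus_num[OF assms(1)])
qed

lemma cmod_square_le1: "cmod z \<le> 1 \<longleftrightarrow> (cmod z)\<^sup>2 \<le> 1"
  by (simp add: power_le_one_iff)

lemma cmod_square_less1: "cmod z < 1 \<longleftrightarrow> (cmod z)\<^sup>2 < 1"
  by (simp add: power_less_one_iff)

lemma mob_closed: assumes "m \<in> SU" "cmod z \<le> 1" shows "cmod (mob m z) \<le> 1"
proof -
  have "(1 - (cmod z)\<^sup>2) / jac m z \<ge> 0" using assms jac_pos[OF assms] cmod_square_le1[of z] by simp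
  then show ?thesis using mob_one_minus[OF assms] cmod_square_le1[of "mob m z"] by linarith
qed

lemma mob_open: assumes "m \<in> SU" "cmod z < 1" shows "cmod (mob m z) < 1"
proof -
  have "(1 - (cmod z)\<^sup>2) / jac m z > 0" using assms jac_pos[of m z] cmod_square_less1[of z] by simp
  then show ?thesis using mob_one_minus[of m z] assms cmod_square_less1[of "mob m z"] by linarith
qed

lemma mob_circle: assumes "m \<in> SU" "cmod z = 1" shows "cmod (mob m z) = 1"
proof -
  have "(cmod (mob m z))\<^sup>2 = 1\<^sup>2" using mob_one_minus[of m z] assms by simp
  then show ?thesis by (rule power2_eq_imp_eq) auto
qed

lemma mob_H2: "m \<in> SU \<Longrightarrow> z \<in> H2 \<Longrightarrow> mob m z \<in> H2"
  using mob_open by (simp add: H2_def)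

lemma mob_H2bar: "m \<in> SU \<Longrightarrow> z \<in> H2bar \<Longrightarrow> mob m z \<in> H2bar"
  using mob_closed by (simp add: H2bar_def)

lemma mmul_SU: assumes "m \<in> SU" "n \<in> SU" shows "mmul m n \<in> SU"
proof -
  have "fst (mmul m n) * cnj (fst (mmul m n)) - snd (mmul m n) * cnj (snd (mmul m n))
    = (fst m * cnj (fst m) - snd m * cnj (snd m)) * (fst n * cnj (fst n) - snd n * cnj (snd n))"
    by (simp add: mmul_def algebra_simps)
  then show ?thesis using SU_cnj[OF assms(1)] SU_cnj[OF assms(2)] by (simp add: SU_iff)
qed

lemma minv_SU: "m \<in> SU \<Longrightarrow> minv m \<in> SU"
  by (simp add: SU_def minv_def)

lemma one_SU: "(1, 0) \<in> SU"
  by (simp add: SU_def)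

lemma minv_mmul: "m \<in> SU \<Longrightarrow> mmul (minv m) m = (1, 0)"
  using SU_cnj[of m] by (simp add: mmul_def minv_def algebra_simps)

lemma mmul_minv: "m \<in> SU \<Longrightarrow> mmul m (minv m) = (1, 0)"
  using SU_cnj[of m] by (simp add: mmul_def minv_def algebra_simps)

lemma mob_one [simp]: "mob (1, 0) z = z"
  by (simp add: mob_def den_def)

lemma den_mmul:
  assumes "n \<in> SU" "cmod z \<le> 1"
  shows "den (mmul m n) z = den m (mob n z) * den n z"
  using den_nz[OF assms] assms(2) by (simp add: mob_def den_def mmul_def field_simps)

lemma mob_mmul:
  assumes "m \<in> SU" "n \<in> SU"
  shows "mob (mmul m n) z = mob m (mob n z)"
proof (cases "cmod z \<le> 1")
  case True
  have nz: "den n z \<noteq> 0" by (rule den_nz[OF assms(2) True])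
  have "(fst (mmul m n) * z + snd (mmul m n)) = (fst m * mob n z + snd m) * den n z"
    using nz True by (simp add: mob_def[of n] mmul_def field_simps) (simp add: den_def algebra_simps)
  then show ?thesis
    using True nz mob_closed[OF assms(2) True] den_mmul[OF assms(2) True, of m]
    by (simp add: mob_def[of m] mob_def[of "mmul m n"])
next
  case False
  then show ?thesis by (simp add: mob_def)
qed

lemma mob_comp: "m \<in> SU \<Longrightarrow> n \<in> SU \<Longrightarrow> mob m \<circ> mob n = mob (mmul m n)"
  by (rule ext) (simp add: mob_mmul)

lemma jac_mmul: "n \<in> SU \<Longrightarrow> cmod z \<le> 1 \<Longrightarrow> jac (mmul m n) z = jac m (mob n z) * jac n z"
  by (simp add: jac_def den_mmul norm_mult power_mult_distrib)

lemma mob_minv_mob [simp]: "m \<in> SU \<Longrightarrow> mob (minv m) (mob m z) = z"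
  by (metis mob_mmul minv_SU minv_mmul mob_one)

lemma mob_mob_minv [simp]: "m \<in> SU \<Longrightarrow> mob m (mob (minv m) z) = z"
  by (metis mob_mmul minv_SU mmul_minv mob_one)

lemma mob_inj: "m \<in> SU \<Longrightarrow> mob m z = mob m w \<longleftrightarrow> z = w"
  by (metis mob_minv_mob)

lemma mob_diff:
  assumes "m \<in> SU" "cmod z \<le> 1" "cmod w \<le> 1"
  shows "mob m z - mob m w = (z - w) / (den m z * den m w)"
proof -
  have "(fst m * z + snd m) * den m w - (fst m * w + snd m) * den m z
      = (fst m * cnj (fst m) - snd m * cnj (snd m)) * (z - w)"
    by (simp add: den_def algebra_simps)
  also have "\<dots> = z - w" using SU_cnj[OF assms(1)] by simp
  finally show ?thesis
    using den_nz[OF assms(1,2)] den_nz[OF assms(1,3)] assms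
    by (simp add: mob_def diff_frac_eq)
qed

lemma lform_eq: "lform z w = 2 * (cmod (z - w))\<^sup>2 + (1 - (cmod z)\<^sup>2) * (1 - (cmod w)\<^sup>2)"
  by (simp add: lform_def cmod_power2) (simp add: algebra_simps power2_eq_square)

lemma lform_mob:
  assumes "m \<in> SU" "cmod z \<le> 1" "cmod w \<le> 1"
  shows "lform (mob m z) (mob m w) = lform z w / (jac m z * jac m w)"
  using assms
  by (simp add: lform_eq mob_one_minus mob_diff norm_divide norm_mult power_divide
      power_mult_distrib add_divide_distrib flip: jac_def)

text \<open>A map determines its matrix only up to sign, and a common element has two
  factorizations, so \<open>jac\<close> must be seen to depend on the map alone. The factor 1 -
  |z|^2 shows this at the origin but is void on the circle; invariance of the product with the cone
  vector of the origin reaches every z.\<close>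

lemma jac_cong:
  assumes "m \<in> SU" "n \<in> SU" "mob m = mob n" "cmod z \<le> 1"
  shows "jac m z = jac n z"
proof -
  have 0: "jac m 0 = jac n 0"
    using mob_one_minus[OF assms(1), of 0] mob_one_minus[OF assms(2), of 0] assms(3) by simp
  have "lform z 0 / (jac m z * jac m 0) = lform z 0 / (jac n z * jac n 0)"
    using lform_mob[OF assms(1,4), of 0] lform_mob[OF assms(2,4), of 0]
    unfolding assms(3) by (metis norm_zero zero_le_one)
  moreover have "lform z 0 \<noteq> 0"
  proof -
    have "lform z 0 = 1 + (cmod z)\<^sup>2" by (simp add: lform_def)
    then show ?thesis using zero_le_power2[of "cmod z"] by linarith
  qed
  moreover have "jac m z \<noteq> 0" "jac n z \<noteq> 0" "jac n 0 \<noteq> 0"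
    using jac_pos[OF assms(1,4)] jac_pos[OF assms(2,4)] jac_pos[OF assms(2), of 0] by auto
  ultimately show ?thesis by (auto simp: 0 frac_eq_eq)
qed

section \<open>Spinors and the area form\<close>

lemma spin_mmul: "spin (mmul m n) \<zeta> = spin m (spin n \<zeta>)"
  by (simp add: spin_def mmul_def algebra_simps)

lemma spin_one [simp]: "spin (1, 0) \<zeta> = \<zeta>"
  by (simp add: spin_def)

lemma spin_minv [simp]: "m \<in> SU \<Longrightarrow> spin (minv m) (spin m \<zeta>) = \<zeta>"
  by (metis minv_mmul spin_mmul spin_one)

lemma spin_spin_minv [simp]: "m \<in> SU \<Longrightarrow> spin m (spin (minv m) \<zeta>) = \<zeta>"
  by (metis mmul_minv spin_mmul spin_one)

lemma spin_add: "spin m (\<zeta> + \<omega>) = spin m \<zeta> + spin m \<omega>"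
  by (simp add: spin_def algebra_simps)

lemma spin_scale: "spin m (of_real r * \<zeta>) = of_real r * spin m \<zeta>"
  by (simp add: spin_def algebra_simps)

lemma spin_zero [simp]: "spin m 0 = 0"
  by (simp add: spin_def)

lemma spin_eq_0_iff: "m \<in> SU \<Longrightarrow> spin m \<zeta> = 0 \<longleftrightarrow> \<zeta> = 0"
  by (metis spin_minv spin_zero)

lemma area_spin: assumes "m \<in> SU" shows "area (spin m \<zeta>) (spin m \<omega>) = area \<zeta> \<omega>"
proof -
  have im: "Im z = Re (\<i> * (cnj z - z)) / 2" for z by simp
  have "cnj (cnj (spin m \<zeta>) * spin m \<omega>) - cnj (spin m \<zeta>) * spin m \<omega>
     = (fst m * cnj (fst m) - snd m * cnj (snd m)) * (cnj (cnj \<zeta> * \<omega>) - cnj \<zeta> * \<omega>)"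
    by (simp add: spin_def algebra_simps)
  then show ?thesis unfolding area_def im using SU_cnj[OF assms] by simp
qed

lemma area_add_left: "area (a + b) c = area a c + area b c"
  and area_add_right: "area a (b + c) = area a b + area a c"
  and area_scale_left: "area (of_real r * a) c = r * area a c"
  and area_scale_right: "area a (of_real r * c) = r * area a c"
  by (simp_all add: area_def algebra_simps)

lemma pt_circle: "\<zeta> \<noteq> 0 \<Longrightarrow> cmod (pt \<zeta>) = 1"
  by (simp add: pt_def norm_divide)

lemma den_pt: "\<zeta> \<noteq> 0 \<Longrightarrow> den m (pt \<zeta>) = cnj (spin m \<zeta>) / cnj \<zeta>"
  by (simp add: den_def pt_def spin_def field_simps)

lemma mob_pt:
  assumes "m \<in> SU" "\<zeta> \<noteq> 0" shows "mob m (pt \<zeta>) = pt (spin m \<zeta>)"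
proof -
  have "fst m * pt \<zeta> + snd m = spin m \<zeta> / cnj \<zeta>"
    using assms(2) by (simp add: pt_def spin_def field_simps)
  then show ?thesis using assms pt_circle[OF assms(2)] spin_eq_0_iff[OF assms(1)]
    by (simp add: mob_def den_pt) (simp add: pt_def)
qed

lemma jac_pt: "\<zeta> \<noteq> 0 \<Longrightarrow> jac m (pt \<zeta>) = (cmod (spin m \<zeta>))\<^sup>2 / (cmod \<zeta>)\<^sup>2"
  by (simp add: jac_def den_pt norm_divide power_divide del: complex_cnj_divide)

lemma pt_scale: "r \<noteq> 0 \<Longrightarrow> pt (of_real r * \<zeta>) = pt \<zeta>"
  by (simp add: pt_def)

lemma pt_surj: assumes "cmod \<xi> = 1" obtains \<zeta> where "\<zeta> \<noteq> 0" "\<xi> = pt \<zeta>"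
proof
  have "(cmod (csqrt \<xi>))\<^sup>2 = 1\<^sup>2" using assms by (simp flip: norm_power)
  then have n: "cmod (csqrt \<xi>) = 1" by (rule power2_eq_imp_eq) auto
  then have "csqrt \<xi> * cnj (csqrt \<xi>) = 1"
    by (metis complex_norm_square of_real_1 one_power2)
  moreover have "csqrt \<xi> * csqrt \<xi> = \<xi>" by (metis power2_csqrt power2_eq_square)
  moreover have "cnj (csqrt \<xi>) \<noteq> 0" using n by auto
  ultimately show "\<xi> = pt (csqrt \<xi>)"
    unfolding pt_def by (metis eq_divide_eq mult.assoc mult_1_right)
  show "csqrt \<xi> \<noteq> 0" using n by auto
qed

lemma area_diff: "a \<noteq> 0 \<Longrightarrow> b \<noteq> 0 \<Longrightarrow> cmod (pt a - pt b) = 2 * \<bar>area a b\<bar> / (cmod a * cmod b)"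
proof -
  assume nz: "a \<noteq> 0" "b \<noteq> 0"
  have "pt a - pt b = (a * cnj b - cnj a * b) / (cnj a * cnj b)"
    using nz by (simp add: pt_def field_simps)
  moreover have "a * cnj b - cnj a * b = - 2 * \<i> * of_real (area a b)"
    by (simp add: area_def complex_eq_iff algebra_simps)
  ultimately show ?thesis by (simp add: norm_divide norm_mult)
qed

lemma pt_eq_iff: "a \<noteq> 0 \<Longrightarrow> b \<noteq> 0 \<Longrightarrow> pt a = pt b \<longleftrightarrow> area a b = 0"
  using area_diff[of a b] by auto

lemma area_0_parallel: assumes "area a b = 0" "a \<noteq> 0" obtains r where "b = of_real r * a"
proof
  have "cnj a * b = of_real (Re (cnj a * b))" using assms(1) by (simp add: area_def complex_eq_iff)
  then have "of_real (Re (cnj a * b)) * a = cnj a * b * a" by simp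
  then show "b = of_real (Re (cnj a * b) / (cmod a)\<^sup>2) * a"
    using assms(2)
    by (simp only: of_real_divide complex_norm_square times_divide_eq_left) (simp add: field_simps)
qed

text \<open>The matrix solves \<alpha> + \<beta> = a and \<i> (\<alpha> - \<beta>) = b, the values
  of the real-linear map at 1 and \<i>; its determinant |\<alpha>|^2 - |\<beta>|^2 is the area of
  the image of the unit square.\<close>

lemma SU_of_basis:
  assumes "area a b = 1"
  obtains m where "m \<in> SU" "spin m 1 = a" "spin m \<i> = b"
proof
  let ?m = "((a - \<i> * b) / 2, (a + \<i> * b) / 2)"
  show "spin ?m 1 = a" "spin ?m \<i> = b" by (simp_all add: spin_def field_simps)
  show "?m \<in> SU" using assms
    by (simp add: SU_def area_def cmod_power2) (simp add: power2_eq_square field_simps)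
qed

text \<open>Go from a, b back to the basis 1, \<i> and on to a', b'. Dividing both second vectors by
  the common area makes the bases unimodular. This produces the common elements with ideal fixed
  points.\<close>

lemma SU_two_vectors:
  assumes "area a' b' = area a b" "area a b \<noteq> 0"
  obtains m where "m \<in> SU" "spin m a = a'" "spin m b = b'"
proof -
  define r where "r = area a b"
  have r: "r \<noteq> 0" "area a b = r" "area a' b' = r" using assms by (auto simp: r_def)
  obtain m where m: "m \<in> SU" "spin m 1 = a" "spin m \<i> = of_real (1/r) * b"
    by (rule SU_of_basis[of a "of_real (1/r) * b"]) (use r in \<open>simp only: area_scale_right, simp\<close>)
  obtain n where n: "n \<in> SU" "spin n 1 = a'" "spin n \<i> = of_real (1/r) * b'"
    by (rule SU_of_basis[of a' "of_real (1/r) * b'"]) (use r in \<open>simp only: area_scale_right, simp\<close>)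
  show ?thesis
  proof
    show "mmul n (minv m) \<in> SU" using m n by (simp add: mmul_SU minv_SU)
    have "spin (minv m) a = 1" using m by (metis spin_minv)
    then show "spin (mmul n (minv m)) a = a'" by (simp add: spin_mmul n)
    have "b = of_real r * spin m \<i>" using m r by simp
    then have "spin (minv m) b = of_real r * \<i>"
      using m(1) by (metis spin_scale spin_minv)
    then show "spin (mmul n (minv m)) b = b'" using r by (simp add: spin_mmul spin_scale n)
  qed
qed

text \<open>On cone vectors \<open>mob\<close> acts linearly once its value is weighted by
  \<open>jac\<close>: the result is the sum of the null vectors of \<open>spin k a\<close> and
  \<open>spin k b\<close> (T is the time component, W the space component). The product of two such
  sums expands into products of null vectors, each twice a squared area.\<close>

lemma lform_spin:
  assumes "k \<in> SU" "k' \<in> SU" "cmod x \<le> 1" "cmod x' \<le> 1"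
    and 1: "1 + (cmod x)\<^sup>2 = (cmod a)\<^sup>2 + (cmod b)\<^sup>2" "2 * x = a\<^sup>2 + b\<^sup>2"
    and 2: "1 + (cmod x')\<^sup>2 = (cmod a')\<^sup>2 + (cmod b')\<^sup>2" "2 * x' = a'\<^sup>2 + b'\<^sup>2"
  shows "lform (mob k x) (mob k' x') * (jac k x * jac k' x')
     = 2 * ((area (spin k a) (spin k' a'))\<^sup>2 + (area (spin k a) (spin k' b'))\<^sup>2
          + (area (spin k b) (spin k' a'))\<^sup>2 + (area (spin k b) (spin k' b'))\<^sup>2)"
proof -
  have T: "(1 + (cmod (mob k x))\<^sup>2) * jac k x = (cmod (spin k a))\<^sup>2 + (cmod (spin k b))\<^sup>2"
    and W: "2 * mob k x * jac k x = (spin k a)\<^sup>2 + (spin k b)\<^sup>2"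
    if k: "k \<in> SU" and x: "cmod x \<le> 1" and h: "1 + (cmod x)\<^sup>2 = (cmod a)\<^sup>2 + (cmod b)\<^sup>2"
      "2 * x = a\<^sup>2 + b\<^sup>2" for k x a b
  proof -
    have nz: "den k x \<noteq> 0" by (rule den_nz[OF k x])
    have hh: "1 + x * cnj x = a * cnj a + b * cnj b"
    proof -
      have "complex_of_real (1 + (cmod x)\<^sup>2) = of_real ((cmod a)\<^sup>2 + (cmod b)\<^sup>2)" using h by simp
      then show ?thesis by (simp only: of_real_add complex_norm_square of_real_1)
    qed
    have ch: "2 * cnj x = (cnj a)\<^sup>2 + (cnj b)\<^sup>2"
      using arg_cong[OF h(2), of cnj] by simp
    have j: "complex_of_real (jac k x) = den k x * cnj (den k x)"
      unfolding jac_def by (simp only: complex_norm_square)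
    define N where "N = fst k * x + snd k"
    have N: "mob k x * den k x = N" using nz x by (simp add: mob_def N_def)
    have "complex_of_real ((1 + (cmod (mob k x))\<^sup>2) * jac k x)
      = den k x * cnj (den k x) + (mob k x * den k x) * cnj (mob k x * den k x)"
      by (simp only: of_real_add of_real_mult complex_norm_square of_real_1 j) (simp add: algebra_simps)
    also have "\<dots> = (fst k * cnj (fst k) + snd k * cnj (snd k)) * (1 + x * cnj x)
        + fst k * cnj (snd k) * (2 * x) + cnj (fst k) * snd k * (2 * cnj x)"
      unfolding N by (simp add: N_def den_def algebra_simps)
    also have "\<dots> = spin k a * cnj (spin k a) + spin k b * cnj (spin k b)"
      unfolding hh h ch by (simp add: spin_def algebra_simps power2_eq_square)
    also have "\<dots> = of_real ((cmod (spin k a))\<^sup>2 + (cmod (spin k b))\<^sup>2)"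
      by (simp only: of_real_add complex_norm_square)
    finally show "(1 + (cmod (mob k x))\<^sup>2) * jac k x = (cmod (spin k a))\<^sup>2 + (cmod (spin k b))\<^sup>2"
      by (simp only: of_real_eq_iff)
    have "2 * mob k x * jac k x = 2 * (mob k x * den k x) * cnj (den k x)"
      by (simp add: j)
    also have "\<dots> = (fst k)\<^sup>2 * (2 * x) + (snd k)\<^sup>2 * (2 * cnj x) + 2 * fst k * snd k * (1 + x * cnj x)"
      unfolding N by (simp add: N_def den_def algebra_simps power2_eq_square)
    also have "\<dots> = (spin k a)\<^sup>2 + (spin k b)\<^sup>2"
      unfolding hh h ch by (simp add: spin_def algebra_simps power2_eq_square)
    finally show "2 * mob k x * jac k x = (spin k a)\<^sup>2 + (spin k b)\<^sup>2" .
  qed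
  have ar: "2 * (area u v)\<^sup>2 = (cmod u)\<^sup>2 * (cmod v)\<^sup>2 - Re (u\<^sup>2 * cnj (v\<^sup>2))" for u v
    by (simp add: area_def cmod_power2) (simp add: power2_eq_square algebra_simps)
  have "lform (mob k x) (mob k' x') * (jac k x * jac k' x')
    = ((1 + (cmod (mob k x))\<^sup>2) * jac k x) * ((1 + (cmod (mob k' x'))\<^sup>2) * jac k' x')
      - Re ((2 * mob k x * jac k x) * cnj (2 * mob k' x' * jac k' x'))"
    by (simp add: lform_def algebra_simps)
  also have "\<dots> = ((cmod (spin k a))\<^sup>2 + (cmod (spin k b))\<^sup>2) * ((cmod (spin k' a'))\<^sup>2 + (cmod (spin k' b'))\<^sup>2)
     - Re (((spin k a)\<^sup>2 + (spin k b)\<^sup>2) * cnj ((spin k' a')\<^sup>2 + (spin k' b')\<^sup>2))"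
    by (simp only: T[OF assms(1,3) 1] T[OF assms(2,4) 2] W[OF assms(1,3) 1] W[OF assms(2,4) 2])
  also have "\<dots> = 2 * (area (spin k a) (spin k' a'))\<^sup>2 + 2 * (area (spin k a) (spin k' b'))\<^sup>2
          + 2 * (area (spin k b) (spin k' a'))\<^sup>2 + 2 * (area (spin k b) (spin k' b'))\<^sup>2"
    unfolding ar by (simp add: algebra_simps)
  finally show ?thesis by (simp only: distrib_left)
qed

section \<open>Fixed points and coincidences\<close>

lemma mob_fix_iff:
  assumes "m \<in> SU" "cmod z \<le> 1"
  shows "mob m z = z \<longleftrightarrow> fst m * z + snd m = z * den m z"
  using den_nz[OF assms] assms(2) by (simp add: mob_def divide_eq_eq)

lemma den_fixpts_mult:
  assumes "m \<in> SU" "cmod p \<le> 1" "cmod q \<le> 1" "mob m p = p" "mob m q = q" "p \<noteq> q"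
  shows "den m p * den m q = 1"
  using mob_diff[OF assms(1-3)] assms(4-6) den_nz[OF assms(1,2)] den_nz[OF assms(1,3)]
  by (simp add: divide_simps)

lemma iterate_H2: "m \<in> SU \<Longrightarrow> x \<in> H2 \<Longrightarrow> (mob m ^^ n) x \<in> H2"
  by (induction n) (auto intro: mob_H2)

text \<open>In the coordinate \<open>(z - p) / (z - q)\<close> an element fixing \<open>p\<close> and \<open>q\<close> acts
  by multiplication with a constant.\<close>

lemma iterate_ratio:
  assumes "m \<in> SU" "cmod p \<le> 1" "cmod q \<le> 1" "mob m p = p" "mob m q = q" "p \<noteq> q" "x \<in> H2"
  shows "cmod ((mob m ^^ n) x - p) * cmod (x - q) * jac m p ^ n
       = cmod ((mob m ^^ n) x - q) * cmod (x - p)"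
proof (induction n)
  case (Suc n)
  define y where "y = (mob m ^^ n) x"
  have y: "cmod y \<le> 1" using iterate_H2[OF assms(1,7), of n] by (simp add: y_def H2_def)
  have nz: "den m y \<noteq> 0" "den m p \<noteq> 0" "den m q \<noteq> 0" using den_nz assms y by auto
  have dd: "cmod (den m p) * cmod (den m q) = 1"
    using den_fixpts_mult[OF assms(1-6)] by (metis norm_mult norm_one)
  then have dq: "1 / cmod (den m q) = cmod (den m p)" using nz by (simp add: divide_simps)
  have p: "cmod (mob m y - p) = cmod (y - p) / (cmod (den m y) * cmod (den m p))"
    using mob_diff[OF assms(1) y assms(2)] assms by (simp add: norm_divide norm_mult)
  have "cmod (mob m y - q) = cmod (y - q) / (cmod (den m y) * cmod (den m q))"
    using mob_diff[OF assms(1) y assms(3)] assms by (simp add: norm_divide norm_mult)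
  also have "\<dots> = cmod (y - q) / cmod (den m y) * (1 / cmod (den m q))" by simp
  finally have q: "cmod (mob m y - q) = cmod (y - q) / cmod (den m y) * cmod (den m p)"
    unfolding dq .
  have "cmod (mob m y - p) * cmod (x - q) * jac m p ^ Suc n
      = (cmod (y - p) * cmod (x - q) * jac m p ^ n) * cmod (den m p) / cmod (den m y)"
    unfolding p using nz by (simp add: jac_def power2_eq_square field_simps)
  also have "\<dots> = (cmod (y - q) * cmod (x - p)) * cmod (den m p) / cmod (den m y)"
    using Suc by (simp add: y_def)
  also have "\<dots> = cmod (mob m y - q) * cmod (x - p)" unfolding q by simp
  finally show ?case by (simp add: y_def)
qed simp

text \<open>Interior fixed points have \<open>jac\<close> 1, so p is ideal. The fixed points are the
  roots of a quadratic; Vieta gives the second root q, again on the circle. The denominators at p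
  and q are reciprocal, so q = p would force \<open>jac m p\<close> to be 1.\<close>

lemma fixpts_two:
  assumes "m \<in> SU" "cmod p \<le> 1" "mob m p = p" "jac m p > 1"
  obtains q where "cmod q \<le> 1" "mob m q = q" "q \<noteq> p" "fixpts (mob m) = {p, q}"
proof -
  let ?a = "fst m" and ?b = "snd m"
  have "(1 - (cmod p)\<^sup>2) * jac m p = 1 - (cmod p)\<^sup>2"
    using mob_one_minus[OF assms(1,2)] assms(3,4) by (simp add: field_simps)
  then have "(cmod p)\<^sup>2 = 1" using assms(4) by (simp add: mult_cancel_left1)
  then have p1: "cmod p = 1" by (simp add: power2_eq_1_iff) (use norm_ge_zero[of p] in linarith)
  then have p0: "p \<noteq> 0" by auto
  have b0: "?b \<noteq> 0" using assms(1,4) by (auto simp: SU_def jac_def den_def)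
  define q where "q = - ?b / (cnj ?b * p)"
  have q1: "cmod q = 1" using b0 p1 by (simp add: q_def norm_divide norm_mult)
  have bq: "?b = - cnj ?b * p * q" using b0 p0 by (simp add: q_def)
  have "?a * p + ?b = p * den m p" using mob_fix_iff assms by blast
  then have "(?a - cnj ?a) * p = cnj ?b * (p + q) * p" using bq by (simp add: den_def) algebra
  then have aa: "?a - cnj ?a = cnj ?b * (p + q)" using p0 by simp
  have roots: "?a * z + ?b - z * den m z = - cnj ?b * (z - p) * (z - q)" for z
    using aa bq by (simp add: den_def) algebra
  have fixed: "mob m z = z \<longleftrightarrow> z = p \<or> z = q" if "cmod z \<le> 1" for z
  proof -
    have "mob m z = z \<longleftrightarrow> ?a * z + ?b - z * den m z = 0"
      using mob_fix_iff[OF assms(1) that] by simp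
    then show ?thesis unfolding roots using b0 by simp
  qed
  have "den m p * den m q = cnj ?b * (cnj ?b * p * q) + cnj ?a * (cnj ?b * (p + q)) + cnj ?a * cnj ?a"
    by (simp add: den_def algebra_simps)
  also have "cnj ?b * p * q = - ?b" using bq by (metis minus_minus mult_minus_left)
  also have "cnj ?b * - ?b + cnj ?a * (cnj ?b * (p + q)) + cnj ?a * cnj ?a = 1"
    unfolding aa[symmetric] using SU_cnj[OF assms(1)] by (simp add: algebra_simps)
  finally have "den m p * den m q = 1" .
  then have "q \<noteq> p" using assms(4)
    by (metis jac_def norm_mult norm_one power2_eq_square less_irrefl)
  moreover have "fixpts (mob m) = {p, q}"
    using fixed q1 p1 by (auto simp: fixpts_def H2bar_def)
  ultimately show ?thesis using that[of q] q1 fixed[of q] by simp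
qed

lemma jac_fix_interior: assumes "m \<in> SU" "cmod p < 1" "mob m p = p" shows "jac m p = 1"
proof -
  have "(cmod p)\<^sup>2 < 1" using assms(2) cmod_square_less1 by blast
  moreover have "(1 - (cmod p)\<^sup>2) * jac m p = 1 - (cmod p)\<^sup>2"
    using mob_one_minus[OF assms(1), of p] assms jac_pos[of m p] by (simp add: field_simps)
  ultimately show ?thesis by (simp add: mult_cancel_left1)
qed

text \<open>By \<open>iterate_ratio\<close>, the quotient |z - p| / |z - q| along an orbit is its
  initial value divided by \<open>jac m p ^ n\<close>, so orbits tend to p exactly when this factor
  exceeds 1. The second fixed point that the definition demands comes from
  \<open>fixpts_two\<close>.\<close>

lemma attracting_fp_iff:
  assumes m: "m \<in> SU" and p: "cmod p \<le> 1" "mob m p = p"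
  shows "attracting_fp (mob m) p \<longleftrightarrow> jac m p > 1"
proof
  assume at: "attracting_fp (mob m) p"
  then have "card (fixpts (mob m)) = 2" "p \<in> fixpts (mob m)" by (auto simp: attracting_fp_def)
  then obtain q where q: "q \<in> fixpts (mob m)" "p \<noteq> q" by (auto simp: card_2_iff)
  have "\<exists>x \<in> {0, 1/2, -1/2 :: complex}. x \<noteq> p \<and> x \<noteq> q" by auto
  moreover have "{0, 1/2, -1/2} \<subseteq> H2" by (simp add: H2_def)
  ultimately obtain x where x: "x \<noteq> p" "x \<noteq> q" and x2: "x \<in> H2" by blast
  show "jac m p > 1"
  proof (rule ccontr)
    assume "\<not> jac m p > 1"
    then have j: "jac m p ^ n \<le> 1" for n
      using jac_pos[OF m p(1)] by (simp add: power_le_one)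
    have lim: "(\<lambda>n. (mob m ^^ n) x) \<longlonglongrightarrow> p" using at x2 by (auto simp: attracting_fp_def)
    have le: "cmod ((mob m ^^ n) x - q) * cmod (x - p) \<le> cmod ((mob m ^^ n) x - p) * cmod (x - q)" for n
    proof -
      have "cmod ((mob m ^^ n) x - p) * cmod (x - q) * jac m p ^ n
          \<le> cmod ((mob m ^^ n) x - p) * cmod (x - q) * 1"
        using j by (intro mult_left_mono) auto
      then show ?thesis using iterate_ratio[of m p q x n] m p q x2 by (simp add: fixpts_def H2bar_def)
    qed
    have "cmod (p - q) * cmod (x - p) \<le> cmod (p - p) * cmod (x - q)"
    proof (rule LIMSEQ_le)
      show "(\<lambda>n. cmod ((mob m ^^ n) x - q) * cmod (x - p)) \<longlonglongrightarrow> cmod (p - q) * cmod (x - p)"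
        by (intro tendsto_intros lim)
      show "(\<lambda>n. cmod ((mob m ^^ n) x - p) * cmod (x - q)) \<longlonglongrightarrow> cmod (p - p) * cmod (x - q)"
        by (intro tendsto_intros lim)
    qed (use le in blast)
    then have "cmod (p - q) * cmod (x - p) \<le> 0" by simp
    moreover have "cmod (p - q) * cmod (x - p) > 0" using q(2) x(1) by simp
    ultimately show False by linarith
  qed
next
  assume j: "jac m p > 1"
  obtain q where q: "cmod q \<le> 1" "mob m q = q" "q \<noteq> p" "fixpts (mob m) = {p, q}"
    using fixpts_two[OF m p j] .
  have "(\<lambda>n. (mob m ^^ n) x) \<longlonglongrightarrow> p" if x: "x \<in> H2" for x
  proof (cases "x = q")
    \<comment> \<open>A vacuous case: q has a factor below 1, so it lies on the circle.\<close>
    case True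
    have "jac m q < 1"
    proof -
      have "jac m p * jac m q = (cmod (den m p * den m q))\<^sup>2"
        by (simp add: jac_def norm_mult power_mult_distrib)
      then have "jac m p * jac m q = 1" using den_fixpts_mult[of m p q] m p q by simp
      then show ?thesis using j
        by (metis jac_pos less_eq_real_def linorder_neqE_linordered_idom m mult_less_cancel_left_pos
            mult.right_neutral p(1) order_less_trans zero_less_one)
    qed
    moreover have "jac m q = 1" using jac_fix_interior[OF m _ q(2)] x True by (simp add: H2_def)
    ultimately show ?thesis by simp
  next
    case False
    then have xq: "cmod (x - q) > 0" by simp
    have le: "cmod ((mob m ^^ n) x - p) \<le> 2 * cmod (x - p) / cmod (x - q) * (1 / jac m p) ^ n" for n
    proof -
      have "cmod ((mob m ^^ n) x - q) \<le> cmod ((mob m ^^ n) x) + cmod q"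
        by (rule norm_triangle_ineq4)
      then have "cmod ((mob m ^^ n) x - q) \<le> 2"
        using q iterate_H2[OF m x, of n] by (simp add: H2_def)
      then have "cmod ((mob m ^^ n) x - q) * cmod (x - p) \<le> 2 * cmod (x - p)"
        by (intro mult_right_mono) auto
      then have "cmod ((mob m ^^ n) x - p) * cmod (x - q) * jac m p ^ n \<le> 2 * cmod (x - p)"
        using iterate_ratio[of m p q x n] m p q x by simp
      then show ?thesis using j xq by (simp add: field_simps power_one_over)
    qed
    have "(\<lambda>n. (1 / jac m p) ^ n) \<longlonglongrightarrow> 0"
      by (rule LIMSEQ_power_zero) (use j in simp)
    from tendsto_mult_right_zero[OF this, of "2 * cmod (x - p) / cmod (x - q)"]
    have lim: "(\<lambda>n. 2 * cmod (x - p) / cmod (x - q) * (1 / jac m p) ^ n) \<longlonglongrightarrow> 0" .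
    have "(\<lambda>n. (mob m ^^ n) x - p) \<longlonglongrightarrow> 0"
      by (rule Lim_null_comparison[OF _ lim]) (use le in simp)
    then show ?thesis by (simp add: LIM_zero_iff)
  qed
  then show "attracting_fp (mob m) p" unfolding attracting_fp_def q(4) using q(3) by auto
qed

lemma nonattr_fixpts_iff:
  assumes "m \<in> SU"
  shows "p \<in> nonattr_fixpts (mob m) \<longleftrightarrow> cmod p \<le> 1 \<and> mob m p = p \<and> jac m p \<le> 1"
  using attracting_fp_iff[OF assms, of p]
  by (auto simp: nonattr_fixpts_def fixpts_def H2bar_def not_less)

section \<open>Hyperbolic distance and two-point homogeneity\<close>

lemma cosh_hdist:
  assumes "z \<in> H2" "w \<in> H2"
  shows "cosh (hdist z w) = lform z w / ((1 - (cmod z)\<^sup>2) * (1 - (cmod w)\<^sup>2))"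
    and "hdist z w \<ge> 0"
proof -
  have "(cmod z)\<^sup>2 < 1" "(cmod w)\<^sup>2 < 1" using assms cmod_square_less1 by (auto simp: H2_def)
  then have pos: "1 - (cmod z)\<^sup>2 > 0" "1 - (cmod w)\<^sup>2 > 0" by auto
  then have ge: "1 + 2 * (cmod (z - w))\<^sup>2 / ((1 - (cmod z)\<^sup>2) * (1 - (cmod w)\<^sup>2)) \<ge> 1"
    by simp
  show "hdist z w \<ge> 0" unfolding hdist_def using ge by (rule arcosh_nonneg_real)
  have "cosh (hdist z w) = 1 + 2 * (cmod (z - w))\<^sup>2 / ((1 - (cmod z)\<^sup>2) * (1 - (cmod w)\<^sup>2))"
    unfolding hdist_def using ge by (rule cosh_arcosh_real)
  then show "cosh (hdist z w) = lform z w / ((1 - (cmod z)\<^sup>2) * (1 - (cmod w)\<^sup>2))"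
    using pos by (simp add: lform_eq add_divide_distrib)
qed

lemma hdist_eqI:
  assumes "z \<in> H2" "w \<in> H2" "z' \<in> H2" "w' \<in> H2"
    "lform z w / ((1 - (cmod z)\<^sup>2) * (1 - (cmod w)\<^sup>2)) = lform z' w' / ((1 - (cmod z')\<^sup>2) * (1 - (cmod w')\<^sup>2))"
  shows "hdist z w = hdist z' w'"
  using cosh_hdist[OF assms(1,2)] cosh_hdist[OF assms(3,4)] assms(5)
  by (metis cosh_real_nonneg_less_iff less_irrefl linorder_neqE_linordered_idom)

lemma hdist_mob:
  assumes "m \<in> SU" "z \<in> H2" "w \<in> H2" shows "hdist (mob m z) (mob m w) = hdist z w"
proof (rule hdist_eqI)
  have "cmod z \<le> 1" "cmod w \<le> 1" using assms by (auto simp: H2_def)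
  moreover have "jac m z > 0" "jac m w > 0" using calculation assms jac_pos by auto
  ultimately show "lform (mob m z) (mob m w) / ((1 - (cmod (mob m z))\<^sup>2) * (1 - (cmod (mob m w))\<^sup>2)) =
    lform z w / ((1 - (cmod z)\<^sup>2) * (1 - (cmod w)\<^sup>2))"
    using assms by (simp add: lform_mob mob_one_minus)
qed (use assms mob_H2 in auto)

lemma move_to_radius:
  assumes "x \<in> H2" "x' \<in> H2"
  obtains m r where "m \<in> SU" "0 \<le> r" "r < 1" "mob m x = 0" "mob m x' = of_real r"
proof -
  have x: "(cmod x)\<^sup>2 < 1" using assms cmod_square_less1 by (auto simp: H2_def)
  define s where "s = sqrt (1 - (cmod x)\<^sup>2)"
  have s: "s > 0" "s\<^sup>2 = 1 - (cmod x)\<^sup>2" using x by (auto simp: s_def)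
  define m where "m = (complex_of_real (1 / s), - x / of_real s)"
  have m: "m \<in> SU" using s(1) by (simp add: SU_def m_def norm_divide power_divide diff_divide_distrib[symmetric] s(2)[symmetric])
  have m0: "mob m x = 0" using assms by (simp add: mob_def m_def H2_def)
  define w where "w = mob m x'"
  have w: "cmod w < 1" using mob_H2[OF m assms(2)] by (simp add: w_def H2_def)
  \<comment> \<open>The matrix (c, 0) acts as rotation by c^2, so c is a square root of the rotation
    wanted.\<close>
  obtain c where c: "cmod c = 1" "c\<^sup>2 * w = of_real (cmod w)"
  proof (cases "w = 0")
    case False
    define c where "c = csqrt (of_real (cmod w) / w)"
    have c2: "c\<^sup>2 = of_real (cmod w) / w" by (simp add: c_def)
    then have "(cmod c)\<^sup>2 = 1\<^sup>2" using False by (simp add: norm_divide flip: norm_power)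
    then have "cmod c = 1" by (rule power2_eq_imp_eq) auto
    then show ?thesis using that[of c] c2 False by simp
  qed (use that[of 1] in simp)
  have cs: "(c, 0) \<in> SU" using c by (simp add: SU_def)
  have "c * cnj c = 1" using c(1) by (metis complex_norm_square of_real_1 one_power2)
  then have "c / cnj c = c\<^sup>2"
    by (metis divide_eq_eq mult.assoc mult_1_right mult_zero_right power2_eq_square zero_neq_one)
  then have "mob (c, 0) w = c\<^sup>2 * w" using w
    by (simp add: mob_def den_def) (metis times_divide_eq_left)
  then have "mob (mmul (c, 0) m) x' = of_real (cmod w)" using c cs m by (simp add: mob_mmul w_def)
  moreover have "mob (mmul (c, 0) m) x = 0" using cs m m0 by (simp add: mob_mmul) (simp add: mob_def)
  ultimately show ?thesis using that[of "mmul (c, 0) m" "cmod w"] w cs m mmul_SU by auto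
qed

text \<open>Both pairs have a normal form (0, r), and the distance determines r.\<close>

lemma two_point_homogeneous:
  assumes "x \<in> H2" "x' \<in> H2" "y \<in> H2" "y' \<in> H2" "hdist x x' = hdist y y'"
  obtains u where "u \<in> SU" "mob u x = y" "mob u x' = y'"
proof -
  obtain m r where m: "m \<in> SU" "0 \<le> r" "r < 1" "mob m x = 0" "mob m x' = of_real r"
    using move_to_radius[OF assms(1,2)] .
  obtain n t where n: "n \<in> SU" "0 \<le> t" "t < 1" "mob n y = 0" "mob n y' = of_real t"
    using move_to_radius[OF assms(3,4)] .
  have c: "cosh (hdist 0 (of_real q)) = 2 / (1 - q\<^sup>2) - 1 \<and> q\<^sup>2 < 1" if "0 \<le> q" "q < 1" for q
  proof -
    have q: "q\<^sup>2 < 1" using that by (simp add: power_less_one_iff)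
    have "cosh (hdist 0 (of_real q)) = (1 + q\<^sup>2) / (1 - q\<^sup>2)"
      using that by (subst cosh_hdist) (auto simp: H2_def lform_def)
    then show ?thesis using q by (simp add: field_simps)
  qed
  have "hdist 0 (of_real r) = hdist 0 (of_real t)"
    using hdist_mob[OF m(1) assms(1,2)] hdist_mob[OF n(1) assms(3,4)] m n assms(5) by simp
  then have "2 / (1 - r\<^sup>2) = 2 / (1 - t\<^sup>2)" using c[OF m(2,3)] c[OF n(2,3)] by simp
  then have "r\<^sup>2 = t\<^sup>2" using c[OF m(2,3)] c[OF n(2,3)] by (simp add: field_simps)
  then have "r = t" using m n by (simp add: power2_eq_iff_nonneg)
  then have "mob (mmul (minv n) m) x = y" "mob (mmul (minv n) m) x' = y'"
    using m n by (simp_all add: mob_mmul minv_SU) (metis mob_minv_mob)+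
  then show ?thesis using that m n mmul_SU minv_SU by blast
qed

section \<open>Common elements: construction and obstruction\<close>

lemma eigenvector_fixpt:
  assumes "c \<in> SU" "a \<noteq> 0" "spin c a = of_real r * a" "\<bar>r\<bar> \<le> 1"
  shows "pt a \<in> nonattr_fixpts (mob c)"
proof -
  have r: "r \<noteq> 0" using assms(1-3) spin_eq_0_iff[of c a] by auto
  have "r\<^sup>2 \<le> 1" using assms(4) by (simp add: abs_square_le_1)
  then show ?thesis using assms r
    by (simp add: nonattr_fixpts_iff pt_circle mob_pt pt_scale jac_pt norm_mult power_mult_distrib)
qed

text \<open>The common element u is built first, as a map taking a and b to multiples of
  \<open>spin g a\<close> and \<open>spin g' b\<close> with factors of modulus at most 1; then g^-1
  u and g'^-1 u have a and b as eigenvectors. Hypothesis \<open>nd\<close> excludes parallel a, b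
  with nonparallel images, for which there is no such linear map.\<close>

lemma meet_ideal:
  assumes g: "g \<in> SU" "g' \<in> SU" and ab: "a \<noteq> 0" "b \<noteq> 0"
    and le: "\<bar>area a b\<bar> \<le> \<bar>area (spin g a) (spin g' b)\<bar>"
    and nd: "area a b \<noteq> 0 \<or> area (spin g a) (spin g' b) = 0"
  obtains c c' where "c \<in> SU" "c' \<in> SU" "mob g \<circ> mob c = mob g' \<circ> mob c'"
    "pt a \<in> nonattr_fixpts (mob c)" "pt b \<in> nonattr_fixpts (mob c')"
proof -
  have nz: "spin g a \<noteq> 0" "spin g' b \<noteq> 0" using g ab by (auto simp: spin_eq_0_iff)
  have "\<exists>u r s. u \<in> SU \<and> spin u a = of_real r * spin g a \<and> spin u b = of_real s * spin g' b
     \<and> \<bar>r\<bar> \<le> 1 \<and> \<bar>s\<bar> \<le> 1"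
  proof (cases "area a b = 0")
    case False
    \<comment> \<open>Keep the target \<open>spin g a\<close> and rescale the other one until the
      areas agree; \<open>le\<close> bounds the factor by 1.\<close>
    define s where "s = area a b / area (spin g a) (spin g' b)"
    have n: "area (spin g a) (spin g' b) \<noteq> 0" using False le by auto
    have "area (spin g a) (of_real s * spin g' b) = area a b"
      using n unfolding area_scale_right s_def by simp
    then obtain u where "u \<in> SU" "spin u a = spin g a" "spin u b = of_real s * spin g' b"
      using SU_two_vectors False by metis
    moreover have "\<bar>s\<bar> \<le> 1" using le n by (simp add: s_def)
    ultimately show ?thesis by (intro exI[of _ u] exI[of _ 1] exI[of _ s]) simp
  next
    case True
    obtain q where q: "b = of_real q * a" using area_0_parallel[OF True ab(1)] .
    obtain s where s: "spin g' b = of_real s * spin g a"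
      using area_0_parallel[OF _ nz(1)] nd True by metis
    have nq: "q \<noteq> 0" "s \<noteq> 0" using q s ab nz by auto
    \<comment> \<open>If u a = t g a, the factor for b is q t / s, so t must not exceed 1 or |s /
      q|.\<close>
    define t where "t = min 1 \<bar>s / q\<bar>"
    have t: "t > 0" "t \<le> 1" "t \<le> \<bar>s / q\<bar>" using nq by (auto simp: t_def)
    have ii: "area v (\<i> * v) = (cmod v)\<^sup>2" for v
      by (simp add: area_def cmod_power2) (simp add: power2_eq_square)
    define h where "h = (cmod a)\<^sup>2 / (cmod (spin g a))\<^sup>2 / t"
    have "area (of_real t * spin g a) (of_real h * (\<i> * spin g a)) = area a (\<i> * a)"
      using nz t unfolding area_scale_left area_scale_right ii h_def by simp
    moreover have "area a (\<i> * a) \<noteq> 0" using ab by (simp add: ii)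
    ultimately obtain u where u: "u \<in> SU" "spin u a = of_real t * spin g a"
      using SU_two_vectors by metis
    have "spin u b = of_real (q * t / s) * spin g' b"
      unfolding s using nq by (simp add: q spin_scale u)
    moreover have "\<bar>q * t / s\<bar> \<le> 1"
      using t nq by (simp add: abs_mult abs_divide field_simps)
    ultimately show ?thesis using u t by (intro exI[of _ u] exI[of _ t] exI[of _ "q * t / s"]) simp
  qed
  then obtain u r s where u: "u \<in> SU" "spin u a = of_real r * spin g a" "spin u b = of_real s * spin g' b"
     "\<bar>r\<bar> \<le> 1" "\<bar>s\<bar> \<le> 1" by blast
  show ?thesis
  proof
    show *: "mmul (minv g) u \<in> SU" "mmul (minv g') u \<in> SU" using u g by (auto simp: mmul_SU minv_SU)
    show "mob g \<circ> mob (mmul (minv g) u) = mob g' \<circ> mob (mmul (minv g') u)"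
      using g u by (simp add: fun_eq_iff mob_mmul minv_SU)
    show "pt a \<in> nonattr_fixpts (mob (mmul (minv g) u))"
      by (rule eigenvector_fixpt[of _ _ r]) (use * u ab g in \<open>simp_all add: spin_mmul spin_scale\<close>)
    show "pt b \<in> nonattr_fixpts (mob (mmul (minv g') u))"
      by (rule eigenvector_fixpt[of _ _ s]) (use * u ab g in \<open>simp_all add: spin_mmul spin_scale\<close>)
  qed
qed

text \<open>The element u carries z and z' to their images under g and g'. Fixed points inside the
  plane are always nonattracting, so equality of distances suffices.\<close>

lemma meet_interior:
  assumes g: "g \<in> SU" "g' \<in> SU" and z: "z \<in> H2" "z' \<in> H2"
    and eq: "hdist (mob g z) (mob g' z') = hdist z z'"
  obtains c c' where "c \<in> SU" "c' \<in> SU" "mob g \<circ> mob c = mob g' \<circ> mob c'"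
    "z \<in> nonattr_fixpts (mob c)" "z' \<in> nonattr_fixpts (mob c')"
proof -
  obtain u where u: "u \<in> SU" "mob u z = mob g z" "mob u z' = mob g' z'"
    using two_point_homogeneous[OF z, of "mob g z" "mob g' z'"] mob_H2 g z eq by metis
  have zz: "cmod z < 1" "cmod z' < 1" using z by (auto simp: H2_def)
  show ?thesis
  proof
    show *: "mmul (minv g) u \<in> SU" "mmul (minv g') u \<in> SU" using u g by (auto simp: mmul_SU minv_SU)
    show "mob g \<circ> mob (mmul (minv g) u) = mob g' \<circ> mob (mmul (minv g') u)"
      using g u by (simp add: fun_eq_iff mob_mmul minv_SU)
    have "mob (mmul (minv g) u) z = z" "mob (mmul (minv g') u) z' = z'"
      using g u by (simp_all add: mob_mmul minv_SU)
    then show "z \<in> nonattr_fixpts (mob (mmul (minv g) u))" "z' \<in> nonattr_fixpts (mob (mmul (minv g') u))"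
      using * zz by (simp_all add: nonattr_fixpts_iff jac_fix_interior)
  qed
qed

text \<open>The map u = g c = g' c' preserves the product of cone vectors. Its factor is
  \<open>jac g z * jac c z\<close> at z and, read off the other factorization by
  \<open>jac_cong\<close>, \<open>jac g' z' * jac c' z'\<close> at z'; nonattraction bounds the
  factors of c and c' by 1.\<close>

lemma meet_imp_lform_ge:
  assumes g: "g \<in> SU" "g' \<in> SU" and c: "c \<in> SU" "c' \<in> SU" "mob g \<circ> mob c = mob g' \<circ> mob c'"
    and z: "z \<in> nonattr_fixpts (mob c)" "z' \<in> nonattr_fixpts (mob c')"
  shows "lform z z' \<le> lform (mob g z) (mob g' z') * (jac g z * jac g' z')"
proof -
  have 1: "cmod z \<le> 1" "mob c z = z" "jac c z \<le> 1" and 2: "cmod z' \<le> 1" "mob c' z' = z'" "jac c' z' \<le> 1"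
    using z c by (auto simp: nonattr_fixpts_iff)
  define u u' where "u = mmul g c" and "u' = mmul g' c'"
  have u: "u \<in> SU" "u' \<in> SU" "mob u = mob u'"
    using g c by (auto simp: u_def u'_def mmul_SU mob_comp)
  have uz: "mob u z = mob g z" "mob u z' = mob g' z'"
    using 1 2 u(3) g c mob_mmul[OF g(1) c(1)] mob_mmul[OF g(2) c(2)] unfolding u_def u'_def by metis+
  have j: "jac u z = jac g z * jac c z" "jac u z' = jac g' z' * jac c' z'"
    using 1 2 c jac_cong[OF u 2(1)] by (simp_all add: jac_mmul u_def u'_def)
  have pos: "jac c z > 0" "jac c' z' > 0" "jac g z > 0" "jac g' z' > 0"
    using jac_pos 1 2 c g by auto
  have eq: "lform z z' = lform (mob g z) (mob g' z') * (jac u z * jac u z')"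
    using lform_mob[OF u(1) 1(1) 2(1)] uz j pos by simp
  have "jac u z * jac u z' = (jac c z * jac c' z') * (jac g z * jac g' z')" by (simp add: j)
  also have "\<dots> \<le> 1 * (jac g z * jac g' z')"
    using pos 1 2 by (intro mult_right_mono mult_le_one) auto
  finally have le: "jac u z * jac u z' \<le> jac g z * jac g' z'" by simp
  have "(cmod (mob g z))\<^sup>2 \<le> 1" "(cmod (mob g' z'))\<^sup>2 \<le> 1"
    using mob_closed g 1 2 cmod_square_le1 by auto
  then have "lform (mob g z) (mob g' z') \<ge> 0" by (simp add: lform_eq)
  then show ?thesis unfolding eq using le by (intro mult_left_mono) auto
qed

section \<open>Geodesic lines\<close>

definition hline :: "complex set" where "hline = complex_of_real ` {-1<..<1}"
definition hline_bar :: "complex set" where "hline_bar = complex_of_real ` {-1..1}"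

lemma hline_H2: "hline \<subseteq> H2" by (auto simp: hline_def H2_def)

text \<open>Place \<gamma> 0 at the origin and \<gamma> 1 on the positive axis. The distances to
  these two points express cosh t and, by the addition formula, sinh t through |\<delta> t|^2 and Re
  (\<delta> t); then cosh^2 - sinh^2 = 1 forces \<delta> t to be real.\<close>

lemma geodesic_line_hline:
  assumes "geodesic_line l"
  obtains k where "k \<in> SU" "l = mob k ` hline"
proof -
  obtain \<gamma> where \<gamma>: "\<And>t. \<gamma> t \<in> H2" "\<And>s t. hdist (\<gamma> s) (\<gamma> t) = \<bar>s - t\<bar>" "l = range \<gamma>"
    using assms by (auto simp: geodesic_line_def)
  obtain m r where m: "m \<in> SU" "0 \<le> r" "r < 1" "mob m (\<gamma> 0) = 0" "mob m (\<gamma> 1) = of_real r"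
    using move_to_radius[OF \<gamma>(1) \<gamma>(1)] .
  define \<delta> where "\<delta> t = mob m (\<gamma> t)" for t
  have \<delta>: "\<delta> t \<in> H2" "hdist (\<delta> s) (\<delta> t) = \<bar>s - t\<bar>" "\<delta> 0 = 0" "\<delta> 1 = of_real r" for s t
    using \<gamma> m mob_H2 hdist_mob by (auto simp: \<delta>_def)
  have less1: "(cmod (\<delta> t))\<^sup>2 < 1" for t using \<delta>(1)[of t] cmod_square_less1 by (simp add: H2_def)
  have c0: "cosh t = (1 + (cmod (\<delta> t))\<^sup>2) / (1 - (cmod (\<delta> t))\<^sup>2)" for t
    using cosh_hdist(1)[OF \<delta>(1)[of t] \<delta>(1)[of 0]] \<delta>(2)[of t 0] by (simp add: \<delta> lform_def)
  have c1: "sinh t * sinh 1 = 4 * Re (\<delta> t) * r / ((1 - (cmod (\<delta> t))\<^sup>2) * (1 - r\<^sup>2))" for t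
  proof -
    have "cosh (t - 1) = ((1 + (cmod (\<delta> t))\<^sup>2) * (1 + r\<^sup>2) - 4 * (Re (\<delta> t) * r))
        / ((1 - (cmod (\<delta> t))\<^sup>2) * (1 - r\<^sup>2))"
      using cosh_hdist(1)[OF \<delta>(1)[of t] \<delta>(1)[of 1]] \<delta>(2)[of t 1] m
      by (simp add: \<delta> lform_def)
    also have "\<dots> = cosh t * cosh 1 - 4 * (Re (\<delta> t) * r) / ((1 - (cmod (\<delta> t))\<^sup>2) * (1 - r\<^sup>2))"
      unfolding c0 using m by (simp add: \<delta> diff_divide_distrib)
    finally show ?thesis by (simp add: cosh_diff)
  qed
  have "(sinh (1::real))\<^sup>2 = (2 * r / (1 - r\<^sup>2))\<^sup>2"
    using c1[of 1] m by (simp add: \<delta> power2_eq_square field_simps)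
  moreover have r1: "1 - r\<^sup>2 > 0" using less1[of 1] m by (simp add: \<delta>)
  ultimately have s1: "sinh 1 = 2 * r / (1 - r\<^sup>2)" using m
    by (metis (no_types, lifting) divide_nonneg_pos mult_nonneg_nonneg power2_eq_iff_nonneg
        sinh_real_nonneg_iff zero_le_numeral zero_le_one)
  have "sinh (1::real) > 0" by simp
  then have r0: "r > 0" using s1 r1 m by (cases "r = 0") auto
  have sh: "sinh t = 2 * Re (\<delta> t) / (1 - (cmod (\<delta> t))\<^sup>2)" for t
  proof -
    have "sinh t * (2 * r / (1 - r\<^sup>2)) = 2 * Re (\<delta> t) / (1 - (cmod (\<delta> t))\<^sup>2) * (2 * r / (1 - r\<^sup>2))"
      using c1[of t] unfolding s1 by simp
    moreover have "2 * r / (1 - r\<^sup>2) \<noteq> 0" using r0 r1 by simp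
    ultimately show ?thesis using mult_right_cancel by blast
  qed
  have im: "Im (\<delta> t) = 0" for t
  proof -
    let ?n = "1 - (cmod (\<delta> t))\<^sup>2"
    have n: "?n > 0" using less1[of t] by simp
    have "(sinh t)\<^sup>2 = (cosh t)\<^sup>2 - 1" by (simp add: cosh_square_eq)
    then have "(sinh t * ?n)\<^sup>2 = (cosh t * ?n)\<^sup>2 - ?n\<^sup>2"
      by (simp only: power_mult_distrib left_diff_distrib mult_1_left)
    moreover have "sinh t * ?n = 2 * Re (\<delta> t)" "cosh t * ?n = 1 + (cmod (\<delta> t))\<^sup>2"
      using n by (simp_all add: sh[of t] c0[of t])
    ultimately have "(2 * Re (\<delta> t))\<^sup>2 = (1 + (cmod (\<delta> t))\<^sup>2)\<^sup>2 - ?n\<^sup>2" by simp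
    then have "(Re (\<delta> t))\<^sup>2 = (cmod (\<delta> t))\<^sup>2" by (simp add: power2_eq_square algebra_simps)
    then show ?thesis by (simp add: cmod_power2)
  qed
  have ex: "Re (\<delta> t) > -1 \<and> Re (\<delta> t) < 1 \<and> exp t = (1 + Re (\<delta> t)) / (1 - Re (\<delta> t))" for t
  proof -
    let ?x = "Re (\<delta> t)"
    have n: "(cmod (\<delta> t))\<^sup>2 = ?x\<^sup>2" by (simp add: cmod_power2 im)
    have "\<bar>?x\<bar> < 1" using less1[of t] unfolding n by (simp add: abs_square_less_1)
    then have x: "?x > -1" "?x < 1" by auto
    have "exp t = cosh t + sinh t" by (simp add: cosh_plus_sinh)
    also have "\<dots> = (1 + ?x)\<^sup>2 / (1 - ?x\<^sup>2)"
      unfolding sh c0 n by (simp add: add_divide_distrib[symmetric] power2_eq_square algebra_simps)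
    also have "1 - ?x\<^sup>2 = (1 + ?x) * (1 - ?x)" by (simp add: power2_eq_square algebra_simps)
    finally show ?thesis using x by (simp add: power2_eq_square)
  qed
  have "range \<delta> = hline"
  proof (intro equalityI subsetI)
    fix z assume "z \<in> range \<delta>"
    then obtain t where "z = \<delta> t" by auto
    then have "z = of_real (Re (\<delta> t))" using im by (simp add: complex_eq_iff)
    then show "z \<in> hline" using ex[of t] by (auto simp: hline_def)
  next
    fix z assume "z \<in> hline"
    then obtain x where x: "z = of_real x" "-1 < x" "x < 1" by (auto simp: hline_def)
    define t where "t = ln ((1 + x) / (1 - x))"
    have "(1 + x) / (1 - x) = (1 + Re (\<delta> t)) / (1 - Re (\<delta> t))"
      using ex[of t] x by (simp add: t_def)
    then have "Re (\<delta> t) = x" using ex[of t] x by (simp add: field_simps)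
    then have "z = \<delta> t" using im x by (simp add: complex_eq_iff)
    then show "z \<in> range \<delta>" by simp
  qed
  moreover have "l = mob (minv m) ` range \<delta>"
    unfolding \<gamma>(3) \<delta>_def image_image using m(1) by simp
  ultimately show ?thesis using that[of "minv m"] minv_SU m by simp
qed

lemma continuous_on_mob: "m \<in> SU \<Longrightarrow> continuous_on (cball 0 1) (mob m)"
proof -
  assume m: "m \<in> SU"
  have "continuous_on (cball 0 1) (\<lambda>z. (fst m * z + snd m) / den m z)"
    using den_nz[OF m] unfolding den_def by (intro continuous_intros) auto
  then show ?thesis by (rule continuous_on_eq) (simp add: mob_def)
qed

lemma closure_hline: "closure hline = hline_bar"
proof
  have "compact hline_bar" unfolding hline_bar_def by (intro compact_continuous_image continuous_intros) auto
  moreover have "hline \<subseteq> hline_bar" by (auto simp: hline_def hline_bar_def)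
  ultimately show "closure hline \<subseteq> hline_bar" by (simp add: closure_minimal compact_imp_closed)
  have "complex_of_real ` closure {-1<..<1} \<subseteq> closure hline"
    by (rule image_closure_subset) (auto intro!: continuous_intros closure_subset[THEN subsetD] simp: hline_def)
  then show "hline_bar \<subseteq> closure hline" by (simp add: hline_bar_def)
qed

lemma hline_bar_cball: "hline_bar \<subseteq> cball 0 1" by (auto simp: hline_bar_def)

lemma closure_line:
  assumes "k \<in> SU" shows "closure (mob k ` hline) = mob k ` hline_bar"
proof
  have "compact (mob k ` hline_bar)"
    unfolding hline_bar_def by (intro compact_continuous_image continuous_on_subset[OF continuous_on_mob[OF assms]])
      (auto intro!: compact_continuous_image continuous_intros)
  moreover have "hline \<subseteq> hline_bar" by (auto simp: hline_def hline_bar_def)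
  ultimately show "closure (mob k ` hline) \<subseteq> mob k ` hline_bar"
    by (intro closure_minimal image_mono compact_imp_closed)
  have "mob k ` closure hline \<subseteq> closure (mob k ` hline)"
    using continuous_on_subset[OF continuous_on_mob[OF assms] hline_bar_cball]
    by (intro image_closure_subset) (auto simp: closure_hline closure_subset)
  then show "mob k ` hline_bar \<subseteq> closure (mob k ` hline)" by (simp add: closure_hline)
qed

lemma endpoints_line:
  assumes "k \<in> SU" shows "endpoints (mob k ` hline) = {mob k 1, mob k (-1)}"
proof -
  have "inj (mob k)" using mob_inj[OF assms] by (simp add: inj_def)
  moreover have "hline_bar - hline = {1, -1}"
  proof -
    have "hline_bar - hline = complex_of_real ` ({-1..1} - {-1<..<1})"
      unfolding hline_bar_def hline_def by (intro image_set_diff[symmetric]) (simp add: inj_def)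
    also have "{-1..1} - {-1<..<1} = {1, -1::real}" by auto
    finally show ?thesis by simp
  qed
  ultimately show ?thesis
    unfolding endpoints_def closure_line[OF assms] by (simp add: image_set_diff[symmetric])
qed

section \<open>Horoballs\<close>

text \<open>The exponential of the Busemann function at \<open>\<xi>\<close> vanishing at the origin.\<close>

definition busemann_exp :: "complex \<Rightarrow> complex \<Rightarrow> real" where
  "busemann_exp \<xi> z = (cmod (\<xi> - z))\<^sup>2 / (1 - (cmod z)\<^sup>2)"

text \<open>Horoballs by the level of the Busemann function instead of the Euclidean radius: an
  isometry divides the level by its \<open>jac\<close> at the center
  (\<open>mob_hb\<close>).\<close>

definition hb :: "complex \<Rightarrow> real \<Rightarrow> complex set" where
  "hb \<xi> \<rho> = {z \<in> H2. busemann_exp \<xi> z < \<rho>}"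

lemma less_iff_power2_less: "0 \<le> x \<Longrightarrow> 0 \<le> y \<Longrightarrow> x < y \<longleftrightarrow> x\<^sup>2 < y\<^sup>2" for x y :: real
  using power_mono_iff[of y x 2] by (simp flip: not_le)

lemma horoball_eq:
  assumes "cmod \<xi> = 1" "0 < r" "r < 1" shows "horoball \<xi> r = hb \<xi> (r / (1 - r))"
proof (rule set_eqI)
  fix z
  have in1: "z \<in> H2" if "z \<in> horoball \<xi> r"
  proof -
    have "cmod z \<le> cmod ((1 - r) * \<xi>) + cmod (z - (1 - r) * \<xi>)" by (metis norm_triangle_sub)
    also have "cmod ((1 - r) * \<xi>) = 1 - r"
      using assms by (simp add: norm_mult del: of_real_diff)
    also have "1 - r + cmod (z - (1 - r) * \<xi>) < (1 - r) + r" using that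
      by (intro add_le_less_mono) (auto simp: horoball_def dist_norm norm_minus_commute)
    finally show ?thesis by (simp add: H2_def)
  qed
  have x1: "(Re \<xi>)\<^sup>2 + (Im \<xi>)\<^sup>2 = 1" using assms(1) by (simp flip: cmod_power2)
  have "z \<in> horoball \<xi> r \<longleftrightarrow> busemann_exp \<xi> z < r / (1 - r)" if "z \<in> H2"
  proof -
    have z1: "(cmod z)\<^sup>2 < 1" using that cmod_square_less1 by (simp add: H2_def)
    have "z \<in> horoball \<xi> r \<longleftrightarrow> (cmod (z - (1 - r) * \<xi>))\<^sup>2 < r\<^sup>2"
      using assms less_iff_power2_less[of "cmod (z - (1 - r) * \<xi>)" r]
      by (simp add: horoball_def dist_norm norm_minus_commute)
    also have "\<dots> \<longleftrightarrow> (1 - r) * (cmod (\<xi> - z))\<^sup>2 < r * (1 - (cmod z)\<^sup>2)"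
    proof -
      have "(cmod (z - (1 - r) * \<xi>))\<^sup>2 - r\<^sup>2 - ((1 - r) * (cmod (\<xi> - z))\<^sup>2 - r * (1 - (cmod z)\<^sup>2))
        = ((Re \<xi>)\<^sup>2 + (Im \<xi>)\<^sup>2 - 1) * ((1 - r)\<^sup>2 - (1 - r))"
        by (simp add: cmod_power2) (simp add: power2_eq_square algebra_simps)
      then show ?thesis unfolding x1 by auto
    qed
    finally show ?thesis using z1 assms by (simp add: busemann_exp_def field_simps)
  qed
  then show "z \<in> horoball \<xi> r \<longleftrightarrow> z \<in> hb \<xi> (r / (1 - r))" using in1 by (auto simp: hb_def)
qed

lemma busemann_exp_mob:
  assumes "g \<in> SU" "cmod \<xi> = 1" "z \<in> H2"
  shows "busemann_exp (mob g \<xi>) (mob g z) = busemann_exp \<xi> z / jac g \<xi>"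
proof -
  have z: "cmod z \<le> 1" using assms by (simp add: H2_def)
  have "jac g z > 0" "jac g \<xi> > 0" using assms z jac_pos by auto
  then show ?thesis using assms z
    by (simp add: busemann_exp_def mob_diff mob_one_minus norm_divide norm_mult power_divide power_mult_distrib flip: jac_def)
qed

lemma mob_hb:
  assumes "g \<in> SU" "cmod \<xi> = 1"
  shows "mob g ` hb \<xi> \<rho> = hb (mob g \<xi>) (\<rho> / jac g \<xi>)"
proof -
  have j: "jac g \<xi> > 0" using assms jac_pos by auto
  have "mob g z \<in> hb (mob g \<xi>) (\<rho> / jac g \<xi>) \<longleftrightarrow> z \<in> hb \<xi> \<rho>" if "z \<in> H2" for z
    using that assms j by (simp add: hb_def mob_H2 busemann_exp_mob divide_less_cancel)
  note iff = this
  have sub: "hb \<eta> s \<subseteq> H2" for \<eta> s by (auto simp: hb_def)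
  show ?thesis
  proof (intro equalityI subsetI)
    fix w assume "w \<in> mob g ` hb \<xi> \<rho>"
    then show "w \<in> hb (mob g \<xi>) (\<rho> / jac g \<xi>)" using iff sub by auto
  next
    fix w assume w: "w \<in> hb (mob g \<xi>) (\<rho> / jac g \<xi>)"
    then have "mob (minv g) w \<in> H2" using sub assms(1) by (meson minv_SU mob_H2 subsetD)
    then have "mob (minv g) w \<in> hb \<xi> \<rho>" using iff[of "mob (minv g) w"] w assms(1) by simp
    then show "w \<in> mob g ` hb \<xi> \<rho>" using assms(1) by (metis image_eqI mob_mob_minv)
  qed
qed

text \<open>With A = |z - w| and B = |1 - z cnj w|, tanh (d / 2) = A / B, hence exp d = (B + A) / (B
  - A); and B^2 - A^2 is the denominator (1 - |z|^2) (1 - |w|^2).\<close>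

lemma exp_hdist:
  assumes "z \<in> H2" "w \<in> H2"
  shows "exp (hdist z w) = (cmod (z - w) + cmod (1 - z * cnj w))\<^sup>2 / ((1 - (cmod z)\<^sup>2) * (1 - (cmod w)\<^sup>2))"
proof -
  let ?A = "cmod (z - w)" and ?B = "cmod (1 - z * cnj w)"
  define P where "P = (1 - (cmod z)\<^sup>2) * (1 - (cmod w)\<^sup>2)"
  have P: "P > 0" using assms cmod_square_less1 by (auto simp: P_def H2_def)
  have B: "?B\<^sup>2 = ?A\<^sup>2 + P"
    unfolding P_def by (simp add: cmod_power2) (simp add: power2_eq_square algebra_simps)
  have "?A\<^sup>2 < ?B\<^sup>2" using B P by simp
  then have AB: "?A < ?B" by (rule power_less_imp_less_base) simp
  have PF: "P = (?B - ?A) * (?B + ?A)" using B by (simp add: power2_eq_square algebra_simps)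
  define E where "E = (?B + ?A) / (?B - ?A)"
  have E1: "E \<ge> 1" using AB by (simp add: E_def)
  have "?A + ?B > 0" using AB norm_ge_zero[of "z - w"] by linarith
  then have EP: "E = (?A + ?B)\<^sup>2 / P" unfolding PF E_def by (simp add: power2_eq_square add.commute)
  have "cosh (ln E) = (E + 1 / E) / 2" using E1 by (simp add: cosh_ln_real inverse_eq_divide)
  also have "\<dots> = (?A\<^sup>2 + ?B\<^sup>2) / P"
  proof -
    have "?B + ?A > 0" "?B - ?A > 0" using AB norm_ge_zero[of "z - w"] by linarith+
    moreover have "(u / v + v / u) / 2 = (((u - v) / 2)\<^sup>2 + ((u + v) / 2)\<^sup>2) / (v * u)"
      if "u > 0" "v > 0" for u v :: real
      using that by (simp add: divide_simps power2_eq_square) (simp add: algebra_simps)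
    ultimately have "((?B + ?A) / (?B - ?A) + (?B - ?A) / (?B + ?A)) / 2
       = ((((?B + ?A) - (?B - ?A)) / 2)\<^sup>2 + (((?B + ?A) + (?B - ?A)) / 2)\<^sup>2) / P"
      unfolding PF by blast
    moreover have "1 / E = (?B - ?A) / (?B + ?A)" by (simp add: E_def)
    ultimately show ?thesis unfolding E_def by (simp add: add_divide_distrib)
  qed
  also have "\<dots> = cosh (hdist z w)"
    using cosh_hdist(1)[OF assms] by (simp add: B lform_eq flip: P_def)
  finally have "hdist z w = ln E" using cosh_hdist(2)[OF assms] E1 by simp
  then show ?thesis using E1 EP P_def by simp
qed

text \<open>Fact 2 says that Busemann functions are 1-Lipschitz and moves the estimate from z to w;
  fact 1 is the case z = w. Each is the triangle inequality applied to an algebraic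
  identity.\<close>

lemma exp_hdist_lower:
  assumes \<xi>: "cmod \<xi> = 1" "cmod \<xi>' = 1" and zw: "z \<in> H2" "w \<in> H2"
  shows "(cmod (\<xi> - \<xi>'))\<^sup>2 \<le> 4 * (busemann_exp \<xi> z * busemann_exp \<xi>' w) * exp (hdist z w)"
proof -
  have nn: "(cmod z)\<^sup>2 < 1" "(cmod w)\<^sup>2 < 1" using zw cmod_square_less1 by (auto simp: H2_def)
  have conj1: "cmod (1 - cnj v * \<eta>) = cmod (\<eta> - v)" if "cmod \<eta> = 1" for \<eta> v
  proof -
    have "cnj \<eta> * \<eta> = 1" using that by (metis complex_norm_square mult.commute of_real_1 one_power2)
    then have "1 - cnj v * \<eta> = cnj (\<eta> - v) * \<eta>" by (simp add: algebra_simps)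
    then show ?thesis using that by (metis complex_mod_cnj mult.right_neutral norm_mult)
  qed
  have 1: "cmod (\<xi> - \<xi>') * (1 - (cmod w)\<^sup>2) \<le> 2 * cmod (\<xi> - w) * cmod (\<xi>' - w)"
  proof -
    have "(\<xi> - \<xi>') * of_real (1 - (cmod w)\<^sup>2) = (\<xi> - w) * (1 - cnj w * \<xi>') - (\<xi>' - w) * (1 - cnj w * \<xi>)"
      unfolding of_real_diff complex_norm_square by (simp add: algebra_simps)
    then have "cmod (\<xi> - \<xi>') * \<bar>1 - (cmod w)\<^sup>2\<bar> \<le> cmod (\<xi> - w) * cmod (1 - cnj w * \<xi>') + cmod (\<xi>' - w) * cmod (1 - cnj w * \<xi>)"
      by (metis norm_mult norm_of_real norm_triangle_ineq4)
    then show ?thesis using nn by (simp add: conj1 \<xi>)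
  qed
  define S where "S = cmod (z - w) + cmod (1 - z * cnj w)"
  have 2: "cmod (\<xi> - w) * (1 - (cmod z)\<^sup>2) \<le> cmod (\<xi> - z) * S"
  proof -
    have "(\<xi> - w) * of_real (1 - (cmod z)\<^sup>2) = (\<xi> - z) * cnj (1 - z * cnj w) - (w - z) * (1 - cnj z * \<xi>)"
      unfolding of_real_diff complex_norm_square by (simp add: algebra_simps)
    then have "cmod (\<xi> - w) * \<bar>1 - (cmod z)\<^sup>2\<bar> \<le> cmod (\<xi> - z) * cmod (cnj (1 - z * cnj w)) + cmod (w - z) * cmod (1 - cnj z * \<xi>)"
      by (metis norm_mult norm_of_real norm_triangle_ineq4)
    then show ?thesis using nn conj1[OF \<xi>(1), of z] unfolding complex_mod_cnj
      by (simp add: S_def norm_minus_commute[of w z] distrib_left mult.commute add.commute)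
  qed
  define p q where "p = 1 - (cmod z)\<^sup>2" and "q = 1 - (cmod w)\<^sup>2"
  have pq: "p > 0" "q > 0" using nn by (auto simp: p_def q_def)
  have "(cmod (\<xi> - \<xi>') * q) * p \<le> (2 * cmod (\<xi> - w) * cmod (\<xi>' - w)) * p"
    using 1 pq by (intro mult_right_mono) (auto simp: q_def)
  also have "\<dots> = 2 * cmod (\<xi>' - w) * (cmod (\<xi> - w) * p)" by simp
  also have "\<dots> \<le> 2 * cmod (\<xi>' - w) * (cmod (\<xi> - z) * S)"
    using 2 by (intro mult_left_mono) (auto simp: p_def)
  finally have "(cmod (\<xi> - \<xi>') * q * p)\<^sup>2 \<le> (2 * cmod (\<xi>' - w) * (cmod (\<xi> - z) * S))\<^sup>2"
    using pq by (intro power_mono) auto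
  then show ?thesis
    unfolding exp_hdist[OF zw] busemann_exp_def S_def[symmetric] p_def[symmetric] q_def[symmetric]
    using pq by (simp add: power_mult_distrib field_simps power2_eq_square)
qed

lemma busemann_exp_diameter:
  assumes "\<tau> > 0" defines "t \<equiv> (1 - \<tau>) / (1 + \<tau>)"
  shows "complex_of_real t \<in> H2" "busemann_exp 1 (of_real t) = \<tau>" "busemann_exp (-1) (of_real (-t)) = \<tau>"
proof -
  have t: "\<bar>t\<bar> < 1" using assms by (simp add: t_def abs_if field_simps)
  then show "complex_of_real t \<in> H2" by (simp add: H2_def)
  have "t\<^sup>2 < 1" using t by (simp add: abs_square_less_1)
  moreover have "1 - t = \<tau> * (1 + t)" using assms by (simp add: t_def field_simps)
  then have "(1 - t) * (1 - t) = \<tau> * (1 + t) * (1 - t)" by simp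
  then have "(1 - t)\<^sup>2 = \<tau> * (1 - t\<^sup>2)" by (simp add: power2_eq_square algebra_simps)
  ultimately have e: "(1 - t)\<^sup>2 / (1 - t\<^sup>2) = \<tau>" by simp
  have "cmod (1 - of_real t) = \<bar>1 - t\<bar>" "cmod (-1 - of_real (-t)) = \<bar>1 - t\<bar>"
    by (metis norm_of_real of_real_1 of_real_diff) (metis abs_minus_commute norm_of_real of_real_1 of_real_diff of_real_minus minus_diff_commute uminus_add_conv_diff diff_minus_eq_add add.commute)
  then show "busemann_exp 1 (of_real t) = \<tau>" "busemann_exp (-1) (of_real (-t)) = \<tau>"
    unfolding busemann_exp_def using e by simp_all
qed

text \<open>Along the diameter the Busemann functions of its ends are signed arc length, so the
  distance is - ln \<tau> - ln \<tau>'. The bound on the product keeps the two points in this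
  order.\<close>

lemma hdist_diameter:
  assumes "\<tau> > 0" "\<tau>' > 0" "\<tau> * \<tau>' \<le> 1"
  shows "hdist (of_real ((1 - \<tau>) / (1 + \<tau>))) (of_real (- ((1 - \<tau>') / (1 + \<tau>')))) = - ln (\<tau> * \<tau>')"
proof -
  define t t' where "t = (1 - \<tau>) / (1 + \<tau>)" and "t' = (1 - \<tau>') / (1 + \<tau>')"
  have H: "complex_of_real t \<in> H2" "complex_of_real (-t') \<in> H2"
    using busemann_exp_diameter(1) assms by (auto simp: t_def t'_def H2_def)
  \<comment> \<open>As t = tanh (- ln \<tau> / 2), these are cosh and sinh of - ln \<tau>, ready for
    the addition formula.\<close>
  have s: "(1 + t\<^sup>2) / (1 - t\<^sup>2) = (1 / \<tau> + \<tau>) / 2 \<and> 2 * t / (1 - t\<^sup>2) = (1 / \<tau> - \<tau>) / 2"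
    if "\<tau> > 0" "t = (1 - \<tau>) / (1 + \<tau>)" for t \<tau> :: real
  proof -
    have n: "1 - t\<^sup>2 = 4 * \<tau> / (1 + \<tau>)\<^sup>2" and p: "1 + t\<^sup>2 = 2 * (1 + \<tau>\<^sup>2) / (1 + \<tau>)\<^sup>2"
      and m: "2 * t = 2 * (1 - \<tau>\<^sup>2) / (1 + \<tau>)\<^sup>2"
      unfolding that(2) power_divide using that(1) by (simp_all add: divide_simps) (simp_all add: power2_eq_square algebra_simps)
    have "A / (1 + \<tau>)\<^sup>2 / (B / (1 + \<tau>)\<^sup>2) = A / B" for A B using that(1) by simp
    from this[of "2 * (1 + \<tau>\<^sup>2)" "4 * \<tau>"] this[of "2 * (1 - \<tau>\<^sup>2)" "4 * \<tau>"]
    show ?thesis unfolding n p m by (simp only:) (use that(1) in \<open>simp add: field_simps power2_eq_square\<close>)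
  qed
  have "cosh (hdist (of_real t) (of_real (-t'))) = ((1 + t\<^sup>2) * (1 + t'\<^sup>2) + 4 * (t * t')) / ((1 - t\<^sup>2) * (1 - t'\<^sup>2))"
    using cosh_hdist(1)[OF H] by (simp add: lform_def)
  also have "\<dots> = (1 + t\<^sup>2) / (1 - t\<^sup>2) * ((1 + t'\<^sup>2) / (1 - t'\<^sup>2)) + 2 * t / (1 - t\<^sup>2) * (2 * t' / (1 - t'\<^sup>2))"
    unfolding times_divide_times_eq add_divide_distrib[symmetric] by (simp add: mult.left_commute)
  also have "\<dots> = (\<tau> * \<tau>' + 1 / (\<tau> * \<tau>')) / 2"
    unfolding s[OF assms(1) t_def, THEN conjunct1] s[OF assms(1) t_def, THEN conjunct2]
      s[OF assms(2) t'_def, THEN conjunct1] s[OF assms(2) t'_def, THEN conjunct2]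
    using assms(1,2) by (simp add: field_simps)
  also have "\<dots> = cosh (ln (\<tau> * \<tau>'))" using assms by (simp add: cosh_ln_real inverse_eq_divide)
  finally have "\<bar>hdist (of_real t) (of_real (-t'))\<bar> = \<bar>ln (\<tau> * \<tau>')\<bar>" by simp
  moreover have "ln (\<tau> * \<tau>') \<le> 0" using assms by simp
  ultimately show ?thesis using cosh_hdist(2)[OF H] unfolding t_def t'_def by simp
qed

text \<open>The lower bound is \<open>exp_hdist_lower\<close>; for the upper bound the diameter is
  moved to the geodesic joining \<xi> and \<xi>'. Hypothesis \<open>le\<close> says that the open
  horoballs do not overlap.\<close>

lemma hb_dist_eq:
  assumes \<xi>: "cmod \<xi> = 1" "cmod \<xi>' = 1" "\<xi> \<noteq> \<xi>'" and \<rho>: "\<rho> > 0" "\<rho>' > 0"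
    and le: "4 * (\<rho> * \<rho>') \<le> (cmod (\<xi> - \<xi>'))\<^sup>2"
  shows "hb_dist \<xi> (hb \<xi> \<rho>) \<xi>' (hb \<xi>' \<rho>') = ereal (ln ((cmod (\<xi> - \<xi>'))\<^sup>2 / (4 * (\<rho> * \<rho>'))))"
proof -
  define D where "D = (cmod (\<xi> - \<xi>'))\<^sup>2"
  have D: "D > 0" using \<xi> by (simp add: D_def)
  define L where "L = ln (D / (4 * (\<rho> * \<rho>')))"
  obtain a where a: "a \<noteq> 0" "\<xi> = pt a" using pt_surj[OF \<xi>(1)] .
  obtain b where b: "b \<noteq> 0" "\<xi>' = pt b" using pt_surj[OF \<xi>(2)] .
  have ab: "area a b \<noteq> 0" using pt_eq_iff a b \<xi>(3) by blast
  obtain m where m: "m \<in> SU" "spin m 1 = a" "spin m \<i> = of_real (1 / area a b) * b"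
  proof (rule SU_of_basis)
    show "area a (of_real (1 / area a b) * b) = 1" unfolding area_scale_right using ab by simp
  qed
  have p1: "pt 1 = 1" "pt \<i> = -1" by (simp_all add: pt_def)
  have m1: "mob m 1 = \<xi>" using mob_pt[OF m(1), of 1] m(2) a p1 by simp
  have m2: "mob m (-1) = \<xi>'" using mob_pt[OF m(1), of \<i>] m(3) b p1 pt_scale[of "1 / area a b" b] ab by simp
  define j j' where "j = jac m 1" and "j' = jac m (-1)"
  have j: "j > 0" "j' > 0" using jac_pos m(1) by (auto simp: j_def j'_def)
  have "cmod (\<xi> - \<xi>') = cmod (mob m 1 - mob m (-1))" by (simp add: m1 m2)
  then have Dj: "D = 4 / (j * j')"
    using mob_diff[OF m(1), of 1 "-1"]
    by (simp add: D_def j_def j'_def jac_def norm_divide norm_mult power_divide power_mult_distrib)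
  have "(INF p \<in> hb \<xi> \<rho> \<times> hb \<xi>' \<rho>'. ereal (hdist (fst p) (snd p))) = ereal L"
  proof (rule antisym)
    show "(INF p \<in> hb \<xi> \<rho> \<times> hb \<xi>' \<rho>'. ereal (hdist (fst p) (snd p))) \<le> ereal L"
    proof (rule ereal_le_epsilon2)
      fix e :: real assume e: "0 < e"
      \<comment> \<open>Since the horoballs are open, the infimum is only approached: shrinking both
        levels by s costs exactly e in the distance.\<close>
      define s where "s = exp (- e / 2)"
      have s: "s > 0" "s < 1" using e by (auto simp: s_def)
      define \<tau> \<tau>' where "\<tau> = s * \<rho> * j" and "\<tau>' = s * \<rho>' * j'"
      have \<tau>: "\<tau> > 0" "\<tau>' > 0" using s \<rho> j by (auto simp: \<tau>_def \<tau>'_def)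
      have tt: "\<tau> * \<tau>' = s\<^sup>2 * (4 * (\<rho> * \<rho>') / D)"
        using j by (simp add: \<tau>_def \<tau>'_def Dj power2_eq_square)
      have "4 * (\<rho> * \<rho>') / D \<le> 1" using le D by (simp add: D_def)
      moreover have "s\<^sup>2 \<le> 1" using s by (simp add: power_le_one)
      ultimately have t1: "\<tau> * \<tau>' \<le> 1" unfolding tt using \<rho> D by (intro mult_le_one) auto
      define z w where "z = complex_of_real ((1 - \<tau>) / (1 + \<tau>))" and "w = complex_of_real (- ((1 - \<tau>') / (1 + \<tau>')))"
      have zw: "z \<in> H2" "w \<in> H2" using busemann_exp_diameter(1)[OF \<tau>(1)] busemann_exp_diameter(1)[OF \<tau>(2)]
        by (auto simp: z_def w_def H2_def)
      have "busemann_exp \<xi> (mob m z) = s * \<rho>"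
        using busemann_exp_mob[OF m(1) _ zw(1), of 1] busemann_exp_diameter(2)[OF \<tau>(1)] j
        by (simp add: m1 z_def \<tau>_def flip: j_def)
      then have "mob m z \<in> hb \<xi> \<rho>" using s \<rho> zw m by (simp add: hb_def mob_H2)
      moreover have "busemann_exp \<xi>' (mob m w) = s * \<rho>'"
        using busemann_exp_mob[OF m(1) _ zw(2), of "-1"] busemann_exp_diameter(3)[OF \<tau>(2)] j
        by (simp add: m2 w_def \<tau>'_def flip: j'_def)
      then have "mob m w \<in> hb \<xi>' \<rho>'" using s \<rho> zw m by (simp add: hb_def mob_H2)
      ultimately have "(INF p \<in> hb \<xi> \<rho> \<times> hb \<xi>' \<rho>'. ereal (hdist (fst p) (snd p))) \<le> ereal (hdist (mob m z) (mob m w))"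
        by (intro INF_lower2[of "(mob m z, mob m w)"]) auto
      also have "hdist (mob m z) (mob m w) = - ln (\<tau> * \<tau>')"
        using hdist_mob[OF m(1) zw] hdist_diameter[OF \<tau> t1] by (simp add: z_def w_def)
      also have "\<dots> = L + e"
      proof -
        have "ln (\<tau> * \<tau>') = ln (s\<^sup>2) + ln (4 * (\<rho> * \<rho>') / D)"
          unfolding tt using s \<rho> D by (intro ln_mult_pos) auto
        also have "ln (s\<^sup>2) = - e" using s by (simp add: ln_realpow s_def)
        also have "ln (4 * (\<rho> * \<rho>') / D) = - L" unfolding L_def using \<rho> D by (simp add: ln_div)
        finally show ?thesis by simp
      qed
      finally show "(INF p \<in> hb \<xi> \<rho> \<times> hb \<xi>' \<rho>'. ereal (hdist (fst p) (snd p))) \<le> ereal L + ereal e" by simp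
    qed
    show "ereal L \<le> (INF p \<in> hb \<xi> \<rho> \<times> hb \<xi>' \<rho>'. ereal (hdist (fst p) (snd p)))"
    proof (rule INF_greatest)
      fix p assume "p \<in> hb \<xi> \<rho> \<times> hb \<xi>' \<rho>'"
      then obtain z w where p: "p = (z, w)" and zw: "z \<in> H2" "w \<in> H2"
        "busemann_exp \<xi> z < \<rho>" "busemann_exp \<xi>' w < \<rho>'" by (auto simp: hb_def)
      have bn: "busemann_exp \<eta> v \<ge> 0" if "v \<in> H2" for \<eta> v
        using that cmod_square_less1[of v] by (simp add: busemann_exp_def H2_def)
      have "D \<le> 4 * (busemann_exp \<xi> z * busemann_exp \<xi>' w) * exp (hdist z w)"
        using exp_hdist_lower[OF \<xi>(1,2) zw(1,2)] by (simp add: D_def)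
      also have "\<dots> \<le> 4 * (\<rho> * \<rho>') * exp (hdist z w)"
        using zw bn \<rho> by (intro mult_right_mono mult_left_mono mult_mono) auto
      finally have "D / (4 * (\<rho> * \<rho>')) \<le> exp (hdist z w)" using \<rho> by (simp add: field_simps)
      then have "L \<le> hdist z w" unfolding L_def using \<rho> D 
        by (metis divide_pos_pos exp_gt_zero ln_exp ln_le_cancel_iff mult_pos_pos zero_less_numeral)
      then show "ereal L \<le> ereal (hdist (fst p) (snd p))" by (simp add: p)
    qed
  qed
  then show ?thesis using \<xi>(3) by (simp add: hb_dist_def L_def D_def)
qed

lemma F_ideal_eqI:
  assumes "r0 > 0" "\<And>r r'. 0 < r \<Longrightarrow> r < r0 \<Longrightarrow> 0 < r' \<Longrightarrow> r' < r0 \<Longrightarrow>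
      hb_dist (g xi) (g ` horoball xi r) (g' xi') (g' ` horoball xi' r')
      - hb_dist xi (horoball xi r) xi' (horoball xi' r') = c"
  shows "F_ideal g g' xi xi' = c"
  unfolding F_ideal_def
proof (rule the_equality)
  show "\<exists>r0>0. \<forall>r r'. 0 < r \<and> r < r0 \<and> 0 < r' \<and> r' < r0 \<longrightarrow>
      hb_dist (g xi) (g ` horoball xi r) (g' xi') (g' ` horoball xi' r')
      - hb_dist xi (horoball xi r) xi' (horoball xi' r') = c" using assms by blast
next
  fix d assume "\<exists>r0>0. \<forall>r r'. 0 < r \<and> r < r0 \<and> 0 < r' \<and> r' < r0 \<longrightarrow>
      hb_dist (g xi) (g ` horoball xi r) (g' xi') (g' ` horoball xi' r')
      - hb_dist xi (horoball xi r) xi' (horoball xi' r') = d"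
  then obtain r1 where r1: "r1 > 0" "\<And>r r'. 0 < r \<Longrightarrow> r < r1 \<Longrightarrow> 0 < r' \<Longrightarrow> r' < r1 \<Longrightarrow>
      hb_dist (g xi) (g ` horoball xi r) (g' xi') (g' ` horoball xi' r')
      - hb_dist xi (horoball xi r) xi' (horoball xi' r') = d" by blast
  define r where "r = min r0 r1 / 2"
  have "0 < r" "r < r0" "r < r1" using assms r1 by (auto simp: r_def)
  then show "d = c" using assms(2)[of r r] r1(2)[of r r] by simp
qed

text \<open>For small horoballs the change of distance is the logarithm of the ratio of squared
  areas, because the levels are only rescaled by \<open>jac\<close> and cancel. If the image points
  coincide, the value is -\<infinity>, matching a vanishing area.\<close>

lemma F_ideal_neg_iff:
  assumes g: "g \<in> SU" "g' \<in> SU" and ab: "a \<noteq> 0" "b \<noteq> 0"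
  shows "pt a \<noteq> pt b \<and> F_ideal (mob g) (mob g') (pt a) (pt b) < 0
     \<longleftrightarrow> \<bar>area (spin g a) (spin g' b)\<bar> < \<bar>area a b\<bar>"
proof (cases "pt a = pt b")
  case True
  then show ?thesis using ab by (simp add: pt_eq_iff)
next
  case False
  then have ar: "area a b \<noteq> 0" using ab by (simp add: pt_eq_iff)
  have nz: "spin g a \<noteq> 0" "spin g' b \<noteq> 0" using g ab by (auto simp: spin_eq_0_iff)
  have c: "cmod (pt a) = 1" "cmod (pt b) = 1" "cmod (mob g (pt a)) = 1" "cmod (mob g' (pt b)) = 1"
    using ab g by (auto simp: pt_circle mob_circle)
  define D D' j j' where "D = (cmod (pt a - pt b))\<^sup>2" and "D' = (cmod (mob g (pt a) - mob g' (pt b)))\<^sup>2"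
    and "j = jac g (pt a)" and "j' = jac g' (pt b)"
  have D: "D > 0" using False by (simp add: D_def)
  have j: "j > 0" "j' > 0" using jac_pos g c by (auto simp: j_def j'_def)
  define s where "s r = r / (1 - r)" for r :: real
  have s: "0 < s r \<and> s r \<le> 2 * r" if "0 < r" "r < 1/2" for r
    using that mult_pos_pos[of r "1/2 - r"] by (simp add: s_def field_simps)
  \<comment> \<open>Radii below 1/2 and sqrt E / 4 have levels at most sqrt E / 2, as
    \<open>hb_dist_eq\<close> requires for squared chord E.\<close>
  have small: "4 * (s r * s r') \<le> E" if "0 < r" "r < min (1/2) (sqrt E / 4)"
    "0 < r'" "r' < min (1/2) (sqrt E / 4)" "E > 0" for r r' E
  proof -
    have "s r * s r' \<le> (sqrt E / 2) * (sqrt E / 2)"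
      using that s[of r] s[of r'] by (intro mult_mono) auto
    also have "\<dots> = E / 4" using that by simp
    finally show ?thesis by simp
  qed
  have h0: "hb_dist (pt a) (horoball (pt a) r) (pt b) (horoball (pt b) r') = ereal (ln (D / (4 * (s r * s r'))))"
    if "0 < r" "r < min (1/2) (sqrt D / 4)" "0 < r'" "r' < min (1/2) (sqrt D / 4)" for r r'
    using that hb_dist_eq[OF c(1,2) False, of "s r" "s r'"] s small[OF that D] c
    by (simp add: D_def horoball_eq flip: s_def)
  show ?thesis
  proof (cases "mob g (pt a) = mob g' (pt b)")
    case True
    have "F_ideal (mob g) (mob g') (pt a) (pt b) = - \<infinity>"
    proof (rule F_ideal_eqI)
      show "min (1/2) (sqrt D / 4) > 0" using D by simp
    next
      fix r r' :: real assume "0 < r" "r < min (1/2) (sqrt D / 4)" "0 < r'" "r' < min (1/2) (sqrt D / 4)"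
      from h0[OF this] True show "hb_dist (mob g (pt a)) (mob g ` horoball (pt a) r) (mob g' (pt b)) (mob g' ` horoball (pt b) r')
         - hb_dist (pt a) (horoball (pt a) r) (pt b) (horoball (pt b) r') = - \<infinity>"
        by (simp add: hb_dist_def[of "mob g' (pt b)" _ "mob g' (pt b)"])
    qed
    moreover have "area (spin g a) (spin g' b) = 0"
      using True g ab nz by (simp add: mob_pt pt_eq_iff)
    ultimately show ?thesis using False ar by simp
  next
    case ne: False
    then have D': "D' > 0" by (simp add: D'_def)
    \<comment> \<open>Both pairs of horoballs must be free of overlap. The image levels are s r / j
      and s r' / j', whence the factor j j'.\<close>
    define E where "E = min D (D' * (j * j'))"
    have E: "E > 0" "E \<le> D" "E \<le> D' * (j * j')" using D D' j by (auto simp: E_def)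
    have "F_ideal (mob g) (mob g') (pt a) (pt b) = ereal (ln (D' * (j * j') / D))"
    proof (rule F_ideal_eqI)
      show "min (1/2) (sqrt E / 4) > 0" using E by simp
    next
      fix r r' :: real assume r: "0 < r" "r < min (1/2) (sqrt E / 4)" "0 < r'" "r' < min (1/2) (sqrt E / 4)"
      have "sqrt E \<le> sqrt D" using E by simp
      then have rD: "r < min (1/2) (sqrt D / 4)" "r' < min (1/2) (sqrt D / 4)"
        using r unfolding min_less_iff_conj by linarith+
      have sp: "s r > 0" "s r' > 0" using s r by auto
      have "4 * (s r / j * (s r' / j')) \<le> D'"
        using small[OF r E(1)] E(3) j by (simp add: field_simps)
      then have "hb_dist (mob g (pt a)) (mob g ` horoball (pt a) r) (mob g' (pt b)) (mob g' ` horoball (pt b) r')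
        = ereal (ln (D' / (4 * (s r / j * (s r' / j')))))"
        using hb_dist_eq[OF c(3,4) ne, of "s r / j" "s r' / j'"] sp j r c g
        by (simp add: horoball_eq mob_hb D'_def flip: s_def j_def j'_def)
      also have "\<dots> = ereal (ln (D' * (j * j') / D) + ln (D / (4 * (s r * s r'))))"
        using sp j D D' by (subst ln_mult_pos[symmetric]) (auto simp: field_simps)
      finally show "hb_dist (mob g (pt a)) (mob g ` horoball (pt a) r) (mob g' (pt b)) (mob g' ` horoball (pt b) r')
         - hb_dist (pt a) (horoball (pt a) r) (pt b) (horoball (pt b) r') = ereal (ln (D' * (j * j') / D))"
        using h0[OF r(1) rD(1) r(3) rD(2)] by simp
    qed
    moreover have "D' * (j * j') / D = (area (spin g a) (spin g' b))\<^sup>2 / (area a b)\<^sup>2"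
      using ab nz g ar
      by (simp add: D_def D'_def j_def j'_def mob_pt area_diff jac_pt power_divide power_mult_distrib)
    moreover have "area (spin g a) (spin g' b) \<noteq> 0"
      using ne g ab nz by (simp add: mob_pt pt_eq_iff)
    moreover have "x\<^sup>2 / y\<^sup>2 < 1 \<longleftrightarrow> \<bar>x\<bar> < \<bar>y\<bar>" if "y \<noteq> 0" for x y :: real
      using that less_iff_power2_less[of "\<bar>x\<bar>" "\<bar>y\<bar>"] by simp
    ultimately show ?thesis using ar False by simp
  qed
qed

section \<open>The endpoint criterion\<close>

text \<open>The criterion of condition (3) in spinor coordinates: \<open>1\<close> and \<open>\<i>\<close> represent the two
  endpoints of the hline.\<close>

definition contracting ::
  "complex \<times> complex \<Rightarrow> complex \<times> complex \<Rightarrow> complex \<times> complex \<Rightarrow> complex \<times> complex \<Rightarrow> bool" where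
  "contracting g g' k k' \<longleftrightarrow> (\<forall>a\<in>{1, \<i>}. \<forall>b\<in>{1, \<i>}.
     \<bar>area (spin g (spin k a)) (spin g' (spin k' b))\<bar> < \<bar>area (spin k a) (spin k' b)\<bar>)"

lemma area_swap: "area b a = - area a b"
  by (simp add: area_def algebra_simps)

lemma contracting_sym: "contracting g g' k k' \<Longrightarrow> contracting g' g k' k"
  unfolding contracting_def
proof (intro ballI)
  fix a b :: complex
  assume "\<forall>a\<in>{1, \<i>}. \<forall>b\<in>{1, \<i>}.
     \<bar>area (spin g (spin k a)) (spin g' (spin k' b))\<bar> < \<bar>area (spin k a) (spin k' b)\<bar>"
    and "a \<in> {1, \<i>}" "b \<in> {1, \<i>}"
  then show "\<bar>area (spin g' (spin k' a)) (spin g (spin k b))\<bar> < \<bar>area (spin k' a) (spin k b)\<bar>"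
    unfolding area_swap[of _ "spin g (spin k b)"] area_swap[of _ "spin k b"] abs_minus_cancel by blast
qed

lemma pt_1 [simp]: "pt 1 = 1" and pt_ii [simp]: "pt \<i> = -1"
  by (simp_all add: pt_def)

lemma endpoints_contracting_iff:
  assumes "g \<in> SU" "g' \<in> SU" "k \<in> SU" "k' \<in> SU"
  shows "(\<forall>xi\<in>endpoints (mob k ` hline). \<forall>xi'\<in>endpoints (mob k' ` hline).
      xi \<noteq> xi' \<and> F_ideal (mob g) (mob g') xi xi' < 0) \<longleftrightarrow> contracting g g' k k'"
proof -
  have e: "endpoints (mob k ` hline) = {pt (spin k 1), pt (spin k \<i>)}" if "k \<in> SU" for k
    using that by (simp add: endpoints_line flip: mob_pt)
  have "spin k a \<noteq> 0" if "k \<in> SU" "a \<in> {1, \<i>}" for k a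
    using that spin_eq_0_iff by auto
  then have "contracting g g' k k' \<longleftrightarrow> (\<forall>a\<in>{1, \<i>}. \<forall>b\<in>{1, \<i>}.
      pt (spin k a) \<noteq> pt (spin k' b) \<and> F_ideal (mob g) (mob g') (pt (spin k a)) (pt (spin k' b)) < 0)"
    unfolding contracting_def using assms by (intro ball_cong refl F_ideal_neg_iff[symmetric]) auto
  then show ?thesis using assms by (simp add: e)
qed

section \<open>Reduction to common elements of two families\<close>

definition fixing :: "complex set \<Rightarrow> (complex \<Rightarrow> complex) set" where
  "fixing A = {h \<in> G0. nonattr_fixpts h \<inter> A \<noteq> {}}"

lemma Cstar_fixing: "Cstar l = fixing (closure l)"
  by (simp add: Cstar_def fixing_def)

lemma id_G0: "id \<in> G0"
proof -
  have "mob (1, 0) = id" by (simp add: fun_eq_iff)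
  then show ?thesis using one_SU unfolding G0_eq by (metis imageI)
qed

text \<open>\<open>Hstar_plus\<close> omits the identity, but the identity fixes every point and so
  lies in \<open>Cstar\<close>. Thus the closed half-space has the same form as the crooked plane,
  with P \<union> closure l in place of closure l.\<close>

lemma Hstar_plus_closed_fixing:
  assumes "closure l \<noteq> {}" "closure l \<subseteq> H2bar"
  shows "Hstar_plus_closed l P = fixing (P \<union> closure l)"
proof -
  have "nonattr_fixpts id = H2bar"
  proof -
    have id: "mob (1, 0) = id" by (simp add: fun_eq_iff)
    have "jac (1, 0) p = 1" for p by (simp add: jac_def den_def)
    then show ?thesis using nonattr_fixpts_iff[OF one_SU] unfolding id
      by (auto simp: H2bar_def)
  qed
  moreover have "H2bar \<inter> closure l \<noteq> {}" using assms by (simp add: Int_absorb1)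
  ultimately have id: "nonattr_fixpts id \<inter> closure l \<noteq> {}" by simp
  show ?thesis
  proof (intro set_eqI)
    fix h
    show "h \<in> Hstar_plus_closed l P \<longleftrightarrow> h \<in> fixing (P \<union> closure l)"
      by (cases "h = id")
        (use id id_G0 in \<open>auto simp: Hstar_plus_closed_def Hstar_plus_def Cstar_fixing fixing_def Int_Un_distrib\<close>)
  qed
qed

definition meet ::
  "complex \<times> complex \<Rightarrow> complex \<times> complex \<Rightarrow> complex set \<Rightarrow> complex set \<Rightarrow> bool" where
  "meet g g' A A' \<longleftrightarrow> (\<exists>c\<in>SU. \<exists>c'\<in>SU. mob g \<circ> mob c = mob g' \<circ> mob c' \<and>
     nonattr_fixpts (mob c) \<inter> A \<noteq> {} \<and> nonattr_fixpts (mob c') \<inter> A' \<noteq> {})"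

lemma meet_iff: "lmul (mob g) (fixing A) \<inter> lmul (mob g') (fixing A') = {} \<longleftrightarrow> \<not> meet g g' A A'"
proof
  assume *: "lmul (mob g) (fixing A) \<inter> lmul (mob g') (fixing A') = {}"
  show "\<not> meet g g' A A'"
  proof
    assume "meet g g' A A'"
    then obtain c c' where c: "c \<in> SU" "c' \<in> SU" "mob g \<circ> mob c = mob g' \<circ> mob c'"
      "nonattr_fixpts (mob c) \<inter> A \<noteq> {}" "nonattr_fixpts (mob c') \<inter> A' \<noteq> {}"
      unfolding meet_def by blast
    then have "mob c \<in> fixing A" "mob c' \<in> fixing A'" by (simp_all add: fixing_def G0_eq)
    then have "mob g \<circ> mob c \<in> lmul (mob g) (fixing A) \<inter> lmul (mob g') (fixing A')"
      unfolding lmul_def using c(3) by (metis IntI imageI)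
    then show False using * by simp
  qed
next
  assume *: "\<not> meet g g' A A'"
  show "lmul (mob g) (fixing A) \<inter> lmul (mob g') (fixing A') = {}"
  proof (rule equals0I)
    fix u assume "u \<in> lmul (mob g) (fixing A) \<inter> lmul (mob g') (fixing A')"
    then obtain h h' where h: "h \<in> fixing A" "h' \<in> fixing A'" "mob g \<circ> h = mob g' \<circ> h'"
      by (auto simp: lmul_def)
    then obtain c c' where "c \<in> SU" "c' \<in> SU" "h = mob c" "h' = mob c'" by (auto simp: fixing_def G0_eq)
    then show False using * h unfolding meet_def fixing_def by blast
  qed
qed

lemma meet_sym: "meet g g' A A' \<Longrightarrow> meet g' g A' A"
  unfolding meet_def by metis

lemma meet_mono: "meet g g' A A' \<Longrightarrow> A \<subseteq> B \<Longrightarrow> A' \<subseteq> B' \<Longrightarrow> meet g g' B B'"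
  unfolding meet_def by blast

text \<open>Bilinearity reduces the nonexistence of a common element to ideal points, since the cone
  vector \<open>(1 + |y|\<^sup>2, 2 y)\<close> is a sum of two null vectors \<open>(|a|\<^sup>2, a\<^sup>2)\<close>, \<open>(|b|\<^sup>2, b\<^sup>2)\<close>.\<close>

lemma not_meet_if_null:
  assumes gk: "g \<in> SU" "g' \<in> SU" "k \<in> SU" "k' \<in> SU"
    and Y: "\<And>y. y \<in> Y \<Longrightarrow> cmod y \<le> 1 \<and> (\<exists>a\<in>Z. \<exists>b\<in>Z. 1 + (cmod y)\<^sup>2 = (cmod a)\<^sup>2 + (cmod b)\<^sup>2 \<and> 2 * y = a\<^sup>2 + b\<^sup>2)"
    and Y': "\<And>y. y \<in> Y' \<Longrightarrow> cmod y \<le> 1 \<and> (\<exists>a\<in>Z'. \<exists>b\<in>Z'. 1 + (cmod y)\<^sup>2 = (cmod a)\<^sup>2 + (cmod b)\<^sup>2 \<and> 2 * y = a\<^sup>2 + b\<^sup>2)"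
    and less: "\<And>a b. a \<in> Z \<Longrightarrow> b \<in> Z' \<Longrightarrow> a \<noteq> 0 \<Longrightarrow> b \<noteq> 0 \<Longrightarrow>
      \<bar>area (spin g (spin k a)) (spin g' (spin k' b))\<bar> < \<bar>area (spin k a) (spin k' b)\<bar>"
  shows "\<not> meet g g' (mob k ` Y) (mob k' ` Y')"
proof
  assume "meet g g' (mob k ` Y) (mob k' ` Y')"
  then obtain c c' y y' where c: "c \<in> SU" "c' \<in> SU" "mob g \<circ> mob c = mob g' \<circ> mob c'"
    and y: "y \<in> Y" "y' \<in> Y'" "mob k y \<in> nonattr_fixpts (mob c)" "mob k' y' \<in> nonattr_fixpts (mob c')"
    unfolding meet_def by blast
  obtain a b where ab: "a \<in> Z" "b \<in> Z" "cmod y \<le> 1" "1 + (cmod y)\<^sup>2 = (cmod a)\<^sup>2 + (cmod b)\<^sup>2" "2 * y = a\<^sup>2 + b\<^sup>2"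
    using Y[OF y(1)] by blast
  obtain a' b' where ab': "a' \<in> Z'" "b' \<in> Z'" "cmod y' \<le> 1" "1 + (cmod y')\<^sup>2 = (cmod a')\<^sup>2 + (cmod b')\<^sup>2" "2 * y' = a'\<^sup>2 + b'\<^sup>2"
    using Y'[OF y(2)] by blast
  define d q where "d u v = (area (spin k u) (spin k' v))\<^sup>2"
    and "q u v = (area (spin g (spin k u)) (spin g' (spin k' v)))\<^sup>2" for u v
  have j: "jac k y > 0" "jac k' y' > 0" using jac_pos gk ab ab' by auto
  have "lform (mob k y) (mob k' y') * (jac k y * jac k' y')
    \<le> lform (mob g (mob k y)) (mob g' (mob k' y')) * (jac g (mob k y) * jac g' (mob k' y')) * (jac k y * jac k' y')"
    using meet_imp_lform_ge[OF gk(1,2) c y(3,4)] j by (intro mult_right_mono) auto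
  also have "\<dots> = lform (mob (mmul g k) y) (mob (mmul g' k') y') * (jac (mmul g k) y * jac (mmul g' k') y')"
    using gk ab(3) ab'(3) by (simp add: mob_mmul jac_mmul)
  finally have le: "d a a' + d a b' + d b a' + d b b' \<le> q a a' + q a b' + q b a' + q b b'"
    using lform_spin[OF gk(3,4) ab(3) ab'(3) ab(4,5) ab'(4,5)]
      lform_spin[OF mmul_SU[OF gk(1,3)] mmul_SU[OF gk(2,4)] ab(3) ab'(3) ab(4,5) ab'(4,5)]
    by (simp add: spin_mmul d_def q_def)
  have s: "q u v < d u v" if "u \<in> Z" "v \<in> Z'" "u \<noteq> 0" "v \<noteq> 0" for u v
    using less[OF that] less_iff_power2_less by (metis abs_ge_zero d_def power2_abs q_def)
  have z: "q u v = 0 \<and> d u v = 0" if "u = 0 \<or> v = 0" for u v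
    using that by (auto simp: q_def d_def area_def)
  have w: "q u v \<le> d u v" if "u \<in> Z" "v \<in> Z'" for u v
    using s[OF that] z[of u v] by (cases "u = 0 \<or> v = 0") auto
  \<comment> \<open>The time components 1 + |y|^2 and 1 + |y'|^2 are positive, so some pair of
    nonzero spinors occurs and makes the inequality of the sums strict.\<close>
  have "a \<noteq> 0 \<or> b \<noteq> 0" "a' \<noteq> 0 \<or> b' \<noteq> 0"
  proof -
    have "1 + (cmod y)\<^sup>2 \<noteq> 0" "1 + (cmod y')\<^sup>2 \<noteq> 0"
      using zero_le_power2[of "cmod y"] zero_le_power2[of "cmod y'"] by linarith+
    then show "a \<noteq> 0 \<or> b \<noteq> 0" "a' \<noteq> 0 \<or> b' \<noteq> 0" using ab(4) ab'(4) by auto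
  qed
  then have "q a a' < d a a' \<or> q a b' < d a b' \<or> q b a' < d b a' \<or> q b b' < d b b'"
    using s ab ab' by blast
  then show False using le w[OF ab(1) ab'(1)] w[OF ab(1) ab'(2)] w[OF ab(2) ab'(1)] w[OF ab(2) ab'(2)]
    by linarith
qed

text \<open>(1 + t^2, 2 t) = (1 + t)^2 / 2 (1, 1) + (1 - t)^2 / 2 (1, -1), and (1, 1), (1, -1) are
  the null vectors of 1 and \<i>.\<close>

lemma hline_bar_null:
  assumes "y \<in> hline_bar"
  obtains r s where "cmod y \<le> 1"
    "1 + (cmod y)\<^sup>2 = (cmod (of_real r * 1))\<^sup>2 + (cmod (of_real s * \<i>))\<^sup>2"
    "2 * y = (of_real r * 1)\<^sup>2 + (of_real s * \<i>)\<^sup>2"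
proof -
  obtain t where t: "y = of_real t" "\<bar>t\<bar> \<le> 1" using assms by (auto simp: hline_bar_def)
  define r s where "r = (1 + t) / sqrt 2" and "s = (1 - t) / sqrt 2"
  have r2: "r\<^sup>2 = (1 + t)\<^sup>2 / 2" "s\<^sup>2 = (1 - t)\<^sup>2 / 2" by (simp_all add: r_def s_def power_divide)
  show ?thesis
  proof
    show "cmod y \<le> 1" using t by simp
    show "1 + (cmod y)\<^sup>2 = (cmod (of_real r * 1))\<^sup>2 + (cmod (of_real s * \<i>))\<^sup>2"
    proof -
      have "1 + t\<^sup>2 = r\<^sup>2 + s\<^sup>2" unfolding r2 by (simp add: power2_eq_square field_simps)
      then show ?thesis by (simp add: t norm_mult)
    qed
    have "2 * t = r\<^sup>2 - s\<^sup>2" unfolding r2 by (simp add: power2_eq_square field_simps)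
    then have "complex_of_real (2 * t) = of_real (r\<^sup>2 - s\<^sup>2)" by simp
    then show "2 * y = (of_real r * 1)\<^sup>2 + (of_real s * \<i>)\<^sup>2" by (simp add: t power_mult_distrib)
  qed
qed

text \<open>Vary only the real part of the cone vector: with T and q kept, the segment through it
  ends at two null vectors with real parts s and -s. Both ends have imaginary part q \<ge> 0, so
  their square roots lie in the closed first quadrant.\<close>

lemma half_disc_null:
  assumes "cmod y \<le> 1" "Im y \<ge> 0"
  obtains a b where "Re a \<ge> 0" "Im a \<ge> 0" "Re b \<ge> 0" "Im b \<ge> 0"
    "1 + (cmod y)\<^sup>2 = (cmod a)\<^sup>2 + (cmod b)\<^sup>2" "2 * y = a\<^sup>2 + b\<^sup>2"
proof -
  define T p q where "T = 1 + (cmod y)\<^sup>2" and "p = 2 * Re y" and "q = 2 * Im y"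
  have T: "T \<ge> 1" by (simp add: T_def)
  have q: "q \<ge> 0" using assms by (simp add: q_def)
  have "0 \<le> (1 - (cmod y)\<^sup>2)\<^sup>2" by simp
  also have "\<dots> = T\<^sup>2 - 4 * (cmod y)\<^sup>2" by (simp add: T_def power2_eq_square algebra_simps)
  also have "4 * (cmod y)\<^sup>2 = p\<^sup>2 + q\<^sup>2" by (simp add: cmod_power2 p_def q_def power_mult_distrib)
  finally have pq: "p\<^sup>2 \<le> T\<^sup>2 - q\<^sup>2" by simp
  define s where "s = sqrt (T\<^sup>2 - q\<^sup>2)"
  have Tq: "T\<^sup>2 - q\<^sup>2 \<ge> 0" using pq zero_le_power2[of p] by linarith
  have s: "s \<ge> 0" "s\<^sup>2 + q\<^sup>2 = T\<^sup>2" using Tq by (simp_all add: s_def)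
  have ps: "\<bar>p\<bar> \<le> s" unfolding s_def using pq by (rule real_le_rsqrt[of "\<bar>p\<bar>", simplified])
  \<comment> \<open>The weight of the end with real part s. If s = 0 then p = 0 too, and the value 0
    given by division by zero is as good as any.\<close>
  define c where "c = (s + p) / (2 * s)"
  have c: "0 \<le> c" "c \<le> 1" using ps s by (auto simp: c_def divide_le_eq_1)
  have cp: "c * s - (1 - c) * s = p" using ps by (cases "s = 0") (auto simp: c_def field_simps)
  have qd: "Re (csqrt w) \<ge> 0 \<and> Im (csqrt w) \<ge> 0" if "Im w \<ge> 0" for w
    using that abs_Re_le_cmod[of w] by (auto simp: sgn_if)
  define W1 W2 where "W1 = Complex s q" and "W2 = Complex (- s) q"
  have nW: "cmod W1 = T" "cmod W2 = T" using s T by (simp_all add: W1_def W2_def cmod_def)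
  show ?thesis
  proof
    show "0 \<le> Re (of_real (sqrt c) * csqrt W1)" "0 \<le> Im (of_real (sqrt c) * csqrt W1)"
      "0 \<le> Re (of_real (sqrt (1 - c)) * csqrt W2)" "0 \<le> Im (of_real (sqrt (1 - c)) * csqrt W2)"
      using qd[of W1] qd[of W2] c q 
      by (auto simp: W1_def W2_def simp del: csqrt.simps)
    have "(cmod (csqrt W1))\<^sup>2 = T" "(cmod (csqrt W2))\<^sup>2 = T" using nW T by (simp_all flip: norm_power)
    then show "1 + (cmod y)\<^sup>2 = (cmod (of_real (sqrt c) * csqrt W1))\<^sup>2 + (cmod (of_real (sqrt (1 - c)) * csqrt W2))\<^sup>2"
      using c by (simp add: norm_mult power_mult_distrib del: csqrt.simps) (simp add: T_def algebra_simps)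
    have "2 * y = of_real c * W1 + of_real (1 - c) * W2"
      using cp by (simp add: complex_eq_iff W1_def W2_def p_def q_def algebra_simps)
    moreover have "(complex_of_real (sqrt r))\<^sup>2 = of_real r" if "r \<ge> 0" for r
      using that by (simp flip: of_real_power)
    ultimately show "2 * y = (of_real (sqrt c) * csqrt W1)\<^sup>2 + (of_real (sqrt (1 - c)) * csqrt W2)\<^sup>2"
      using c by (simp add: power_mult_distrib del: csqrt.simps of_real_diff)
  qed
qed

lemma contracting_not_meet:
  assumes "g \<in> SU" "g' \<in> SU" "k \<in> SU" "k' \<in> SU" "contracting g g' k k'"
  shows "\<not> meet g g' (mob k ` hline_bar) (mob k' ` hline_bar)"
proof (rule not_meet_if_null[OF assms(1-4)])
  let ?Z = "{of_real r * e | r e. e \<in> {1, \<i>}} :: complex set"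
  show "cmod y \<le> 1 \<and> (\<exists>a\<in>?Z. \<exists>b\<in>?Z. 1 + (cmod y)\<^sup>2 = (cmod a)\<^sup>2 + (cmod b)\<^sup>2 \<and> 2 * y = a\<^sup>2 + b\<^sup>2)"
    if y: "y \<in> hline_bar" for y
  proof -
    obtain r s where rs: "cmod y \<le> 1" "1 + (cmod y)\<^sup>2 = (cmod (of_real r * 1))\<^sup>2 + (cmod (of_real s * \<i>))\<^sup>2"
      "2 * y = (of_real r * 1)\<^sup>2 + (of_real s * \<i>)\<^sup>2" using hline_bar_null[OF y] .
    have "of_real r * 1 \<in> ?Z" "of_real s * \<i> \<in> ?Z" by blast+
    then show ?thesis using rs by blast
  qed
  then show "cmod y \<le> 1 \<and> (\<exists>a\<in>?Z. \<exists>b\<in>?Z. 1 + (cmod y)\<^sup>2 = (cmod a)\<^sup>2 + (cmod b)\<^sup>2 \<and> 2 * y = a\<^sup>2 + b\<^sup>2)"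
    if "y \<in> hline_bar" for y using that .
  fix a b assume "a \<in> ?Z" "b \<in> ?Z" and nz: "a \<noteq> 0" "b \<noteq> 0"
  then obtain r e s f where e: "e \<in> {1, \<i>}" "f \<in> {1, \<i>}" and a: "a = of_real r * e" and b: "b = of_real s * f"
    by blast
  have "\<bar>area (spin g (spin k e)) (spin g' (spin k' f))\<bar> < \<bar>area (spin k e) (spin k' f)\<bar>"
    using assms(5) e unfolding contracting_def by blast
  moreover have "\<bar>r * s\<bar> > 0" using nz a b by auto
  ultimately show "\<bar>area (spin g (spin k a)) (spin g' (spin k' b))\<bar> < \<bar>area (spin k a) (spin k' b)\<bar>"
    unfolding a b spin_scale area_scale_left area_scale_right mult.assoc[symmetric] abs_mult[of "r * s"] mult.commute[of s r]
    using mult_strict_left_mono by blast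
qed

section \<open>Interior points of the lines and the uniform gap\<close>

text \<open>The point of the diameter whose cone vector is proportional to \<open>x\<close> times the null vector of
  the endpoint spinor \<open>a\<close> plus \<open>1 / x\<close> times the other one.\<close>

definition axpt :: "complex \<Rightarrow> real \<Rightarrow> complex" where
  "axpt a x = of_real (if a = 1 then (x - 1) / (x + 1) else (1 - x) / (x + 1))"

lemma axpt_hline: "x > 0 \<Longrightarrow> axpt a x \<in> hline"
  unfolding axpt_def hline_def by (intro imageI) (simp add: field_simps)

lemma hline_axpt: assumes "y \<in> hline" obtains x where "x > 0" "y = axpt 1 x"
proof -
  obtain t where t: "y = of_real t" "-1 < t" "t < 1" using assms by (auto simp: hline_def)
  define x where "x = (1 + t) / (1 - t)"
  have "x > 0" using t by (simp add: x_def)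
  moreover have "(x - 1) / (x + 1) = t" using t by (simp add: x_def field_simps)
  then have "axpt 1 x = y" unfolding axpt_def t(1) by (simp only: simp_thms if_True)
  ultimately show ?thesis using that by blast
qed

lemma axpt_null:
  assumes "(a, a') \<in> {(1, \<i>), (\<i>, 1)}" "x > 0"
  obtains s where "s > 0" "1 + (cmod (axpt a x))\<^sup>2 = (cmod (of_real (s * sqrt x) * a))\<^sup>2 + (cmod (of_real (s / sqrt x) * a'))\<^sup>2"
    "2 * axpt a x = (of_real (s * sqrt x) * a)\<^sup>2 + (of_real (s / sqrt x) * a')\<^sup>2"
    "1 - (cmod (axpt a x))\<^sup>2 = 2 * s\<^sup>2"
proof
  define y where "y = (x - 1) / (x + 1)"
  define s where "s = sqrt (2 * x) / (x + 1)"
  show "s > 0" using assms by (simp add: s_def)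
  have s2: "s\<^sup>2 = 2 * x / (x + 1)\<^sup>2" using assms by (simp add: s_def power_divide)
  have sx: "(s * sqrt x)\<^sup>2 = 2 * x\<^sup>2 / (x + 1)\<^sup>2" "(s / sqrt x)\<^sup>2 = 2 / (x + 1)\<^sup>2"
  proof -
    have "(s * sqrt x)\<^sup>2 = s\<^sup>2 * x" "(s / sqrt x)\<^sup>2 = s\<^sup>2 / x"
      using assms(2) by (simp_all add: power_mult_distrib power_divide)
    then show "(s * sqrt x)\<^sup>2 = 2 * x\<^sup>2 / (x + 1)\<^sup>2" "(s / sqrt x)\<^sup>2 = 2 / (x + 1)\<^sup>2"
      unfolding s2 using assms(2) by (simp_all add: power2_eq_square[of x])
  qed
  have xp: "x + 1 \<noteq> 0" using assms by simp
  have y1: "1 + y\<^sup>2 = (s * sqrt x)\<^sup>2 + (s / sqrt x)\<^sup>2" "2 * y = (s * sqrt x)\<^sup>2 - (s / sqrt x)\<^sup>2"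
    "1 - y\<^sup>2 = 2 * s\<^sup>2"
    unfolding sx s2 y_def using xp by (simp_all add: divide_simps) (simp_all add: power2_eq_square algebra_simps)
  have ax: "axpt a x = of_real (if a = 1 then y else - y)" by (simp add: axpt_def y_def minus_divide_left)
  have n: "(cmod (axpt a x))\<^sup>2 = y\<^sup>2" by (simp add: ax)
  have ca: "cmod a = 1" "cmod a' = 1" using assms by auto
  show "1 + (cmod (axpt a x))\<^sup>2 = (cmod (of_real (s * sqrt x) * a))\<^sup>2 + (cmod (of_real (s / sqrt x) * a'))\<^sup>2"
    unfolding n y1 norm_mult ca norm_of_real mult_1_right power2_abs ..
  show "1 - (cmod (axpt a x))\<^sup>2 = 2 * s\<^sup>2" unfolding n y1 ..
  have "2 * complex_of_real y = of_real ((s * sqrt x)\<^sup>2) - of_real ((s / sqrt x)\<^sup>2)"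
    by (simp only: of_real_diff[symmetric] y1(2)[symmetric]) simp
  then show "2 * axpt a x = (of_real (s * sqrt x) * a)\<^sup>2 + (of_real (s / sqrt x) * a')\<^sup>2"
    unfolding ax power_mult_distrib of_real_power[symmetric] using assms(1) by auto
qed

text \<open>ln x is the signed distance of \<open>axpt a x\<close> from the origin towards
  \<open>pt a\<close>, so large x and x' isolate the area of a and b; exchanging labels isolates any
  of the four pairs.\<close>

lemma cosh_axpt:
  assumes k: "k \<in> SU" "k' \<in> SU" and ab: "(a, a') \<in> {(1, \<i>), (\<i>, 1)}" "(b, b') \<in> {(1, \<i>), (\<i>, 1)}"
    and x: "x > 0" "x' > 0"
  shows "cosh (hdist (mob k (axpt a x)) (mob k' (axpt b x'))) =
    (x * x' * (area (spin k a) (spin k' b))\<^sup>2 + x / x' * (area (spin k a) (spin k' b'))\<^sup>2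
     + x' / x * (area (spin k a') (spin k' b))\<^sup>2 + 1 / (x * x') * (area (spin k a') (spin k' b'))\<^sup>2) / 2"
proof -
  obtain s where s: "s > 0"
    "1 + (cmod (axpt a x))\<^sup>2 = (cmod (of_real (s * sqrt x) * a))\<^sup>2 + (cmod (of_real (s / sqrt x) * a'))\<^sup>2"
    "2 * axpt a x = (of_real (s * sqrt x) * a)\<^sup>2 + (of_real (s / sqrt x) * a')\<^sup>2"
    "1 - (cmod (axpt a x))\<^sup>2 = 2 * s\<^sup>2" using axpt_null[OF ab(1) x(1)] .
  obtain t where t: "t > 0"
    "1 + (cmod (axpt b x'))\<^sup>2 = (cmod (of_real (t * sqrt x') * b))\<^sup>2 + (cmod (of_real (t / sqrt x') * b'))\<^sup>2"
    "2 * axpt b x' = (of_real (t * sqrt x') * b)\<^sup>2 + (of_real (t / sqrt x') * b')\<^sup>2"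
    "1 - (cmod (axpt b x'))\<^sup>2 = 2 * t\<^sup>2" using axpt_null[OF ab(2) x(2)] .
  have H: "axpt a x \<in> H2" "axpt b x' \<in> H2" using axpt_hline x hline_H2 by blast+
  have le: "cmod (axpt a x) \<le> 1" "cmod (axpt b x') \<le> 1" using H by (auto simp: H2_def)
  have "cosh (hdist (mob k (axpt a x)) (mob k' (axpt b x')))
     = lform (mob k (axpt a x)) (mob k' (axpt b x')) * (jac k (axpt a x) * jac k' (axpt b x')) / (4 * s\<^sup>2 * t\<^sup>2)"
    using k le H by (subst cosh_hdist) (simp_all add: mob_H2 mob_one_minus s t)
  also have "\<dots> = (x * x' * (area (spin k a) (spin k' b))\<^sup>2 + x / x' * (area (spin k a) (spin k' b'))\<^sup>2
     + x' / x * (area (spin k a') (spin k' b))\<^sup>2 + 1 / (x * x') * (area (spin k a') (spin k' b'))\<^sup>2) / 2"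
    unfolding lform_spin[OF k le s(2,3) t(2,3)] spin_scale area_scale_left area_scale_right
    using s(1) t(1) x by (simp add: power_mult_distrib power_divide field_simps)
  finally show ?thesis .
qed

text \<open>\<open>spin k a\<close> and \<open>spin k a'\<close> form a basis and the area form is
  nondegenerate. So if a shared endpoint makes one area vanish, the other endpoint of that line has
  nonzero area.\<close>

lemma area_dual:
  assumes "k \<in> SU" "(a, a') \<in> {(1, \<i>), (\<i>, 1)}" "v \<noteq> 0" "area (spin k a) v = 0"
  shows "area (spin k a') v \<noteq> 0"
proof
  assume 0: "area (spin k a') v = 0"
  have z: "area a (spin (minv k) v) = 0" "area a' (spin (minv k) v) = 0"
    using assms 0 area_spin[OF assms(1), of _ "spin (minv k) v"] by simp_all
  moreover have "spin (minv k) v \<noteq> 0" using assms minv_SU spin_eq_0_iff by blast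
  ultimately show False using assms(2) by (auto simp: area_def complex_eq_iff)
qed

lemma basis_pt: "a \<in> {1, \<i>} \<Longrightarrow> a \<noteq> 0 \<and> pt a \<in> hline_bar"
  using image_eqI[of 1 complex_of_real 1 "{-1..1}"] image_eqI[of "-1" complex_of_real "-1" "{-1..1}"]
  by (auto simp: hline_bar_def)

lemma meetI:
  assumes "c \<in> SU" "c' \<in> SU" "mob g \<circ> mob c = mob g' \<circ> mob c'" "z \<in> nonattr_fixpts (mob c)"
    "z' \<in> nonattr_fixpts (mob c')" "z \<in> A" "z' \<in> A'"
  shows "meet g g' A A'"
  using assms unfolding meet_def by blast

lemma meet_spinors:
  assumes g: "g \<in> SU" "g' \<in> SU" "k \<in> SU" "k' \<in> SU" and ab: "a \<noteq> 0" "b \<noteq> 0" "pt a \<in> A" "pt b \<in> A'"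
    and le: "\<bar>area (spin k a) (spin k' b)\<bar> \<le> \<bar>area (spin g (spin k a)) (spin g' (spin k' b))\<bar>"
    and nd: "area (spin k a) (spin k' b) \<noteq> 0 \<or> area (spin g (spin k a)) (spin g' (spin k' b)) = 0"
  shows "meet g g' (mob k ` A) (mob k' ` A')"
proof -
  have nz: "spin k a \<noteq> 0" "spin k' b \<noteq> 0" using spin_eq_0_iff g ab by auto
  obtain c c' where "c \<in> SU" "c' \<in> SU" "mob g \<circ> mob c = mob g' \<circ> mob c'"
    "pt (spin k a) \<in> nonattr_fixpts (mob c)" "pt (spin k' b) \<in> nonattr_fixpts (mob c')"
    using meet_ideal[OF g(1,2) nz le nd] .
  then show ?thesis by (rule meetI) (use g ab in \<open>auto simp flip: mob_pt\<close>)
qed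

text \<open>If no pair of endpoints gives a common element, (3) can fail only at a shared endpoint
  a, b with distinct images. The change of cosh is then a combination of four monomials in x, x'
  with coefficients r, positive near a, b and negative near a', b. A zero of it is a pair of
  interior points at unchanged distance.\<close>

lemma not_contracting_meet:
  assumes g: "g \<in> SU" "g' \<in> SU" "k \<in> SU" "k' \<in> SU" and nc: "\<not> contracting g g' k k'"
  shows "meet g g' (mob k ` hline_bar) (mob k' ` hline_bar)"
proof (rule ccontr)
  assume nm: "\<not> ?thesis"
  define d q where "d a b = area (spin k a) (spin k' b)"
    and "q a b = area (spin g (spin k a)) (spin g' (spin k' b))" for a b
  have caseA: "\<bar>q a b\<bar> < \<bar>d a b\<bar> \<or> d a b = 0 \<and> q a b \<noteq> 0" if "a \<in> {1, \<i>}" "b \<in> {1, \<i>}" for a b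
    using meet_spinors[OF g, of a b hline_bar hline_bar] basis_pt that nm unfolding d_def q_def by force
  obtain a b where ab: "a \<in> {1, \<i>}" "b \<in> {1, \<i>}" "\<not> \<bar>q a b\<bar> < \<bar>d a b\<bar>"
    using nc unfolding contracting_def d_def q_def by blast
  then have dq: "d a b = 0" "q a b \<noteq> 0" using caseA by auto
  obtain a' b' where a': "(a, a') \<in> {(1, \<i>), (\<i>, 1)}" and b': "(b, b') \<in> {(1, \<i>), (\<i>, 1)}" using ab by auto
  have "spin k' b \<noteq> 0" using g ab spin_eq_0_iff by auto
  then have d': "d a' b \<noteq> 0" using area_dual[OF g(3) a'] dq by (simp add: d_def)
  moreover have "a' \<in> {1, \<i>}" using a' by auto
  ultimately have "\<bar>q a' b\<bar> < \<bar>d a' b\<bar>" using caseA[of a' b] ab by blast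
  define r where "r u v = (q u v)\<^sup>2 - (d u v)\<^sup>2" for u v
  have r1: "r a b > 0" using dq by (simp add: r_def)
  have r2: "r a' b < 0"
    using \<open>\<bar>q a' b\<bar> < \<bar>d a' b\<bar>\<close> less_iff_power2_less[of "\<bar>q a' b\<bar>" "\<bar>d a' b\<bar>"] by (simp add: r_def)
  \<comment> \<open>So large that the x'^2 terms dominate and A and B below are both
    positive.\<close>
  define x' where "x' = sqrt (1 + \<bar>r a b'\<bar> / r a b + \<bar>r a' b'\<bar> / (- r a' b))"
  have pos: "1 + \<bar>r a b'\<bar> / r a b + \<bar>r a' b'\<bar> / (- r a' b) > 0"
    using r1 r2 by (intro add_pos_nonneg divide_nonneg_pos) auto
  have x': "x' > 0" "x' * x' = 1 + \<bar>r a b'\<bar> / r a b + \<bar>r a' b'\<bar> / (- r a' b)"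
    using pos by (simp_all add: x'_def)
  define A B where "A = r a b * (x' * x') + r a b'" and "B = - (r a' b * (x' * x') + r a' b')"
  have "A = r a b + (\<bar>r a b'\<bar> + r a b') + r a b * (\<bar>r a' b'\<bar> / (- r a' b))"
    unfolding A_def x'(2) using r1 by (simp add: field_simps)
  moreover have "r a b * (\<bar>r a' b'\<bar> / (- r a' b)) \<ge> 0" using r1 r2 by (intro mult_nonneg_nonneg divide_nonneg_pos) auto
  ultimately have A: "A > 0" using r1 by linarith
  have "B = - r a' b + (\<bar>r a' b'\<bar> - r a' b') + (- r a' b) * (\<bar>r a b'\<bar> / r a b)"
    unfolding B_def x'(2) using r2 by (simp add: field_simps)
  moreover have "(- r a' b) * (\<bar>r a b'\<bar> / r a b) \<ge> 0" using r1 r2 by (intro mult_nonneg_nonneg divide_nonneg_pos) auto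
  ultimately have B: "B > 0" using r2 by linarith
  \<comment> \<open>With this x' the change of cosh is half of (x^2 A - B) / (x x'), which vanishes
    for x^2 = B / A.\<close>
  define x where "x = sqrt (B / A)"
  have x: "x > 0" "x * x = B / A" using A B by (simp_all add: x_def)
  have "x * x' * r a b + x / x' * r a b' + x' / x * r a' b + 1 / (x * x') * r a' b'
     = (x * x * A - B) / (x * x')"
    using x(1) x'(1) by (simp add: A_def B_def field_simps)
  also have "\<dots> = 0" unfolding x(2) using A by simp
  finally have eq: "x * x' * r a b + x / x' * r a b' + x' / x * r a' b + 1 / (x * x') * r a' b' = 0" .
  define z z' where "z = mob k (axpt a x)" and "z' = mob k' (axpt b x')"
  have ax: "axpt a x \<in> hline" "axpt b x' \<in> hline" using axpt_hline x x' by auto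
  then have zH: "z \<in> H2" "z' \<in> H2" using hline_H2 mob_H2[OF g(3)] mob_H2[OF g(4)] by (auto simp: z_def z'_def)
  have "cosh (hdist (mob (mmul g k) (axpt a x)) (mob (mmul g' k') (axpt b x'))) = cosh (hdist z z')"
    unfolding z_def z'_def cosh_axpt[OF g(3,4) a' b' x(1) x'(1)]
      cosh_axpt[OF mmul_SU[OF g(1,3)] mmul_SU[OF g(2,4)] a' b' x(1) x'(1)]
    using eq unfolding r_def d_def q_def spin_mmul by (simp add: algebra_simps)
  then have "cosh (hdist (mob g z) (mob g' z')) = cosh (hdist z z')"
    using g by (simp add: mob_mmul z_def z'_def)
  then have "hdist (mob g z) (mob g' z') = hdist z z'"
    using cosh_hdist(2) zH mob_H2 g by simp
  then obtain c c' where c: "c \<in> SU" "c' \<in> SU" "mob g \<circ> mob c = mob g' \<circ> mob c'"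
    "z \<in> nonattr_fixpts (mob c)" "z' \<in> nonattr_fixpts (mob c')"
    by (rule meet_interior[OF g(1,2) zH])
  have "hline \<subseteq> hline_bar" by (auto simp: hline_def hline_bar_def)
  then have "z \<in> mob k ` hline_bar" "z' \<in> mob k' ` hline_bar" using ax by (auto simp: z_def z'_def)
  then have "meet g g' (mob k ` hline_bar) (mob k' ` hline_bar)" by (rule meetI[OF c])
  with nm show False by contradiction
qed

text \<open>Isolates the factor exp (-K); for h, K \<ge> 0 the remainder lies between 0 and sinh K.
  One direction between (2) and (3) drops the remainder, the other bounds it.\<close>

lemma cosh_diff_exp: "cosh (h - K) = exp (- K) * cosh h + exp (- h) * sinh K" for h K :: real
proof -
  have "cosh (h - K) = cosh h * cosh K - sinh h * sinh K" by (rule cosh_diff)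
  also have "cosh K = exp (- K) + sinh K" by (simp flip: cosh_minus_sinh)
  also have "cosh h * (exp (- K) + sinh K) - sinh h * sinh K = exp (- K) * cosh h + (cosh h - sinh h) * sinh K"
    by (simp add: algebra_simps)
  finally show ?thesis by (simp only: cosh_minus_sinh)
qed

lemma contracting_uniform:
  assumes g: "g \<in> SU" "g' \<in> SU" "k \<in> SU" "k' \<in> SU" and c: "contracting g g' k k'"
  shows "\<exists>K>0. \<forall>x\<in>mob k ` hline. \<forall>x'\<in>mob k' ` hline. hdist (mob g x) (mob g' x') - hdist x x' \<le> - K"
proof -
  define d q where "d a b = (area (spin k a) (spin k' b))\<^sup>2"
    and "q a b = (area (spin g (spin k a)) (spin g' (spin k' b)))\<^sup>2" for a b
  have qd: "q a b < d a b" "q a b \<ge> 0" if "a \<in> {1, \<i>}" "b \<in> {1, \<i>}" for a b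
    using c that less_iff_power2_less unfolding contracting_def d_def q_def
    by (metis abs_ge_zero power2_abs) simp
  \<comment> \<open>The worst of the four ratios; the entry 1/2 keeps \<kappa> positive, so that K =
    - ln \<kappa> makes sense.\<close>
  define \<kappa> where "\<kappa> = max (1/2) (max (max (q 1 1 / d 1 1) (q 1 \<i> / d 1 \<i>)) (max (q \<i> 1 / d \<i> 1) (q \<i> \<i> / d \<i> \<i>)))"
  have r1: "q a b / d a b < 1" if "a \<in> {1, \<i>}" "b \<in> {1, \<i>}" for a b
    using qd[OF that] by simp
  have \<kappa>: "0 < \<kappa>" "\<kappa> < 1" using r1 by (auto simp: \<kappa>_def)
  have q\<kappa>: "q a b \<le> \<kappa> * d a b" if "a \<in> {1, \<i>}" "b \<in> {1, \<i>}" for a b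
  proof -
    have "d a b > 0" using qd[OF that] by linarith
    moreover have "q a b / d a b \<le> \<kappa>" using that by (auto simp: \<kappa>_def)
    ultimately show ?thesis by (simp only: pos_divide_le_eq)
  qed
  define K where "K = - ln \<kappa>"
  have K: "K > 0" "exp (- K) = \<kappa>" using \<kappa> by (simp_all add: K_def)
  have "hdist (mob g x) (mob g' x') - hdist x x' \<le> - K" if xm: "x \<in> mob k ` hline" "x' \<in> mob k' ` hline" for x x'
  proof -
    obtain y where "y \<in> hline" and y: "x = mob k y" using xm(1) by blast
    then obtain s where "s > 0" "y = axpt 1 s" by (elim hline_axpt)
    with y have s: "s > 0" "x = mob k (axpt 1 s)" by simp_all
    obtain y where "y \<in> hline" and y: "x' = mob k' y" using xm(2) by blast
    then obtain t where "t > 0" "y = axpt 1 t" by (elim hline_axpt)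
    with y have t: "t > 0" "x' = mob k' (axpt 1 t)" by simp_all
    have H: "x \<in> H2" "x' \<in> H2" using xm hline_H2 mob_H2[OF g(3)] mob_H2[OF g(4)] by auto
    define a b where "a = hdist (mob g x) (mob g' x')" and "b = hdist x x'"
    have ab: "a \<ge> 0" "b \<ge> 0" using cosh_hdist(2) H mob_H2 g by (auto simp: a_def b_def)
    have p: "(1, \<i>) \<in> {(1, \<i>), (\<i>, 1::complex)}" by simp
    have cb: "cosh b = (s * t * d 1 1 + s / t * d 1 \<i> + t / s * d \<i> 1 + 1 / (s * t) * d \<i> \<i>) / 2"
      unfolding b_def s(2) t(2) cosh_axpt[OF g(3,4) p p s(1) t(1)] d_def ..
    have "a = hdist (mob (mmul g k) (axpt 1 s)) (mob (mmul g' k') (axpt 1 t))"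
      using g by (simp add: a_def s t mob_mmul)
    then have "cosh a = (s * t * q 1 1 + s / t * q 1 \<i> + t / s * q \<i> 1 + 1 / (s * t) * q \<i> \<i>) / 2"
      using cosh_axpt[OF mmul_SU[OF g(1,3)] mmul_SU[OF g(2,4)] p p s(1) t(1)] by (simp add: q_def spin_mmul)
    also have "\<dots> \<le> (s * t * (\<kappa> * d 1 1) + s / t * (\<kappa> * d 1 \<i>) + t / s * (\<kappa> * d \<i> 1) + 1 / (s * t) * (\<kappa> * d \<i> \<i>)) / 2"
      using s(1) t(1) q\<kappa> by (intro divide_right_mono add_mono mult_left_mono) auto
    also have "\<dots> = \<kappa> * cosh b" unfolding cb by (simp add: algebra_simps)
    finally have ca: "cosh a \<le> \<kappa> * cosh b" .
    have "\<kappa> * cosh b \<le> cosh (b - K)"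
    proof -
      have "exp (- b) * sinh K \<ge> 0" using K(1) by simp
      then show ?thesis unfolding cosh_diff_exp K(2) by simp
    qed
    with ca have "cosh a \<le> cosh (b - K)" by (rule order_trans)
    \<comment> \<open>Needed before cosh can be cancelled: as cosh a \<ge> 1, the distance b cannot
      be small.\<close>
    moreover have "b \<ge> K"
    proof -
      have "1 \<le> \<kappa> * cosh b" by (rule order_trans[OF cosh_real_ge_1 ca])
      then have "exp K * 1 \<le> exp K * (exp (- K) * cosh b)" unfolding K(2) by (intro mult_left_mono) auto
      then have "exp K \<le> cosh b" by (simp flip: mult.assoc exp_add)
      moreover have "cosh K \<le> exp K" using K(1) by (simp add: cosh_def)
      ultimately have "cosh K \<le> cosh b" by (rule order_trans[rotated])
      then show ?thesis using K ab by (simp add: cosh_real_nonneg_le_iff)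
    qed
    ultimately have "a \<le> b - K" using ab by (simp add: cosh_real_nonneg_le_iff)
    then show ?thesis by (simp add: a_def b_def)
  qed
  then show ?thesis using K by blast
qed

text \<open>The areas are the entries of the area form in two bases of area 1 or -1;
  \<open>pl\<close> is the Pluecker relation. When one area vanishes, this keeps the two mixed areas
  nonzero.\<close>

lemma area_det:
  assumes "k \<in> SU" "k' \<in> SU" "(a, a') \<in> {(1, \<i>), (\<i>, 1)}" "(b, b') \<in> {(1, \<i>), (\<i>, 1)}"
  shows "(area (spin k a) (spin k' b) * area (spin k a') (spin k' b')
       - area (spin k a) (spin k' b') * area (spin k a') (spin k' b))\<^sup>2 = 1"
proof -
  have pl: "area u v * area u' v' - area u v' * area u' v = area u u' * area v v'" for u v u' v'
    by (simp add: area_def algebra_simps)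
  show ?thesis unfolding pl area_spin[OF assms(1)] area_spin[OF assms(2)]
    using assms(3,4) by (auto simp: area_def)
qed

text \<open>Sending the points to the endpoints a and b leaves only the a, b terms of the cosh, so q
  \<le> exp (-K) d for the squared areas. This is strict only if d is nonzero, which the gap also
  provides: points of the two lines are at distance at least K, while lines with a common endpoint
  come arbitrarily close.\<close>

lemma uniform_contracting:
  assumes g: "g \<in> SU" "g' \<in> SU" "k \<in> SU" "k' \<in> SU" and K: "K > 0"
    and le: "\<And>x x'. x \<in> mob k ` hline \<Longrightarrow> x' \<in> mob k' ` hline \<Longrightarrow> hdist (mob g x) (mob g' x') - hdist x x' \<le> - K"
  shows "contracting g g' k k'"
proof -
  have main: "\<bar>area (spin g (spin k a)) (spin g' (spin k' b))\<bar> < \<bar>area (spin k a) (spin k' b)\<bar>"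
    if ab: "(a, a') \<in> {(1, \<i>), (\<i>, 1)}" "(b, b') \<in> {(1, \<i>), (\<i>, 1)}" for a a' b b'
  proof -
    define d q where "d u v = (area (spin k u) (spin k' v))\<^sup>2"
      and "q u v = (area (spin g (spin k u)) (spin g' (spin k' v)))\<^sup>2" for u v
    define A where "A s t = (s * t * d a b + s / t * d a b' + t / s * d a' b + 1 / (s * t) * d a' b') / 2" for s t
    have nn: "d u v \<ge> 0" "q u v \<ge> 0" for u v by (auto simp: d_def q_def)
    have both: "cosh K \<le> A s t \<and> s * t * q a b / 2 \<le> exp (- K) * A s t + sinh K" if st: "s > 0" "t > 0" for s t
    proof -
      define x x' where "x = mob k (axpt a s)" and "x' = mob k' (axpt b t)"
      have xx: "x \<in> mob k ` hline" "x' \<in> mob k' ` hline" using axpt_hline st by (auto simp: x_def x'_def)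
      have H: "x \<in> H2" "x' \<in> H2" using xx hline_H2 mob_H2[OF g(3)] mob_H2[OF g(4)] by auto
      define h h' where "h = hdist x x'" and "h' = hdist (mob g x) (mob g' x')"
      have hh: "h' \<ge> 0" "h \<ge> 0" "h' \<le> h - K"
        using cosh_hdist(2) H mob_H2 g le[OF xx] by (auto simp: h_def h'_def)
      have ch: "cosh h = A s t"
        unfolding h_def x_def x'_def cosh_axpt[OF g(3,4) ab st] A_def d_def ..
      have "cosh K \<le> cosh h" using hh K by (simp add: cosh_real_nonneg_le_iff)
      have "h' = hdist (mob (mmul g k) (axpt a s)) (mob (mmul g' k') (axpt b t))"
        using g by (simp add: h'_def x_def x'_def mob_mmul)
      then have ch': "cosh h' = (s * t * q a b + s / t * q a b' + t / s * q a' b + 1 / (s * t) * q a' b') / 2"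
        using cosh_axpt[OF mmul_SU[OF g(1,3)] mmul_SU[OF g(2,4)] ab st] by (simp add: q_def spin_mmul)
      have "s / t * q a b' \<ge> 0" "t / s * q a' b \<ge> 0" "1 / (s * t) * q a' b' \<ge> 0"
        using st nn by (auto intro!: mult_nonneg_nonneg)
      then have "s * t * q a b / 2 \<le> cosh h'" unfolding ch' by (intro divide_right_mono) (simp_all only: add_increasing2 order_refl zero_le_numeral)
      also have "\<dots> \<le> cosh (h - K)" using hh by (simp add: cosh_real_nonneg_le_iff)
      also have "\<dots> = exp (- K) * cosh h + exp (- h) * sinh K"
        by (rule cosh_diff_exp)
      also have "\<dots> \<le> exp (- K) * cosh h + 1 * sinh K"
        using hh K by (intro add_left_mono mult_right_mono) auto
      finally show ?thesis using ch \<open>cosh K \<le> cosh h\<close> by simp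
    qed
    have d0: "d a b \<noteq> 0"
    proof
      assume d0: "d a b = 0"
      have "d a b' * d a' b = 1" using area_det[OF g(3,4) ab] d0 by (simp add: d_def power_mult_distrib)
      then have "d a b' \<noteq> 0" by auto
      with \<open>d a b' * d a' b = 1\<close> have dp: "d a b' > 0" "d a' b = 1 / d a b'"
        using nn[of a b'] by (simp_all add: less_le eq_divide_eq mult.commute)
      define e where "e = cosh K - 1"
      have e: "e > 0"
      proof -
        have "cosh 0 < cosh K" using K by (subst cosh_real_nonneg_less_iff) auto
        then show ?thesis by (simp add: e_def)
      qed
      define r where "r = d a b'"
      \<comment> \<open>With t = s r the mixed terms of A contribute exactly 1, because d a b' d a'
        b = 1; s makes the last term at most e / 2. The summand 1 keeps s positive.\<close>
      define s where "s = sqrt ((d a' b' + 1) / (r * e))"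
      have sp: "(d a' b' + 1) / (r * e) > 0" using e dp nn[of a' b'] by (simp add: r_def add_nonneg_pos)
      have s: "s > 0" "s * s = (d a' b' + 1) / (r * e)" using sp unfolding s_def by (simp, intro real_sqrt_mult_self[THEN trans] abs_of_pos)
      have "A s (s * r) = (2 + d a' b' / (s * s * r)) / 2"
        using s(1) dp by (simp add: A_def d0 r_def mult.assoc)
      also have "d a' b' / (s * s * r) = d a' b' / (d a' b' + 1) * e"
        unfolding s(2) using dp e by (simp add: r_def)
      also have "d a' b' / (d a' b' + 1) * e \<le> 1 * e"
        using e nn[of a' b'] by (intro mult_right_mono) (auto simp: divide_le_eq_1)
      finally have "A s (s * r) \<le> 1 + e / 2" by simp
      moreover have "cosh K \<le> A s (s * r)" using both[of s "s * r"] s dp by (simp add: r_def)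
      ultimately have "cosh K \<le> 1 + e / 2" by (rule order_trans[rotated])
      moreover have "cosh K = 1 + e" by (simp add: e_def)
      ultimately show False using e by simp
    qed
    define C where "C = d a b' + d a' b + d a' b' + 2 * sinh K"
    have bound: "s * (q a b - exp (- K) * d a b) \<le> C" if "s \<ge> 1" for s
    proof -
      have s: "sqrt s > 0" "sqrt s * sqrt s = s" using that by auto
      have "s * q a b \<le> exp (- K) * (2 * A (sqrt s) (sqrt s)) + 2 * sinh K"
        using both[OF s(1) s(1)] s(2) by simp
      also have "2 * A (sqrt s) (sqrt s) = s * d a b + (d a b' + d a' b + 1 / s * d a' b')"
        using s by (simp add: A_def)
      also have "exp (- K) * \<dots> \<le> exp (- K) * (s * d a b) + 1 * (d a b' + d a' b + 1 * d a' b')"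
      proof -
        have "1 / s * d a' b' \<le> 1 * d a' b'" using nn that by (intro mult_right_mono) auto
        then have "exp (- K) * (d a b' + d a' b + 1 / s * d a' b') \<le> 1 * (d a b' + d a' b + 1 * d a' b')"
          using nn K that by (intro mult_mono add_nonneg_nonneg mult_nonneg_nonneg) auto
        then show ?thesis by (simp add: distrib_left)
      qed
      finally show ?thesis by (simp add: C_def algebra_simps)
    qed
    have "q a b \<le> exp (- K) * d a b"
    proof (rule ccontr)
      assume "\<not> q a b \<le> exp (- K) * d a b"
      then have dl: "q a b - exp (- K) * d a b > 0" by simp
      define s where "s = max 1 ((C + 1) / (q a b - exp (- K) * d a b))"
      have "C + 1 = (C + 1) / (q a b - exp (- K) * d a b) * (q a b - exp (- K) * d a b)" using dl by simp
      also have "\<dots> \<le> s * (q a b - exp (- K) * d a b)" using dl by (intro mult_right_mono) (auto simp: s_def)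
      also have "\<dots> \<le> C" by (rule bound) (simp add: s_def)
      finally show False by simp
    qed
    also have "\<dots> < 1 * d a b" using K d0 nn[of a b] by (intro mult_strict_right_mono) auto
    finally have "q a b < d a b" by simp
    then show ?thesis
      using less_iff_power2_less[of "\<bar>area (spin g (spin k a)) (spin g' (spin k' b))\<bar>" "\<bar>area (spin k a) (spin k' b)\<bar>"]
      by (simp add: q_def d_def)
  qed
  show ?thesis unfolding contracting_def
  proof (intro ballI)
    fix a b :: complex assume "a \<in> {1, \<i>}" "b \<in> {1, \<i>}"
    then show "\<bar>area (spin g (spin k a)) (spin g' (spin k' b))\<bar> < \<bar>area (spin k a) (spin k' b)\<bar>"
      by (intro main[of a "if a = 1 then \<i> else 1" b "if b = 1 then \<i> else 1"]) auto
  qed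
qed

section \<open>Half-planes\<close>

definition udisc :: "complex set" where "udisc = {y. cmod y \<le> 1 \<and> Im y > 0}"
text \<open>Since \<open>pt\<close> doubles arguments, the arc of this half-disk corresponds to the
  closed first quadrant of spinors, spanned by 1 and \<i>.\<close>

definition udisc_bar :: "complex set" where "udisc_bar = {y. cmod y \<le> 1 \<and> Im y \<ge> 0}"

lemma mem_hline_bar: "y \<in> hline_bar \<longleftrightarrow> cmod y \<le> 1 \<and> Im y = 0"
proof
  assume "y \<in> hline_bar" then show "cmod y \<le> 1 \<and> Im y = 0" by (auto simp: hline_bar_def)
next
  assume y: "cmod y \<le> 1 \<and> Im y = 0"
  then have "y = of_real (Re y)" "\<bar>Re y\<bar> \<le> 1" using abs_Re_le_cmod[of y] by (auto simp: complex_eq_iff)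
  then show "y \<in> hline_bar" unfolding hline_bar_def by (intro image_eqI[of _ _ "Re y"]) auto
qed

lemma udisc_Un: "udisc \<union> hline_bar = udisc_bar"
  by (auto simp: mem_hline_bar udisc_def udisc_bar_def)

lemma half_turn: "(\<i>, 0) \<in> SU" "cmod z \<le> 1 \<Longrightarrow> mob (\<i>, 0) z = - z"
  by (simp_all add: SU_def mob_def den_def)

lemma image_mmul: "k \<in> SU \<Longrightarrow> m \<in> SU \<Longrightarrow> mob (mmul k m) ` A = mob k ` mob m ` A"
  by (simp add: image_image mob_mmul)

lemma half_turn_hline: "mob (\<i>, 0) ` hline = hline" "mob (\<i>, 0) ` hline_bar = hline_bar"
proof -
  have *: "mob (\<i>, 0) ` complex_of_real ` S = complex_of_real ` S" if "uminus ` S = S" "S \<subseteq> {-1..1}" for S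
  proof -
    have "mob (\<i>, 0) ` complex_of_real ` S = (\<lambda>x. complex_of_real (- x)) ` S"
      unfolding image_image
    proof (intro image_cong refl)
      fix x assume "x \<in> S"
      then have "x \<in> {-1..1}" using that(2) by blast
      then have "cmod (of_real x) \<le> 1" by auto
      then show "mob (\<i>, 0) (complex_of_real x) = complex_of_real (- x)" by (simp add: half_turn(2))
    qed
    also have "\<dots> = complex_of_real ` uminus ` S" by (simp add: image_image)
    finally show ?thesis using that by simp
  qed
  show "mob (\<i>, 0) ` hline = hline" "mob (\<i>, 0) ` hline_bar = hline_bar"
    unfolding hline_def hline_bar_def by (intro *; auto)+
qed

text \<open>Pulled back by k, the component is connected and misses the diameter, so Im keeps its
  sign at y; conversely the half-disk is convex.\<close>

lemma component_udisc:
  assumes k: "k \<in> SU" and y: "y \<in> udisc"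
  shows "connected_component_set (H2bar - mob k ` hline_bar) (mob k y) = mob k ` udisc"
proof
  let ?S = "H2bar - mob k ` hline_bar"
  have inj: "inj_on (mob k) B" for B using mob_inj[OF k] by (simp add: inj_on_def)
  have uS: "mob k ` udisc \<subseteq> ?S"
  proof -
    have "udisc \<inter> hline_bar = {}" by (auto simp: udisc_def hline_bar_def)
    then have "mob k ` udisc \<inter> mob k ` hline_bar = {}" using inj_on_image_Int[OF inj[of UNIV], of udisc hline_bar] by simp
    moreover have "mob k ` udisc \<subseteq> H2bar" using mob_closed[OF k] by (auto simp: udisc_def H2bar_def)
    ultimately show ?thesis by blast
  qed
  have "udisc = cball 0 1 \<inter> {z. Im z > 0}" by (auto simp: udisc_def)
  then have "convex udisc" by (metis convex_Int convex_cball convex_halfspace_Im_gt)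
  then have "connected udisc" by (rule convex_connected)
  moreover have "udisc \<subseteq> cball 0 1" by (auto simp: udisc_def)
  ultimately have "connected (mob k ` udisc)"
    using connected_continuous_image continuous_on_subset continuous_on_mob[OF k] by blast
  then show "mob k ` udisc \<subseteq> connected_component_set ?S (mob k y)"
    using uS y by (intro connected_component_maximal) auto
  let ?C = "connected_component_set ?S (mob k y)"
  have sub: "?C \<subseteq> ?S" by (rule connected_component_subset)
  then have "?C \<subseteq> cball 0 1" by (auto simp: H2bar_def)
  then have conn: "connected (mob (minv k) ` ?C)"
    using connected_continuous_image continuous_on_subset continuous_on_mob[OF minv_SU[OF k]]
      connected_connected_component by blast
  have inc: "mob (minv k) w \<in> cball 0 1 - hline_bar" if "w \<in> ?C" for w
  proof -
    have w: "w \<in> H2bar" "w \<notin> mob k ` hline_bar" using that sub by auto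
    then have "mob (minv k) w \<in> cball 0 1" using mob_H2bar[OF minv_SU[OF k]] by (auto simp: H2bar_def)
    moreover have "mob (minv k) w \<notin> hline_bar" using w k by (metis imageI mob_mob_minv)
    ultimately show ?thesis by blast
  qed
  have "Im v \<noteq> 0" if "v \<in> cball 0 1 - hline_bar" for v
    using that by (simp add: mem_hline_bar)
  then have im: "mob (minv k) ` ?C \<subseteq> {z. Im z > 0} \<union> {z. Im z < 0}" using inc by force
  have "mob k y \<in> ?S" using uS y by auto
  then have "mob k y \<in> ?C" by simp
  then have "y \<in> mob (minv k) ` ?C" using k by (metis image_eqI mob_minv_mob)
  then have "y \<in> {z. Im z > 0} \<inter> mob (minv k) ` ?C" using y by (auto simp: udisc_def)
  moreover have "{z. Im z > 0} \<inter> {z. Im z < 0} \<inter> mob (minv k) ` ?C = {}" by auto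
  ultimately have neg: "{z. Im z < 0} \<inter> mob (minv k) ` ?C = {}"
    using connectedD[OF conn open_halfspace_Im_gt open_halfspace_Im_lt _ im] by blast
  show "?C \<subseteq> mob k ` udisc"
  proof
    fix w assume w: "w \<in> ?C"
    then have "Im (mob (minv k) w) > 0" using im neg by blast
    then have "mob (minv k) w \<in> udisc" using inc[OF w] by (auto simp: udisc_def)
    then show "w \<in> mob k ` udisc" using k by (metis image_eqI mob_mob_minv)
  qed
qed

text \<open>Precomposing k with the half turn keeps the line and exchanges its sides, so either side
  is the image of the upper half-disk.\<close>

lemma side_udisc:
  assumes k: "k \<in> SU" and "side_of (mob k ` hline) P"
  obtains m where "m \<in> SU" "mob m ` hline = mob k ` hline" "P = mob m ` udisc"
proof -
  obtain x where x: "x \<in> H2bar" "x \<notin> mob k ` hline_bar"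
    "P = connected_component_set (H2bar - mob k ` hline_bar) x"
    using assms by (auto simp: side_of_def closure_line)
  define y where "y = mob (minv k) x"
  have xy: "x = mob k y" using k by (simp add: y_def)
  have y: "cmod y \<le> 1" using x mob_H2bar[OF minv_SU[OF k]] by (auto simp: y_def H2bar_def)
  have "y \<notin> hline_bar" using x xy by auto
  then have "Im y \<noteq> 0" using y by (simp add: mem_hline_bar)
  then consider "Im y > 0" | "Im y < 0" by linarith
  then show ?thesis
  proof cases
    case 1
    then have "y \<in> udisc" using y by (simp add: udisc_def)
    then show ?thesis using that[OF k refl] component_udisc[OF k] x(3) xy by simp
  next
    case 2
    let ?m = "mmul k (\<i>, 0)"
    have m: "?m \<in> SU" using k half_turn mmul_SU by blast
    have im: "mob ?m ` hline = mob k ` hline" "mob ?m ` hline_bar = mob k ` hline_bar"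
      using k half_turn(1) by (simp_all add: image_mmul half_turn_hline)
    have "- y \<in> udisc" using 2 y by (simp add: udisc_def)
    moreover have "mob ?m (- y) = x" using k half_turn y by (simp add: mob_mmul xy)
    ultimately show ?thesis using that[OF m im(1)] component_udisc[OF m, of "- y"] x(3) im(2) by simp
  qed
qed

lemma quadrant_pt:
  assumes "\<zeta> \<noteq> 0" "Re \<zeta> \<ge> 0" "Im \<zeta> \<ge> 0" shows "pt \<zeta> \<in> udisc_bar"
proof -
  have "pt \<zeta> = \<zeta> * \<zeta> / of_real ((cmod \<zeta>)\<^sup>2)"
    unfolding complex_norm_square pt_def using assms(1) by simp
  then have "Im (pt \<zeta>) = (2 * Re \<zeta> * Im \<zeta>) / (cmod \<zeta>)\<^sup>2"
    by (simp add: Im_divide_of_real del: of_real_power)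
  then show ?thesis using assms pt_circle by (simp add: udisc_bar_def)
qed

text \<open>Im y \<ge> 0 means that Re \<zeta> and Im \<zeta> do not have opposite signs; the
  overall sign of \<zeta> is free, as \<open>pt\<close> ignores it.\<close>

lemma pt_quadrant:
  assumes "cmod y = 1" "Im y \<ge> 0"
  obtains \<zeta> where "\<zeta> \<noteq> 0" "Re \<zeta> \<ge> 0" "Im \<zeta> \<ge> 0" "y = pt \<zeta>"
proof -
  obtain \<zeta> where z: "\<zeta> \<noteq> 0" "y = pt \<zeta>" using pt_surj[OF assms(1)] .
  have "pt \<zeta> = \<zeta> * \<zeta> / of_real ((cmod \<zeta>)\<^sup>2)"
    unfolding complex_norm_square pt_def using z(1) by simp
  then have "Im y = (2 * Re \<zeta> * Im \<zeta>) / (cmod \<zeta>)\<^sup>2"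
    by (simp add: z Im_divide_of_real del: of_real_power)
  then have "2 * Re \<zeta> * Im \<zeta> = Im y * (cmod \<zeta>)\<^sup>2" using z(1) by simp
  moreover have "Im y * (cmod \<zeta>)\<^sup>2 \<ge> 0" using assms by simp
  ultimately have "Re \<zeta> * Im \<zeta> \<ge> 0" by linarith
  then consider "Re \<zeta> \<ge> 0 \<and> Im \<zeta> \<ge> 0" | "Re \<zeta> \<le> 0 \<and> Im \<zeta> \<le> 0" by (auto simp: zero_le_mult_iff)
  then show ?thesis
  proof cases
    case 1
    then show ?thesis using that z by blast
  next
    case 2
    moreover have "pt (- \<zeta>) = pt \<zeta>" by (simp add: pt_def)
    ultimately show ?thesis using that[of "- \<zeta>"] z by simp
  qed
qed

text \<open>For half-planes facing away from each other the four determinants of the endpoint spinors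
  have equal signs, so no cancellation occurs when the endpoint criterion is extended bilinearly
  to the quadrants representing the half-planes.\<close>

lemma away_same_sign:
  assumes k: "k \<in> SU" "k' \<in> SU"
    and nz: "\<And>a b. a \<in> {1, \<i>} \<Longrightarrow> b \<in> {1, \<i>} \<Longrightarrow> area (spin k a) (spin k' b) \<noteq> 0"
    and away: "mob k' ` hline_bar \<inter> mob k ` udisc_bar = {}"
    and b: "b \<in> {1, \<i>}"
  shows "area (spin k 1) (spin k' b) * area (spin k \<i>) (spin k' b) > 0"
proof (rule ccontr)
  define d e where "d = area (spin k 1) (spin k' b)" and "e = area (spin k \<i>) (spin k' b)"
  assume "\<not> area (spin k 1) (spin k' b) * area (spin k \<i>) (spin k' b) > 0"
  moreover have de: "d \<noteq> 0" "e \<noteq> 0" using nz b by (auto simp: d_def e_def)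
  ultimately have lt: "d * e < 0" by (simp add: d_def e_def not_less order.order_iff_strict)
  \<comment> \<open>As d and e have opposite signs, this nonnegative combination has area 0 against
    \<open>spin k' b\<close>, which puts that endpoint into the closed half-plane of k.\<close>
  define \<zeta> where "\<zeta> = of_real \<bar>e\<bar> * 1 + of_real \<bar>d\<bar> * \<i>"
  have z: "\<zeta> \<noteq> 0" "Re \<zeta> \<ge> 0" "Im \<zeta> \<ge> 0" using de by (auto simp: \<zeta>_def complex_eq_iff)
  have "area (spin k \<zeta>) (spin k' b) = \<bar>e\<bar> * d + \<bar>d\<bar> * e"
    unfolding \<zeta>_def spin_add spin_scale area_add_left area_scale_left d_def e_def ..
  also have "\<dots> = 0" using lt by (auto simp: mult_less_0_iff)
  finally have "pt (spin k \<zeta>) = pt (spin k' b)"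
    using z b k spin_eq_0_iff by (subst pt_eq_iff) auto
  then have "mob k (pt \<zeta>) = mob k' (pt b)" using k z b basis_pt by (simp add: mob_pt)
  moreover have "pt \<zeta> \<in> udisc_bar" using quadrant_pt z by blast
  ultimately show False using away basis_pt[OF b] by blast
qed

lemma away_not_meet:
  assumes g: "g \<in> SU" "g' \<in> SU" "k \<in> SU" "k' \<in> SU" and c: "contracting g g' k k'"
    and away: "mob k' ` hline_bar \<inter> mob k ` udisc_bar = {}" "mob k ` hline_bar \<inter> mob k' ` udisc_bar = {}"
  shows "\<not> meet g g' (mob k ` udisc_bar) (mob k' ` udisc_bar)"
proof (rule not_meet_if_null[OF g])
  let ?Z = "{\<zeta>. Re \<zeta> \<ge> 0 \<and> Im \<zeta> \<ge> 0}"
  show dec: "cmod y \<le> 1 \<and> (\<exists>a\<in>?Z. \<exists>b\<in>?Z. 1 + (cmod y)\<^sup>2 = (cmod a)\<^sup>2 + (cmod b)\<^sup>2 \<and> 2 * y = a\<^sup>2 + b\<^sup>2)"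
    if y: "y \<in> udisc_bar" for y
  proof -
    have y: "cmod y \<le> 1" "Im y \<ge> 0" using y by (auto simp: udisc_bar_def)
    then show ?thesis using half_disc_null[OF y] by (metis (no_types, lifting) mem_Collect_eq)
  qed
  show "cmod y \<le> 1 \<and> (\<exists>a\<in>?Z. \<exists>b\<in>?Z. 1 + (cmod y)\<^sup>2 = (cmod a)\<^sup>2 + (cmod b)\<^sup>2 \<and> 2 * y = a\<^sup>2 + b\<^sup>2)"
    if y: "y \<in> udisc_bar" for y using dec[OF y] .
  define d q where "d u v = area (spin k u) (spin k' v)"
    and "q u v = area (spin g (spin k u)) (spin g' (spin k' v))" for u v
  have qd: "\<bar>q a b\<bar> < \<bar>d a b\<bar>" if "a \<in> {1, \<i>}" "b \<in> {1, \<i>}" for a b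
    using c that unfolding contracting_def d_def q_def by blast
  then have nz: "d a b \<noteq> 0" if "a \<in> {1, \<i>}" "b \<in> {1, \<i>}" for a b using that by fastforce
  have s1: "d 1 b * d \<i> b > 0" if "b \<in> {1, \<i>}" for b
    using away_same_sign[OF g(3,4) _ away(1) that] nz unfolding d_def by blast
  have "area (spin k' 1) (spin k a) * area (spin k' \<i>) (spin k a) > 0" if "a \<in> {1, \<i>}" for a
    using away_same_sign[OF g(4,3) _ away(2) that] nz unfolding d_def
    by (metis area_swap neg_equal_0_iff_equal)
  then have s2: "d a 1 * d a \<i> > 0" if "a \<in> {1, \<i>}" for a
    using that unfolding d_def by (metis area_swap minus_mult_minus)
  \<comment> \<open>The common sign \<sigma> turns the sum of the |d a b| into \<sigma> * d u v; for
    q the triangle inequality is enough.\<close>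
  have sg: "\<exists>\<sigma>. \<bar>\<sigma>\<bar> = 1 \<and> (\<forall>a\<in>{1, \<i>}. \<forall>b\<in>{1, \<i>}. \<bar>d a b\<bar> = \<sigma> * d a b)"
  proof (cases "d 1 1 > 0")
    case True
    then have "d \<i> 1 > 0" "d 1 \<i> > 0" using s1[of 1] s2[of 1] by (auto simp: zero_less_mult_iff)
    moreover then have "d \<i> \<i> > 0" using s1[of \<i>] by (auto simp: zero_less_mult_iff)
    ultimately show ?thesis using True by (intro exI[of _ 1]) auto
  next
    case False
    then have "d 1 1 < 0" using nz[of 1 1] by simp
    moreover then have "d \<i> 1 < 0" "d 1 \<i> < 0" using s1[of 1] s2[of 1] by (auto simp: zero_less_mult_iff)
    moreover then have "d \<i> \<i> < 0" using s1[of \<i>] by (auto simp: zero_less_mult_iff)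
    ultimately show ?thesis by (intro exI[of _ "-1"]) auto
  qed
  then obtain \<sigma> where \<sigma>: "\<bar>\<sigma>\<bar> = 1" "\<And>a b. a \<in> {1, \<i>} \<Longrightarrow> b \<in> {1, \<i>} \<Longrightarrow> \<bar>d a b\<bar> = \<sigma> * d a b" by blast
  fix u v :: complex assume uv: "u \<in> ?Z" "v \<in> ?Z" "u \<noteq> 0" "v \<noteq> 0"
  define x1 x2 y1 y2 where "x1 = Re u" and "x2 = Im u" and "y1 = Re v" and "y2 = Im v"
  have nn: "x1 \<ge> 0" "x2 \<ge> 0" "y1 \<ge> 0" "y2 \<ge> 0" using uv by (auto simp: x1_def x2_def y1_def y2_def)
  have u: "u = of_real x1 * 1 + of_real x2 * \<i>" and v: "v = of_real y1 * 1 + of_real y2 * \<i>"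
    by (simp_all add: complex_eq_iff x1_def x2_def y1_def y2_def)
  have bil: "d u v = x1 * y1 * d 1 1 + x1 * y2 * d 1 \<i> + x2 * y1 * d \<i> 1 + x2 * y2 * d \<i> \<i>"
    "q u v = x1 * y1 * q 1 1 + x1 * y2 * q 1 \<i> + x2 * y1 * q \<i> 1 + x2 * y2 * q \<i> \<i>"
    unfolding d_def q_def u v spin_add spin_scale area_add_left area_add_right area_scale_left area_scale_right
    by (simp_all add: algebra_simps)
  have "\<bar>q u v\<bar> \<le> x1 * y1 * \<bar>q 1 1\<bar> + x1 * y2 * \<bar>q 1 \<i>\<bar> + x2 * y1 * \<bar>q \<i> 1\<bar> + x2 * y2 * \<bar>q \<i> \<i>\<bar>"
  proof -
    have "\<bar>q u v\<bar> \<le> \<bar>x1 * y1 * q 1 1\<bar> + \<bar>x1 * y2 * q 1 \<i>\<bar> + \<bar>x2 * y1 * q \<i> 1\<bar> + \<bar>x2 * y2 * q \<i> \<i>\<bar>"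
      unfolding bil by linarith
    then show ?thesis using nn by (simp add: abs_mult)
  qed
  also have "\<dots> < x1 * y1 * \<bar>d 1 1\<bar> + x1 * y2 * \<bar>d 1 \<i>\<bar> + x2 * y1 * \<bar>d \<i> 1\<bar> + x2 * y2 * \<bar>d \<i> \<i>\<bar>"
  proof -
    have le: "x * y * \<bar>q a b\<bar> \<le> x * y * \<bar>d a b\<bar>" if "a \<in> {1, \<i>}" "b \<in> {1, \<i>}" "x \<ge> 0" "y \<ge> 0" for a b x y
      using qd[OF that(1,2)] that by (intro mult_left_mono) auto
    have lt: "x * y * \<bar>q a b\<bar> < x * y * \<bar>d a b\<bar>" if "a \<in> {1, \<i>}" "b \<in> {1, \<i>}" "x > 0" "y > 0" for a b x y
      using qd[OF that(1,2)] that by (intro mult_strict_left_mono) auto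
    have "x1 > 0 \<or> x2 > 0" "y1 > 0 \<or> y2 > 0" using uv nn unfolding u v by (auto simp: less_le)
    then consider "x1 > 0" "y1 > 0" | "x1 > 0" "y2 > 0" | "x2 > 0" "y1 > 0" | "x2 > 0" "y2 > 0" by blast
    moreover have L: "x1 * y1 * \<bar>q 1 1\<bar> \<le> x1 * y1 * \<bar>d 1 1\<bar>" "x1 * y2 * \<bar>q 1 \<i>\<bar> \<le> x1 * y2 * \<bar>d 1 \<i>\<bar>" "x2 * y1 * \<bar>q \<i> 1\<bar> \<le> x2 * y1 * \<bar>d \<i> 1\<bar>" "x2 * y2 * \<bar>q \<i> \<i>\<bar> \<le> x2 * y2 * \<bar>d \<i> \<i>\<bar>"
      using nn by (intro le; simp)+
    ultimately show ?thesis
    proof cases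
      case 1
      then have "x1 * y1 * \<bar>q 1 1\<bar> < x1 * y1 * \<bar>d 1 1\<bar>" by (intro lt) auto
      then show ?thesis using L by linarith
    next
      case 2
      then have "x1 * y2 * \<bar>q 1 \<i>\<bar> < x1 * y2 * \<bar>d 1 \<i>\<bar>" by (intro lt) auto
      then show ?thesis using L by linarith
    next
      case 3
      then have "x2 * y1 * \<bar>q \<i> 1\<bar> < x2 * y1 * \<bar>d \<i> 1\<bar>" by (intro lt) auto
      then show ?thesis using L by linarith
    next
      case 4
      then have "x2 * y2 * \<bar>q \<i> \<i>\<bar> < x2 * y2 * \<bar>d \<i> \<i>\<bar>" by (intro lt) auto
      then show ?thesis using L by linarith
    qed
  qed
  also have "\<dots> = \<sigma> * d u v" unfolding bil by (simp add: \<sigma> algebra_simps)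
  also have "\<dots> \<le> \<bar>d u v\<bar>" using \<sigma>(1) by (metis abs_ge_self abs_mult mult_1)
  finally show "\<bar>area (spin g (spin k u)) (spin g' (spin k' v))\<bar> < \<bar>area (spin k u) (spin k' v)\<bar>"
    by (simp add: d_def q_def)
qed

text \<open>If the positive side of the first line contains the second line, one endpoint of the latter
  already gives a common element, after perturbing the fixed point in the half-plane.\<close>

lemma facing_meet:
  assumes g: "g \<in> SU" "g' \<in> SU" "k \<in> SU" "k' \<in> SU" and c: "contracting g g' k k'"
    and disj: "mob k ` hline_bar \<inter> mob k' ` hline_bar = {}"
    and face: "mob k' ` hline_bar \<inter> mob k ` udisc_bar \<noteq> {}"
  shows "meet g g' (mob k ` udisc_bar) (mob k' ` hline_bar)"
proof -
  obtain w where w: "w \<in> mob k' ` hline_bar" "w \<in> mob k ` udisc" using face disj udisc_Un by blast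
  then obtain y0 where y0: "y0 \<in> udisc" "w = mob k y0" by blast
  have "connected hline_bar" unfolding hline_bar_def
    by (intro connected_continuous_image continuous_intros) auto
  then have "connected (mob k' ` hline_bar)"
    using connected_continuous_image continuous_on_subset continuous_on_mob[OF g(4)] hline_bar_cball by blast
  moreover have "mob k' ` hline_bar \<subseteq> H2bar - mob k ` hline_bar"
    using disj mob_closed[OF g(4)] hline_bar_cball by (force simp: H2bar_def)
  \<comment> \<open>The closed second line is connected and avoids the first, so one point on the
    positive side puts all of it there, endpoints included.\<close>
  ultimately have "mob k' ` hline_bar \<subseteq> connected_component_set (H2bar - mob k ` hline_bar) w"
    using w(1) by (intro connected_component_maximal)
  then have sub: "mob k' ` hline_bar \<subseteq> mob k ` udisc" using component_udisc[OF g(3) y0(1)] y0(2) by simp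
  have p1: "pt 1 \<in> hline_bar" using basis_pt by blast
  then have "mob k' 1 \<in> mob k ` udisc" using sub by auto
  then obtain y where y: "y \<in> udisc" "mob k' 1 = mob k y" by blast
  have "cmod (mob k y) = 1" using y(2) mob_circle[OF g(4), of 1] by simp
  then have "cmod y = 1" using mob_circle[OF minv_SU[OF g(3)], of "mob k y"] g(3) by simp
  moreover have "Im y \<ge> 0" using y by (simp add: udisc_def)
  ultimately obtain \<zeta> where z: "\<zeta> \<noteq> 0" "Re \<zeta> \<ge> 0" "Im \<zeta> \<ge> 0" "y = pt \<zeta>" by (rule pt_quadrant)
  define d q where "d u = area (spin k u) (spin k' 1)"
    and "q u = area (spin g (spin k u)) (spin g' (spin k' 1))" for u
  have "pt (spin k \<zeta>) = pt (spin k' 1)" using y z g by (simp flip: mob_pt)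
  then have d0: "d \<zeta> = 0"
    unfolding d_def using z spin_eq_0_iff g by (subst (asm) pt_eq_iff) auto
  obtain \<eta> where e: "\<eta> \<noteq> 0" "Re \<eta> \<ge> 0" "Im \<eta> \<ge> 0" "\<bar>d \<eta>\<bar> \<le> \<bar>q \<eta>\<bar>" "d \<eta> \<noteq> 0 \<or> q \<eta> = 0"
  proof (cases "q \<zeta> = 0")
    case True
    then show ?thesis using that z d0 by simp
  next
    case False
    have d1: "d 1 \<noteq> 0" using c unfolding contracting_def d_def by fastforce
    \<comment> \<open>Adding \<epsilon> times 1 stays in the quadrant and makes d nonzero, and |q
      \<eta>| \<ge> |q \<zeta>| - \<epsilon> |q 1| = \<epsilon> |d 1| = |d \<eta>|.\<close>
    define \<epsilon> where "\<epsilon> = \<bar>q \<zeta>\<bar> / (\<bar>d 1\<bar> + \<bar>q 1\<bar>)"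
    have pos: "\<bar>d 1\<bar> + \<bar>q 1\<bar> > 0" using d1 by linarith
    have \<epsilon>: "\<epsilon> > 0" using False pos by (simp add: \<epsilon>_def)
    have eq: "\<epsilon> * \<bar>d 1\<bar> + \<epsilon> * \<bar>q 1\<bar> = \<bar>q \<zeta>\<bar>"
      unfolding distrib_left[symmetric] \<epsilon>_def using pos by simp
    define \<eta> where "\<eta> = \<zeta> + of_real \<epsilon> * 1"
    have de: "d \<eta> = \<epsilon> * d 1" "q \<eta> = q \<zeta> + \<epsilon> * q 1"
      unfolding \<eta>_def d_def q_def spin_add spin_scale area_add_left area_scale_left
      using d0 by (simp_all add: d_def)
    have "\<bar>d \<eta>\<bar> = \<epsilon> * \<bar>d 1\<bar>" "\<bar>\<epsilon> * q 1\<bar> = \<epsilon> * \<bar>q 1\<bar>" using \<epsilon> by (simp_all add: de abs_mult)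
    then have "\<bar>d \<eta>\<bar> \<le> \<bar>q \<eta>\<bar>" unfolding de(2) using eq by linarith
    moreover have re: "Re \<eta> > 0" "Im \<eta> \<ge> 0" using z \<epsilon> by (auto simp: \<eta>_def)
    moreover have "d \<eta> \<noteq> 0" using de \<epsilon> d1 by simp
    moreover have "\<eta> \<noteq> 0" using re(1) by auto
    ultimately show ?thesis using that[of \<eta>] by simp
  qed
  show ?thesis
    by (rule meet_spinors[OF g e(1) _ quadrant_pt[OF e(1-3)] p1]) (use e in \<open>simp_all add: d_def q_def\<close>)
qed

text \<open>At a common interior point take x = x': distance 0 cannot decrease. A common ideal point
  is a common endpoint, where the area is 0 and cannot shrink strictly.\<close>

lemma uniform_closures_disjoint:
  assumes g: "g \<in> SU" "g' \<in> SU" "k \<in> SU" "k' \<in> SU" and K: "K > 0"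
    and le: "\<And>x x'. x \<in> mob k ` hline \<Longrightarrow> x' \<in> mob k' ` hline \<Longrightarrow> hdist (mob g x) (mob g' x') - hdist x x' \<le> - K"
  shows "mob k ` hline_bar \<inter> mob k' ` hline_bar = {}"
proof (rule equals0I)
  fix z assume "z \<in> mob k ` hline_bar \<inter> mob k' ` hline_bar"
  then obtain y y' where y: "y \<in> hline_bar" "y' \<in> hline_bar" "z = mob k y" "z = mob k' y'" by blast
  have hl: "v \<in> hline \<or> v \<in> {1, -1}" if v: "v \<in> hline_bar" for v
  proof -
    obtain t where t: "v = of_real t" "-1 \<le> t" "t \<le> 1" using v by (auto simp: hline_bar_def)
    then consider "t = 1" | "t = -1" | "-1 < t" "t < 1" by linarith
    then show ?thesis using t by cases (auto simp: hline_def)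
  qed
  show False
  proof (cases "cmod z < 1")
    case True
    have "v \<in> hline" if "m \<in> SU" "v \<in> hline_bar" "z = mob m v" for m v
      using hl[OF that(2)] True mob_circle[OF that(1)] that(3) by fastforce
    then have "z \<in> mob k ` hline" "z \<in> mob k' ` hline" using y g by blast+
    then have "hdist (mob g z) (mob g' z) - hdist z z \<le> - K" by (rule le)
    moreover have "hdist z z = 0" by (simp add: hdist_def)
    moreover have "z \<in> H2" using True by (simp add: H2_def)
    then have "hdist (mob g z) (mob g' z) \<ge> 0" using cosh_hdist(2) mob_H2[OF g(1)] mob_H2[OF g(2)] by blast
    ultimately show False using K by linarith
  next
    case False
    have "v \<in> {1, -1}" if "m \<in> SU" "v \<in> hline_bar" "z = mob m v" for m v
      using hl[OF that(2)] False mob_H2[OF that(1)] hline_H2 that(3) by (auto simp: H2_def)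
    then have "y \<in> {1, -1}" "y' \<in> {1, -1}" using y g(3,4) by blast+
    then have "y \<in> {pt 1, pt \<i>}" "y' \<in> {pt 1, pt \<i>}" by simp_all
    then obtain a b where ab: "a \<in> {1, \<i>}" "b \<in> {1, \<i>}" "y = pt a" "y' = pt b" by blast
    then have nz: "a \<noteq> 0" "b \<noteq> 0" by auto
    then have "pt (spin k a) = pt (spin k' b)" using y ab g by (metis mob_pt)
    then have "area (spin k a) (spin k' b) = 0" using nz g by (simp add: pt_eq_iff spin_eq_0_iff)
    moreover have "contracting g g' k k'" using uniform_contracting[OF g K le] .
    ultimately show False using ab unfolding contracting_def by fastforce
  qed
qed

section \<open>The equivalences and the half-space criterion\<close>

theorem theorem3p2:
  fixes l l' :: "complex set" and g g' :: "complex \<Rightarrow> complex"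
  assumes "geodesic_line l" and "geodesic_line l'" and "g \<in> G0" and "g' \<in> G0"
  shows "((lmul g (Cstar l) \<inter> lmul g' (Cstar l') = {})
           \<longleftrightarrow> (\<exists>K>0. \<forall>x\<in>l. \<forall>x'\<in>l'. hdist (g x) (g' x') - hdist x x' \<le> - K))
       \<and> ((\<exists>K>0. \<forall>x\<in>l. \<forall>x'\<in>l'. hdist (g x) (g' x') - hdist x x' \<le> - K)
           \<longleftrightarrow> (\<forall>xi\<in>endpoints l. \<forall>xi'\<in>endpoints l'. xi \<noteq> xi' \<and> F_ideal g g' xi xi' < 0))
       \<and> (lmul g (Cstar l) \<inter> lmul g' (Cstar l') = {} \<longrightarrow> closure l \<inter> closure l' = {})
       \<and> (\<forall>P P'. side_of l P \<longrightarrow> side_of l' P' \<longrightarrow>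
            (lmul g (Hstar_plus_closed l P) \<inter> lmul g' (Hstar_plus_closed l' P') = {}
             \<longleftrightarrow> (lmul g (Cstar l) \<inter> lmul g' (Cstar l') = {}
                 \<and> (\<exists>K>0. \<forall>x\<in>l. \<forall>x'\<in>l'. hdist (g x) (g' x') - hdist x x' \<le> - K)
                 \<and> (\<forall>xi\<in>endpoints l. \<forall>xi'\<in>endpoints l'. xi \<noteq> xi' \<and> F_ideal g g' xi xi' < 0)
                 \<and> oriented_away l P l' P')))"
proof -
  obtain m where m: "m \<in> SU" "g = mob m" using assms(3) by (auto simp: G0_eq)
  obtain m' where m': "m' \<in> SU" "g' = mob m'" using assms(4) by (auto simp: G0_eq)
  obtain k where k: "k \<in> SU" "l = mob k ` hline" using geodesic_line_hline[OF assms(1)] .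
  obtain k' where k': "k' \<in> SU" "l' = mob k' ` hline" using geodesic_line_hline[OF assms(2)] .
  \<comment> \<open>Stated for all representatives k, k', because adapting them to the sides P, P'
    changes them; condition (1) is independent of that choice and so transfers
    \<open>contracting\<close>.\<close>
  have one: "lmul g (Cstar l) \<inter> lmul g' (Cstar l') = {} \<longleftrightarrow> contracting m m' k k'"
    if "k \<in> SU" "k' \<in> SU" "l = mob k ` hline" "l' = mob k' ` hline" for k k'
    using contracting_not_meet[OF m(1) m'(1) that(1,2)] not_contracting_meet[OF m(1) m'(1) that(1,2)]
    unfolding Cstar_fixing m(2) m'(2) meet_iff that(3,4) closure_line[OF that(1)] closure_line[OF that(2)]
    by blast
  note one' = one[OF k(1) k'(1) k(2) k'(2)]
  have two: "(\<exists>K>0. \<forall>x\<in>l. \<forall>x'\<in>l'. hdist (g x) (g' x') - hdist x x' \<le> - K) \<longleftrightarrow> contracting m m' k k'"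
    using contracting_uniform[OF m(1) m'(1) k(1) k'(1)] uniform_contracting[OF m(1) m'(1) k(1) k'(1)]
    unfolding m(2) m'(2) k(2) k'(2) by metis
  have three: "(\<forall>xi\<in>endpoints l. \<forall>xi'\<in>endpoints l'. xi \<noteq> xi' \<and> F_ideal g g' xi xi' < 0) \<longleftrightarrow> contracting m m' k k'"
    unfolding m(2) m'(2) k(2) k'(2) by (rule endpoints_contracting_iff[OF m(1) m'(1) k(1) k'(1)])
  have disj: "closure l \<inter> closure l' = {}" if "contracting m m' k k'"
    using contracting_uniform[OF m(1) m'(1) k(1) k'(1) that]
      uniform_closures_disjoint[OF m(1) m'(1) k(1) k'(1)]
    unfolding k(2) k'(2) closure_line[OF k(1)] closure_line[OF k'(1)] by blast
  have four: "lmul g (Hstar_plus_closed l P) \<inter> lmul g' (Hstar_plus_closed l' P') = {}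
      \<longleftrightarrow> contracting m m' k k' \<and> oriented_away l P l' P'"
    if side: "side_of l P" "side_of l' P'" for P P'
  proof -
    obtain n where n: "n \<in> SU" "l = mob n ` hline" "P = mob n ` udisc"
      using side_udisc[OF k(1)] side(1) k(2) by metis
    obtain n' where n': "n' \<in> SU" "l' = mob n' ` hline" "P' = mob n' ` udisc"
      using side_udisc[OF k'(1)] side(2) k'(2) by metis
    have con: "contracting m m' k k' \<longleftrightarrow> contracting m m' n n'"
      using one' one[OF n(1) n'(1) n(2) n'(2)] by simp
    note SU4 = m(1) m'(1) n(1) n'(1)
    have cl: "closure l = mob n ` hline_bar" "closure l' = mob n' ` hline_bar"
      unfolding n(2) n'(2) using closure_line n(1) n'(1) by auto
    have cb: "mob k ` hline_bar \<subseteq> H2bar" if "k \<in> SU" for k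
      using mob_closed[OF that] hline_bar_cball by (force simp: H2bar_def)
    have ne: "hline_bar \<noteq> {}" by (auto simp: hline_bar_def)
    have half: "P \<union> closure l = mob n ` udisc_bar" "P' \<union> closure l' = mob n' ` udisc_bar"
      unfolding cl n(3) n'(3) image_Un[symmetric] udisc_Un by (rule refl)+
    have H: "Hstar_plus_closed l P = fixing (mob n ` udisc_bar)"
      "Hstar_plus_closed l' P' = fixing (mob n' ` udisc_bar)"
      using Hstar_plus_closed_fixing[of l P] Hstar_plus_closed_fixing[of l' P'] cb[OF n(1)] cb[OF n'(1)] ne
      unfolding half unfolding cl by auto
    have or: "oriented_away l P l' P' \<longleftrightarrow> mob n' ` hline_bar \<inter> mob n ` udisc_bar = {}
        \<and> mob n ` hline_bar \<inter> mob n' ` udisc_bar = {}"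
    proof -
      have *: "A \<subseteq> C - B - Q \<longleftrightarrow> A \<inter> (Q \<union> B) = {}" if "A \<subseteq> C" for A B C Q :: "complex set"
        using that by blast
      have "closure l \<subseteq> H2bar" "closure l' \<subseteq> H2bar" unfolding cl using cb n(1) n'(1) by auto
      then show ?thesis unfolding oriented_away_def by (simp only: * half) (simp only: cl)
    qed
    have sub: "mob j ` hline_bar \<subseteq> mob j ` udisc_bar" for j using udisc_Un by blast
    have L: "lmul g (Hstar_plus_closed l P) \<inter> lmul g' (Hstar_plus_closed l' P') = {}
       \<longleftrightarrow> \<not> meet m m' (mob n ` udisc_bar) (mob n' ` udisc_bar)"
      unfolding H m(2) m'(2) by (rule meet_iff)
    show ?thesis unfolding L con
    proof
      assume nm: "\<not> meet m m' (mob n ` udisc_bar) (mob n' ` udisc_bar)"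
      then have "\<not> meet m m' (mob n ` hline_bar) (mob n' ` hline_bar)" by (meson meet_mono sub)
      then have c: "contracting m m' n n'" using not_contracting_meet[OF SU4] by blast
      then have dj: "mob n ` hline_bar \<inter> mob n' ` hline_bar = {}" using disj con cl by simp
      have "mob n' ` hline_bar \<inter> mob n ` udisc_bar = {}"
      proof (rule ccontr)
        assume "mob n' ` hline_bar \<inter> mob n ` udisc_bar \<noteq> {}"
        from meet_mono[OF facing_meet[OF SU4 c dj this] subset_refl sub] nm show False by contradiction
      qed
      moreover have "mob n ` hline_bar \<inter> mob n' ` udisc_bar = {}"
      proof (rule ccontr)
        assume "mob n ` hline_bar \<inter> mob n' ` udisc_bar \<noteq> {}"
        from facing_meet[OF m'(1) m(1) n'(1) n(1) contracting_sym[OF c] _ this] dj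
        have "meet m' m (mob n' ` udisc_bar) (mob n ` hline_bar)" by (simp add: Int_commute)
        from meet_mono[OF meet_sym[OF this] sub subset_refl] nm show False by contradiction
      qed
      ultimately show "contracting m m' n n' \<and> oriented_away l P l' P'" unfolding or using c by simp
    next
      assume "contracting m m' n n' \<and> oriented_away l P l' P'"
      then show "\<not> meet m m' (mob n ` udisc_bar) (mob n' ` udisc_bar)"
        unfolding or by (intro away_not_meet[OF SU4]) simp_all
    qed
  qed
  show ?thesis unfolding one' two three using disj four by simp
qed

end
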